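(* Let $\Omega\subset\mathbb{R}^n$ be a nonempty open set. The map $\mathbb{G}\ni G\mapsto U_G\in\mathcal{U}_{R(A^{1/2})}(H^1_0)$ is a continuous group isomorphism (both groups carrying the topology induced by the norm of $\mathcal{B}(H^1_0)$). Its inverse is not continuous.
   Context: $L^2=L^2(\Omega,dx)$ is the complex Lebesgue space with its usual inner product $\langle\cdot,\cdot\rangle$, and $H^1_0=H^1_0(\Omega)$ is the closure in the Sobolev norm of the complex-valued $C^\infty$ functions with compact support in $\Omega$, a Hilbert space with inner product $[f,g]=\int_\Omega f\bar g\,dx+\int_\Omega\nabla f\cdot\nabla\bar g\,dx$. $\mathcal{B}(H^1_0)$ is the algebra of bounded operators on $H^1_0$ with the operator norm, $Gl(H^1_0)$ its invertible group and $U(H^1_0)$ the unitary group of $(H^1_0,[\cdot,\cdot])$. $\mathbb{G}=\{G\in Gl(H^1_0):\langle Gf,Gg\rangle=\langle f,g\rangle\ \text{for all } f,g\in H^1_0\}$. $A\in\mathcal{B}(H^1_0)$ is the positive operator determined by $[Af,g]=\langle f,g\rangle$ for all $f,g\in H^1_0$, $A^{1/2}$ its positive square root in $\mathcal{B}(H^1_0)$, $R(A^{1/2})=A^{1/2}(H^1_0)$ its range, and $\mathcal{U}_{R(A^{1/2})}(H^1_0)=\{U\in U(H^1_0):U(R(A^{1/2}))=R(A^{1/2})\}$. For $G\in\mathbb{G}$, $U_G$ is the unique unitary operator on $H^1_0$ such that $U_GA^{1/2}=A^{1/2}G$. *)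

theory Defs
  imports "HOL-Analysis.Analysis" "HOL-Algebra.Bij"
begin

section \<open>Bounded operators on a complex inner product space given by a carrier set\<close>

class complex_vector = ab_group_add +
  fixes scaleC :: "complex \<Rightarrow> 'a \<Rightarrow> 'a" (infixr "*\<^sub>C" 75)
  assumes scaleC_add_right: "a *\<^sub>C (x + y) = a *\<^sub>C x + a *\<^sub>C y"
    and scaleC_add_left: "(a + b) *\<^sub>C x = a *\<^sub>C x + b *\<^sub>C x"
    and scaleC_scaleC: "a *\<^sub>C (b *\<^sub>C x) = (a * b) *\<^sub>C x"
    and scaleC_one: "1 *\<^sub>C x = x"

text \<open>
  In the following, \<open>H\<close> is the underlying set of the space and \<open>ip\<close> its inner product, linear in
  the first argument. Operators on \<open>H\<close> are extensional functions, as in \<^const>\<open>BijGroup\<close>, so that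
  equality of operators is equality in HOL.
\<close>

definition ip_norm :: "('a \<Rightarrow> 'a \<Rightarrow> complex) \<Rightarrow> 'a \<Rightarrow> real" where
  "ip_norm ip x = sqrt (Re (ip x x))"

definition bounded_ops :: "'a::complex_vector set \<Rightarrow> ('a \<Rightarrow> 'a \<Rightarrow> complex) \<Rightarrow> ('a \<Rightarrow> 'a) set" where
  "bounded_ops H ip = {T \<in> H \<rightarrow>\<^sub>E H.
     (\<forall>x\<in>H. \<forall>y\<in>H. T (x + y) = T x + T y) \<and>
     (\<forall>c. \<forall>x\<in>H. T (c *\<^sub>C x) = c *\<^sub>C T x) \<and>
     (\<exists>C. \<forall>x\<in>H. ip_norm ip (T x) \<le> C * ip_norm ip x)}"

definition op_norm :: "'a set \<Rightarrow> ('a \<Rightarrow> 'a \<Rightarrow> complex) \<Rightarrow> ('a \<Rightarrow> 'a) \<Rightarrow> real" where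
  "op_norm H ip T = (SUP x\<in>{x\<in>H. ip_norm ip x \<le> 1}. ip_norm ip (T x))"

text \<open>The value 0 for functions outside \<open>bounded_ops H ip\<close> is irrelevant to the topology below; it is
  there because \<^locale>\<open>Metric_space\<close> requires the distance to be nonnegative on the whole type.\<close>

definition op_dist ::
  "'a::complex_vector set \<Rightarrow> ('a \<Rightarrow> 'a \<Rightarrow> complex) \<Rightarrow> ('a \<Rightarrow> 'a) \<Rightarrow> ('a \<Rightarrow> 'a) \<Rightarrow> real" where
  "op_dist H ip S T =
     (if S \<in> bounded_ops H ip \<and> T \<in> bounded_ops H ip
      then op_norm H ip (\<lambda>x\<in>H. S x - T x) else 0)"

definition norm_topology ::
  "'a::complex_vector set \<Rightarrow> ('a \<Rightarrow> 'a \<Rightarrow> complex) \<Rightarrow> ('a \<Rightarrow> 'a) topology" where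
  "norm_topology H ip = Metric_space.mtopology (bounded_ops H ip) (op_dist H ip)"

definition invertible_ops ::
  "'a::complex_vector set \<Rightarrow> ('a \<Rightarrow> 'a \<Rightarrow> complex) \<Rightarrow> ('a \<Rightarrow> 'a) set" where
  "invertible_ops H ip = {T \<in> bounded_ops H ip. \<exists>S \<in> bounded_ops H ip.
     compose H S T = (\<lambda>x\<in>H. x) \<and> compose H T S = (\<lambda>x\<in>H. x)}"

definition unitary_ops ::
  "'a::complex_vector set \<Rightarrow> ('a \<Rightarrow> 'a \<Rightarrow> complex) \<Rightarrow> ('a \<Rightarrow> 'a) set" where
  "unitary_ops H ip = {U \<in> invertible_ops H ip. \<forall>x\<in>H. \<forall>y\<in>H. ip (U x) (U y) = ip x y}"

definition positive_op :: "'a set \<Rightarrow> ('a \<Rightarrow> 'a \<Rightarrow> complex) \<Rightarrow> ('a \<Rightarrow> 'a) \<Rightarrow> bool" where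
  "positive_op H ip T \<longleftrightarrow> (\<forall>x\<in>H. ip (T x) x \<in> \<real>\<^sub>\<ge>\<^sub>0)"

definition sqrt_op ::
  "'a::complex_vector set \<Rightarrow> ('a \<Rightarrow> 'a \<Rightarrow> complex) \<Rightarrow> ('a \<Rightarrow> 'a) \<Rightarrow> ('a \<Rightarrow> 'a)" where
  "sqrt_op H ip T = (THE S. S \<in> bounded_ops H ip \<and> positive_op H ip S \<and> compose H S S = T)"


section \<open>Test functions\<close>

definition pderiv_at :: "'n \<Rightarrow> (real^'n \<Rightarrow> complex) \<Rightarrow> real^'n \<Rightarrow> complex" where
  "pderiv_at j f x = frechet_derivative f (at x) (axis j 1)"

primrec C_k :: "nat \<Rightarrow> (real^'n \<Rightarrow> complex) \<Rightarrow> bool" where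
  "C_k 0 f \<longleftrightarrow> continuous_on UNIV f"
| "C_k (Suc k) f \<longleftrightarrow> (\<forall>x. f differentiable (at x)) \<and> (\<forall>j. C_k k (pderiv_at j f))"

text \<open>Functions with compact support in \<open>\<Omega>\<close> are extended by 0 to the whole space.\<close>

definition test_function :: "(real^'n) set \<Rightarrow> (real^'n \<Rightarrow> complex) \<Rightarrow> bool" where
  "test_function \<Omega> \<phi> \<longleftrightarrow>
     (\<forall>k. C_k k \<phi>) \<and> compact (closure {x. \<phi> x \<noteq> 0}) \<and> closure {x. \<phi> x \<noteq> 0} \<subseteq> \<Omega>"


section \<open>Lebesgue measurable functions modulo equality almost everywhere\<close>

quotient_type (overloaded) 'n ae_fun = "real^('n::finite) \<Rightarrow> complex" / partial:
  "\<lambda>f g. f \<in> borel_measurable lebesgue \<and> g \<in> borel_measurable lebesgue \<and>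
         (AE x in lebesgue. f x = g x)"
proof (rule part_equivpI)
  show "\<exists>f :: real^'n \<Rightarrow> complex. f \<in> borel_measurable lebesgue \<and> f \<in> borel_measurable lebesgue \<and>
         (AE x in lebesgue. f x = f x)"
    by (rule exI[of _ "\<lambda>_. 0"]) simp
qed (auto intro!: sympI transpI elim: eventually_elim2 eventually_mono)

instantiation ae_fun :: (finite) complex_vector
begin

lift_definition zero_ae_fun :: "'a ae_fun" is "\<lambda>_. 0" by simp

lift_definition plus_ae_fun :: "'a ae_fun \<Rightarrow> 'a ae_fun \<Rightarrow> 'a ae_fun" is "\<lambda>f g x. f x + g x"
  by (auto elim: eventually_elim2)

lift_definition minus_ae_fun :: "'a ae_fun \<Rightarrow> 'a ae_fun \<Rightarrow> 'a ae_fun" is "\<lambda>f g x. f x - g x"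
  by (auto elim: eventually_elim2)

lift_definition uminus_ae_fun :: "'a ae_fun \<Rightarrow> 'a ae_fun" is "\<lambda>f x. - f x"
  by (auto elim: eventually_mono)

lift_definition scaleC_ae_fun :: "complex \<Rightarrow> 'a ae_fun \<Rightarrow> 'a ae_fun" is "\<lambda>c f x. c * f x"
  by (auto elim: eventually_mono)

instance
  by standard (transfer; auto simp: algebra_simps)+

end


section \<open>The spaces \<open>L\<^sup>2(\<Omega>)\<close>, \<open>H\<^sup>1(\<Omega>)\<close> and \<open>H\<^sup>1\<^sub>0(\<Omega>)\<close>\<close>

text \<open>
  Functions on \<open>\<Omega>\<close> are identified with their extensions by 0, that is, with (classes of) functions
  on the whole space that vanish almost everywhere outside \<open>\<Omega>\<close>. This is only a device to have all
  the function spaces within one type: all integrals are over \<open>\<Omega>\<close>, and weak derivatives are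
  those on \<open>\<Omega>\<close>, tested against functions with compact support in \<open>\<Omega>\<close>.
\<close>

definition L2 :: "(real^'n::finite) set \<Rightarrow> 'n ae_fun set" where
  "L2 \<Omega> = {f. set_integrable lebesgue \<Omega> (\<lambda>x. (cmod (rep_ae_fun f x))\<^sup>2) \<and>
             (AE x in lebesgue. x \<notin> \<Omega> \<longrightarrow> rep_ae_fun f x = 0)}"

definition L2_inner :: "(real^'n::finite) set \<Rightarrow> 'n ae_fun \<Rightarrow> 'n ae_fun \<Rightarrow> complex" where
  "L2_inner \<Omega> f g = (LINT x:\<Omega>|lebesgue. rep_ae_fun f x * cnj (rep_ae_fun g x))"

definition has_weak_pderiv ::
  "(real^'n::finite) set \<Rightarrow> 'n \<Rightarrow> 'n ae_fun \<Rightarrow> 'n ae_fun \<Rightarrow> bool" where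
  "has_weak_pderiv \<Omega> j f g \<longleftrightarrow> (\<forall>\<phi>. test_function \<Omega> \<phi> \<longrightarrow>
     (LINT x:\<Omega>|lebesgue. rep_ae_fun f x * pderiv_at j \<phi> x) =
     - (LINT x:\<Omega>|lebesgue. rep_ae_fun g x * \<phi> x))"

definition H1 :: "(real^'n::finite) set \<Rightarrow> 'n ae_fun set" where
  "H1 \<Omega> = {f \<in> L2 \<Omega>. \<forall>j. \<exists>g \<in> L2 \<Omega>. has_weak_pderiv \<Omega> j f g}"

definition weak_pderiv :: "(real^'n::finite) set \<Rightarrow> 'n \<Rightarrow> 'n ae_fun \<Rightarrow> 'n ae_fun" where
  "weak_pderiv \<Omega> j f = (THE g. g \<in> L2 \<Omega> \<and> has_weak_pderiv \<Omega> j f g)"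

definition H1_inner :: "(real^'n::finite) set \<Rightarrow> 'n ae_fun \<Rightarrow> 'n ae_fun \<Rightarrow> complex" where
  "H1_inner \<Omega> f g =
     L2_inner \<Omega> f g + (\<Sum>j\<in>UNIV. L2_inner \<Omega> (weak_pderiv \<Omega> j f) (weak_pderiv \<Omega> j g))"

definition H10 :: "(real^'n::finite) set \<Rightarrow> 'n ae_fun set" where
  "H10 \<Omega> = {f \<in> H1 \<Omega>. \<forall>\<epsilon>>0. \<exists>\<phi>. test_function \<Omega> \<phi> \<and>
     ip_norm (H1_inner \<Omega>) (f - abs_ae_fun \<phi>) < \<epsilon>}"


section \<open>The groups and the map \<open>G \<mapsto> U\<^sub>G\<close>\<close>

definition GG :: "(real^'n::finite) set \<Rightarrow> ('n ae_fun \<Rightarrow> 'n ae_fun) set" where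
  "GG \<Omega> = {G \<in> invertible_ops (H10 \<Omega>) (H1_inner \<Omega>).
     \<forall>f\<in>H10 \<Omega>. \<forall>g\<in>H10 \<Omega>. L2_inner \<Omega> (G f) (G g) = L2_inner \<Omega> f g}"

definition A_op :: "(real^'n::finite) set \<Rightarrow> 'n ae_fun \<Rightarrow> 'n ae_fun" where
  "A_op \<Omega> = (THE A. A \<in> bounded_ops (H10 \<Omega>) (H1_inner \<Omega>) \<and>
     (\<forall>f\<in>H10 \<Omega>. \<forall>g\<in>H10 \<Omega>. H1_inner \<Omega> (A f) g = L2_inner \<Omega> f g))"

definition A_half :: "(real^'n::finite) set \<Rightarrow> 'n ae_fun \<Rightarrow> 'n ae_fun" where
  "A_half \<Omega> = sqrt_op (H10 \<Omega>) (H1_inner \<Omega>) (A_op \<Omega>)"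

definition UU_R :: "(real^'n::finite) set \<Rightarrow> ('n ae_fun \<Rightarrow> 'n ae_fun) set" where
  "UU_R \<Omega> = {U \<in> unitary_ops (H10 \<Omega>) (H1_inner \<Omega>).
     U ` (A_half \<Omega> ` H10 \<Omega>) = A_half \<Omega> ` H10 \<Omega>}"

definition U_map ::
  "(real^'n::finite) set \<Rightarrow> ('n ae_fun \<Rightarrow> 'n ae_fun) \<Rightarrow> 'n ae_fun \<Rightarrow> 'n ae_fun" where
  "U_map \<Omega> G = (THE U. U \<in> unitary_ops (H10 \<Omega>) (H1_inner \<Omega>) \<and>
     compose (H10 \<Omega>) U (A_half \<Omega>) = compose (H10 \<Omega>) (A_half \<Omega>) G)"

text \<open>Both groups have composition as multiplication and the topology of the operator norm.\<close>

abbreviation op_group ::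
  "(real^'n::finite) set \<Rightarrow> ('n ae_fun \<Rightarrow> 'n ae_fun) set \<Rightarrow> ('n ae_fun \<Rightarrow> 'n ae_fun) monoid" where
  "op_group \<Omega> S \<equiv> (BijGroup (H10 \<Omega>))\<lparr>carrier := S\<rparr>"

abbreviation op_topology ::
  "(real^'n::finite) set \<Rightarrow> ('n ae_fun \<Rightarrow> 'n ae_fun) set \<Rightarrow> ('n ae_fun \<Rightarrow> 'n ae_fun) topology" where
  "op_topology \<Omega> S \<equiv> subtopology (norm_topology (H10 \<Omega>) (H1_inner \<Omega>)) S"

end

theory Submission
  imports Defs
begin

text \<open>
  On \<open>H = H\<^sup>1\<^sub>0(\<Omega>)\<close> with its inner product \<open>[\<cdot>,\<cdot>]\<close> and the weaker one \<open>\<langle>\<cdot>,\<cdot>\<rangle>\<close> of \<open>L\<^sup>2\<close>, the operator \<open>S = A\<^sup>1\<^sup>/\<^sup>2\<close> satisfies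
  \<open>[S f, S g] = \<langle>f, g\<rangle>\<close>, is injective and has dense range. So a bijective \<open>L\<^sup>2\<close>-isometry \<open>G\<close> becomes, on the
  range of \<open>S\<close>, an isometry \<open>S f \<mapsto> S (G f)\<close>, which extends to the unitary \<open>U\<^sub>G\<close>. Conversely, a unitary \<open>U\<close>
  that preserves the range gives \<open>G = S\<^sup>-\<^sup>1 U S\<close>, and \<open>G\<close> is bounded by the uniform boundedness principle,
  because \<open>[G f, A g] = [f, A G\<^sup>-\<^sup>1 g]\<close> and the range of \<open>A\<close> is dense.

  Continuity: \<open>\<parallel>U\<^sub>G - U\<^sub>K\<parallel>\<close> is the norm of \<open>T = G - K\<close> as an operator for \<open>\<langle>\<cdot>,\<cdot>\<rangle>\<close>. The adjoint of \<open>T\<close> for this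
  inner product is \<open>T' = G\<^sup>-\<^sup>1 - K\<^sup>-\<^sup>1\<close>, and Lax's theorem for the symmetric operator \<open>T' T\<close> bounds the square
  of that norm by \<open>\<parallel>T'\<parallel> \<parallel>T\<parallel>\<close>, with the norms of \<open>H\<close>. Discontinuity of the inverse: rank one perturbations of
  the identity by \<open>c \<langle>\<cdot>, z\<rangle> z\<close>, where \<open>z\<close> is bounded in \<open>L\<^sup>2\<close>, not orthogonal to a fixed function, and large
  in \<open>H\<close>.
\<close>

section \<open>Inner products on a carrier set\<close>

text \<open>The two sides measure the same difference differently. \<open>G - K\<close> is measured
  in the norm of H, whereas the difference of the unitaries only sees \<open>G - K\<close> as an
  operator for the L^2 product. A bound in the stronger norm alone need not bound an operator in the
  weaker one; Lax's theorem needs an adjoint that is strongly bounded as well. An isometry has one,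
  its inverse, so continuity of inversion is a part of the continuity proof. In the other direction
  there is no control: a rank one operator of fixed L^2 size can be arbitrarily large on H.

  Most of the argument takes place in an arbitrary Hilbert space with a second, definite inner
  product dominated by the given one. The domain enters only to show that H^1_0 is such a space and
  that its two norms are not equivalent; the latter uses that the domain is nonempty. As weak
  derivatives are given by a definite description, even linearity of the gradient rests on their
  uniqueness, that is, on the fundamental lemma.\<close>

lemma scaleC_zero_left [simp]: "0 *\<^sub>C (x::'a::complex_vector) = 0"
  using scaleC_add_left[of 0 0 x] by simp

lemma scaleC_zero_right [simp]: "c *\<^sub>C (0::'a::complex_vector) = 0"
  using scaleC_add_right[of c 0 "0::'a"] by simp

lemma scaleC_minus_left: "(- c) *\<^sub>C (x::'a::complex_vector) = - (c *\<^sub>C x)"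
  using scaleC_add_left[of c "- c" x] by (simp add: eq_neg_iff_add_eq_0 add.commute)

lemma scaleC_minus_one: "(- 1) *\<^sub>C (x::'a::complex_vector) = - x"
  by (simp add: scaleC_minus_left scaleC_one)

lemma scaleC_minus_right: "c *\<^sub>C (- x) = - (c *\<^sub>C (x::'a::complex_vector))"
  using scaleC_add_right[of c x "- x"] by (simp add: eq_neg_iff_add_eq_0 add.commute)

lemma scaleC_diff_right: "c *\<^sub>C (x - y) = c *\<^sub>C x - c *\<^sub>C (y::'a::complex_vector)"
  using scaleC_add_right[of c x "- y"] by (simp add: scaleC_minus_right)

definition csubspace :: "'a::complex_vector set \<Rightarrow> bool" where
  "csubspace V \<longleftrightarrow> 0 \<in> V \<and> (\<forall>x\<in>V. \<forall>y\<in>V. x + y \<in> V) \<and> (\<forall>c. \<forall>x\<in>V. c *\<^sub>C x \<in> V)"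

lemma csubspaceD:
  assumes "csubspace V"
  shows "0 \<in> V" "x \<in> V \<Longrightarrow> y \<in> V \<Longrightarrow> x + y \<in> V" "x \<in> V \<Longrightarrow> c *\<^sub>C x \<in> V"
    "x \<in> V \<Longrightarrow> - x \<in> V" "x \<in> V \<Longrightarrow> y \<in> V \<Longrightarrow> x - y \<in> V"
proof -
  show "0 \<in> V" and *: "x \<in> V \<Longrightarrow> y \<in> V \<Longrightarrow> x + y \<in> V" and "x \<in> V \<Longrightarrow> c *\<^sub>C x \<in> V" for x y c
    using assms by (auto simp: csubspace_def)
  have **: "- x \<in> V" if "x \<in> V" for x
    using that assms scaleC_minus_one[of x] by (metis csubspace_def)
  then show "x \<in> V \<Longrightarrow> - x \<in> V" for x .
  show "x \<in> V \<Longrightarrow> y \<in> V \<Longrightarrow> x - y \<in> V" for x y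
    using *[of x "- y"] **[of y] by simp
qed

lemma null_comparison:
  fixes f :: "nat \<Rightarrow> 'b::real_normed_vector"
  assumes "g \<longlonglongrightarrow> 0" "\<And>n. norm (f n) \<le> g n"
  shows "f \<longlonglongrightarrow> 0"
  by (rule Lim_null_comparison[OF always_eventually assms(1)]) (simp add: assms(2))

text \<open>Definiteness is left out because Cauchy-Schwarz is later applied to forms such as
  \<open>ip (T x) y\<close> with \<open>T\<close> positive, which may vanish at nonzero
  vectors.\<close>

locale semi_inner =
  fixes H :: "'a::complex_vector set" and ip :: "'a \<Rightarrow> 'a \<Rightarrow> complex"
  assumes H_subspace: "csubspace H"
    and add_left: "\<lbrakk>x \<in> H; y \<in> H; z \<in> H\<rbrakk> \<Longrightarrow> ip (x + y) z = ip x z + ip y z"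
    and scale_left: "\<lbrakk>x \<in> H; y \<in> H\<rbrakk> \<Longrightarrow> ip (c *\<^sub>C x) y = c * ip x y"
    and cnj_sym: "\<lbrakk>x \<in> H; y \<in> H\<rbrakk> \<Longrightarrow> ip y x = cnj (ip x y)"
    and nonneg: "x \<in> H \<Longrightarrow> 0 \<le> Re (ip x x)"
begin

abbreviation nrm where "nrm \<equiv> ip_norm ip"

lemma zero_mem [simp, intro]: "0 \<in> H"
  and add_mem [simp, intro]: "x \<in> H \<Longrightarrow> y \<in> H \<Longrightarrow> x + y \<in> H"
  and scale_mem [simp, intro]: "x \<in> H \<Longrightarrow> c *\<^sub>C x \<in> H"
  and minus_mem [simp, intro]: "x \<in> H \<Longrightarrow> - x \<in> H"
  and diff_mem [simp, intro]: "x \<in> H \<Longrightarrow> y \<in> H \<Longrightarrow> x - y \<in> H"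
  using csubspaceD[OF H_subspace] by auto

lemma minus_left: "x \<in> H \<Longrightarrow> y \<in> H \<Longrightarrow> ip (- x) y = - ip x y"
  using scale_left[of x y "- 1"] by (simp add: scaleC_minus_one)

lemma diff_left: "x \<in> H \<Longrightarrow> y \<in> H \<Longrightarrow> z \<in> H \<Longrightarrow> ip (x - y) z = ip x z - ip y z"
  using add_left[of x "- y" z] by (simp add: minus_left)

lemma add_right: "x \<in> H \<Longrightarrow> y \<in> H \<Longrightarrow> z \<in> H \<Longrightarrow> ip z (x + y) = ip z x + ip z y"
  by (simp add: cnj_sym[of _ z] add_left)

lemma diff_right: "x \<in> H \<Longrightarrow> y \<in> H \<Longrightarrow> z \<in> H \<Longrightarrow> ip z (x - y) = ip z x - ip z y"
  by (simp add: cnj_sym[of _ z] diff_left)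

lemma minus_right: "x \<in> H \<Longrightarrow> z \<in> H \<Longrightarrow> ip z (- x) = - ip z x"
  by (simp add: cnj_sym[of _ z] minus_left)

lemma scale_right: "x \<in> H \<Longrightarrow> y \<in> H \<Longrightarrow> ip y (c *\<^sub>C x) = cnj c * ip y x"
  by (simp add: cnj_sym[of _ y] scale_left)

lemma zero_left [simp]: "y \<in> H \<Longrightarrow> ip 0 y = 0"
  using scale_left[of 0 y 0] by simp

lemma zero_right [simp]: "y \<in> H \<Longrightarrow> ip y 0 = 0"
  using scale_right[of 0 y 0] by simp

lemmas ip_simps = add_left add_right diff_left diff_right minus_left minus_right scale_left scale_right

lemma nrm_ge_0 [simp]: "x \<in> H \<Longrightarrow> 0 \<le> nrm x"
  by (simp add: ip_norm_def nonneg)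

lemma nrm_sq: "x \<in> H \<Longrightarrow> (nrm x)\<^sup>2 = Re (ip x x)"
  by (simp add: ip_norm_def nonneg)

lemma ip_self: "x \<in> H \<Longrightarrow> ip x x = of_real ((nrm x)\<^sup>2)"
  using cnj_sym[of x x] by (simp add: nrm_sq complex_eq_iff)

lemma nrm_zero [simp]: "nrm 0 = 0"
  by (simp add: ip_norm_def)

lemma nrm_scale: "x \<in> H \<Longrightarrow> nrm (c *\<^sub>C x) = cmod c * nrm x"
proof -
  assume x: "x \<in> H"
  have "ip (c *\<^sub>C x) (c *\<^sub>C x) = (c * cnj c) * ip x x"
    using x by (simp add: ip_simps)
  also have "\<dots> = of_real ((cmod c)\<^sup>2 * (nrm x)\<^sup>2)"
    using x by (simp add: ip_self complex_norm_square flip: of_real_power)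
  finally have "(nrm (c *\<^sub>C x))\<^sup>2 = (cmod c * nrm x)\<^sup>2"
    using x by (simp add: nrm_sq power_mult_distrib)
  then show ?thesis
    using x by simp
qed

lemma nrm_minus [simp]: "x \<in> H \<Longrightarrow> nrm (- x) = nrm x"
  using nrm_scale[of x "- 1"] by (simp add: scaleC_minus_one)

lemma nrm_minus_commute: "x \<in> H \<Longrightarrow> y \<in> H \<Longrightarrow> nrm (x - y) = nrm (y - x)"
  using nrm_minus[of "x - y"] by simp

lemma Cauchy_Schwarz:
  assumes x: "x \<in> H" and y: "y \<in> H"
  shows "cmod (ip x y) \<le> nrm x * nrm y"
proof -
  define a b k where "a = Re (ip x x)" and "b = Re (ip y y)" and "k = (cmod (ip x y))\<^sup>2"
  \<comment> \<open>This is the squared norm of \<open>x\<close> minus a multiple of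
    \<open>y\<close>. The factor \<open>ip x y\<close> in the coefficient \<open>c\<close> makes the
    cross terms real, so one real parameter \<open>t\<close> is enough.\<close>
  have q: "0 \<le> a - 2 * t * k + t\<^sup>2 * k * b" for t :: real
  proof -
    define c where "c = of_real t * ip x y"
    have k: "Re (ip x y * cnj (ip x y)) = k" "Re (cnj (ip x y) * ip x y) = k"
      by (simp_all add: k_def cmod_power2 flip: power2_eq_square)
    have "ip (x - c *\<^sub>C y) (x - c *\<^sub>C y)
        = ip x x - cnj c * ip x y - c * cnj (ip x y) + c * cnj c * ip y y"
      using x y by (simp add: ip_simps cnj_sym[OF x y] algebra_simps)
    also have "\<dots> = ip x x - of_real (2 * t * k) + of_real (t\<^sup>2 * k) * ip y y"
    proof -
      have 1: "cnj (ip x y) * ip x y = of_real k" "ip x y * cnj (ip x y) = of_real k"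
        by (simp_all only: k_def complex_norm_square mult.commute)
      have "cnj c * ip x y = of_real (t * k)" "c * cnj (ip x y) = of_real (t * k)"
        by (simp_all add: c_def 1 mult.assoc)
      moreover have "c * cnj c = of_real (t\<^sup>2 * k)"
        using 1(2) by (simp add: c_def power2_eq_square algebra_simps)
      ultimately show ?thesis by simp
    qed
    finally have "Re (ip (x - c *\<^sub>C y) (x - c *\<^sub>C y)) = a - 2 * t * k + t\<^sup>2 * k * b"
      by (simp add: a_def b_def)
    with nonneg[of "x - c *\<^sub>C y"] x y show ?thesis by simp
  qed
  have a0: "0 \<le> a" and b0: "0 \<le> b" and "0 \<le> k"
    using x y by (simp_all add: a_def b_def k_def nonneg)
  have "k \<le> a * b"
  proof (cases "b = 0")
    case True
    have "k = 0"
    proof (rule ccontr)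
      assume "k \<noteq> 0"
      \<comment> \<open>For \<open>b = 0\<close> the polynomial is affine in \<open>t\<close>, and
        at this point its value is -1.\<close>
      with q[of "(a + 1) / (2 * k)"] True show False by simp
    qed
    then show ?thesis using True by simp
  next
    case False
    with q[of "1 / b"] have "0 \<le> a - k / b"
      by (simp add: power2_eq_square divide_simps)
    then show ?thesis using False b0 by (simp add: field_simps)
  qed
  then have "(cmod (ip x y))\<^sup>2 \<le> (nrm x * nrm y)\<^sup>2"
    using x y by (simp add: k_def a_def b_def nrm_sq power_mult_distrib)
  then show ?thesis
    using x y by (simp add: power2_le_iff_abs_le)
qed

lemma nrm_triangle:
  assumes x: "x \<in> H" and y: "y \<in> H"
  shows "nrm (x + y) \<le> nrm x + nrm y"
proof -
  have "(nrm (x + y))\<^sup>2 = (nrm x)\<^sup>2 + 2 * Re (ip x y) + (nrm y)\<^sup>2"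
    using x y cnj_sym[OF x y] by (simp add: nrm_sq ip_simps)
  also have "\<dots> \<le> (nrm x + nrm y)\<^sup>2"
    using Cauchy_Schwarz[OF x y] complex_Re_le_cmod[of "ip x y"]
    by (simp add: power2_sum)
  finally show ?thesis
    using x y by (simp add: power2_le_iff_abs_le)
qed

lemma nrm_triangle_diff: "x \<in> H \<Longrightarrow> y \<in> H \<Longrightarrow> nrm (x - y) \<le> nrm x + nrm y"
  using nrm_triangle[of x "- y"] by simp

lemma nrm_triangle3: "x \<in> H \<Longrightarrow> y \<in> H \<Longrightarrow> z \<in> H \<Longrightarrow> nrm (x - z) \<le> nrm (x - y) + nrm (y - z)"
  using nrm_triangle[of "x - y" "y - z"] by simp

lemma nrm_diff_ge: "x \<in> H \<Longrightarrow> y \<in> H \<Longrightarrow> \<bar>nrm x - nrm y\<bar> \<le> nrm (x - y)"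
  using nrm_triangle[of "x - y" y] nrm_triangle[of "y - x" x] nrm_minus_commute[of x y] by auto

lemma parallelogram:
  "x \<in> H \<Longrightarrow> y \<in> H \<Longrightarrow> (nrm (x + y))\<^sup>2 + (nrm (x - y))\<^sup>2 = 2 * (nrm x)\<^sup>2 + 2 * (nrm y)\<^sup>2"
  by (simp add: nrm_sq ip_simps)

lemma tendsto_nrm:
  assumes "\<And>n. s n \<in> H" "x \<in> H" "(\<lambda>n. nrm (s n - x)) \<longlonglongrightarrow> 0"
  shows "(\<lambda>n. nrm (s n)) \<longlonglongrightarrow> nrm x"
proof -
  have "(\<lambda>n. nrm (s n) - nrm x) \<longlonglongrightarrow> 0"
    by (rule null_comparison[OF assms(3)]) (simp add: nrm_diff_ge assms(1,2))
  then show ?thesis by (simp add: LIM_zero_iff)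
qed

lemma tendsto_ip:
  assumes "\<And>n. s n \<in> H" "x \<in> H" "(\<lambda>n. nrm (s n - x)) \<longlonglongrightarrow> 0" "y \<in> H"
  shows "(\<lambda>n. ip (s n) y) \<longlonglongrightarrow> ip x y"
proof -
  have "(\<lambda>n. nrm (s n - x) * nrm y) \<longlonglongrightarrow> 0"
    using tendsto_mult_left_zero[OF assms(3)] .
  moreover have "cmod (ip (s n) y - ip x y) \<le> nrm (s n - x) * nrm y" for n
    using Cauchy_Schwarz[of "s n - x" y] assms(1,2,4) by (simp add: diff_left)
  ultimately have "(\<lambda>n. ip (s n) y - ip x y) \<longlonglongrightarrow> 0"
    by (rule null_comparison)
  then show ?thesis by (simp add: LIM_zero_iff)
qed

lemma tendsto_ip_right:
  assumes "\<And>n. s n \<in> H" "x \<in> H" "(\<lambda>n. nrm (s n - x)) \<longlonglongrightarrow> 0" "y \<in> H"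
  shows "(\<lambda>n. ip y (s n)) \<longlonglongrightarrow> ip y x"
proof -
  have "ip y (s n) = cnj (ip (s n) y)" for n
    using assms by (intro cnj_sym)
  moreover have "ip y x = cnj (ip x y)"
    using assms by (intro cnj_sym)
  ultimately show ?thesis
    using tendsto_cnj[OF tendsto_ip[OF assms]] by simp
qed

lemma cong_form:
  assumes "\<And>x y. x \<in> H \<Longrightarrow> y \<in> H \<Longrightarrow> q x y = ip x y"
  shows "semi_inner H q"
proof
  show "q y x = cnj (q x y)" if "x \<in> H" "y \<in> H" for x y
    using cnj_sym[OF that] assms that by simp
qed (simp_all add: assms H_subspace add_left scale_left nonneg)

lemma subspace_semi_inner: "csubspace V \<Longrightarrow> V \<subseteq> H \<Longrightarrow> semi_inner V ip"
  by (unfold_locales; (rule add_left scale_left cnj_sym nonneg | assumption)?) (auto dest: subsetD)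

end

text \<open>Over the complex numbers a sesquilinear form with real diagonal is Hermitian: reality at
  \<open>x + y\<close> gives the imaginary part of the symmetry and reality at
  \<open>x + \<i> *\<^sub>C y\<close> the real part. Positive operators become self-adjoint in this
  way.\<close>

lemma semi_inner_polarize:
  assumes H: "csubspace H"
    and add_left: "\<And>x y z. \<lbrakk>x \<in> H; y \<in> H; z \<in> H\<rbrakk> \<Longrightarrow> q (x + y) z = q x z + q y z"
    and add_right: "\<And>x y z. \<lbrakk>x \<in> H; y \<in> H; z \<in> H\<rbrakk> \<Longrightarrow> q z (x + y) = q z x + q z y"
    and scale_left: "\<And>x y c. \<lbrakk>x \<in> H; y \<in> H\<rbrakk> \<Longrightarrow> q (c *\<^sub>C x) y = c * q x y"
    and scale_right: "\<And>x y c. \<lbrakk>x \<in> H; y \<in> H\<rbrakk> \<Longrightarrow> q y (c *\<^sub>C x) = cnj c * q y x"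
    and nonneg: "\<And>x. x \<in> H \<Longrightarrow> q x x \<in> \<real>\<^sub>\<ge>\<^sub>0"
  shows "semi_inner H q"
proof
  have mem: "x \<in> H \<Longrightarrow> y \<in> H \<Longrightarrow> x + y \<in> H" "x \<in> H \<Longrightarrow> c *\<^sub>C x \<in> H" for x y c
    using csubspaceD[OF H] by auto
  show "q y x = cnj (q x y)" if x: "x \<in> H" and y: "y \<in> H" for x y
  proof -
    have im: "Im (q z z) = 0" if "z \<in> H" for z
      using nonneg[OF that] by (simp add: complex_nonneg_Reals_iff)
    have "Im (q (x + y) (x + y)) = 0" "Im (q (x + \<i> *\<^sub>C y) (x + \<i> *\<^sub>C y)) = 0"
      by (intro im mem x y)+
    then have "Im (q x y) + Im (q y x) = 0" "Re (q y x) - Re (q x y) = 0"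
      using x y im[OF x] im[OF y]
      by (simp_all add: add_left add_right scale_left scale_right mem algebra_simps)
    then show ?thesis by (simp add: complex_eq_iff)
  qed
  show "0 \<le> Re (q x x)" if "x \<in> H" for x
    using nonneg[OF that] by (simp add: complex_nonneg_Reals_iff)
qed (use assms in auto)

text \<open>Applied to \<open>q x y = ip (A x) y\<close>, this makes \<open>1 - A\<close> positive,
  which the square root iteration relies on.\<close>

lemma (in semi_inner) inner_mono_semi:
  assumes "semi_inner H q" and "\<And>x. x \<in> H \<Longrightarrow> Re (q x x) \<le> Re (ip x x)"
  shows "semi_inner H (\<lambda>x y. ip x y - q x y)"
proof -
  interpret q: semi_inner H q by fact
  show ?thesis
  proof
    show "ip y x - q y x = cnj (ip x y - q x y)" if "x \<in> H" "y \<in> H" for x y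
      using cnj_sym[OF that] q.cnj_sym[OF that] by simp
  qed (use assms(2) in \<open>simp_all add: H_subspace ip_simps q.ip_simps algebra_simps\<close>)
qed

section \<open>Bounded operators\<close>

text \<open>Extensionality is kept apart from linearity, so that sums and composites can be written
  as plain functions; \<open>restrict\<close> turns them into members of \<open>bounded_ops\<close>
  at the end.\<close>

definition linear_op :: "'a::complex_vector set \<Rightarrow> ('a \<Rightarrow> 'a) \<Rightarrow> bool" where
  "linear_op H T \<longleftrightarrow> (\<forall>x\<in>H. T x \<in> H) \<and> (\<forall>x\<in>H. \<forall>y\<in>H. T (x + y) = T x + T y) \<and>
     (\<forall>c. \<forall>x\<in>H. T (c *\<^sub>C x) = c *\<^sub>C T x)"

context semi_inner
begin

lemma linear_opD:
  assumes "linear_op H T"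
  shows "x \<in> H \<Longrightarrow> T x \<in> H" "x \<in> H \<Longrightarrow> y \<in> H \<Longrightarrow> T (x + y) = T x + T y"
    "x \<in> H \<Longrightarrow> T (c *\<^sub>C x) = c *\<^sub>C T x" "T 0 = 0"
    "x \<in> H \<Longrightarrow> T (- x) = - T x" "x \<in> H \<Longrightarrow> y \<in> H \<Longrightarrow> T (x - y) = T x - T y"
proof -
  show 1: "x \<in> H \<Longrightarrow> T x \<in> H" "x \<in> H \<Longrightarrow> y \<in> H \<Longrightarrow> T (x + y) = T x + T y"
    "x \<in> H \<Longrightarrow> T (c *\<^sub>C x) = c *\<^sub>C T x" for x y c
    using assms by (auto simp: linear_op_def)
  show "T 0 = 0"
    using 1(3)[of 0 0] by simp
  show 2: "x \<in> H \<Longrightarrow> T (- x) = - T x" for x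
    using 1(3)[of x "- 1"] by (simp add: scaleC_minus_one)
  show "x \<in> H \<Longrightarrow> y \<in> H \<Longrightarrow> T (x - y) = T x - T y" for x y
    using 1(2)[of x "- y"] 2[of y] by simp
qed

lemma linear_op_compose:
  "linear_op H S \<Longrightarrow> linear_op H T \<Longrightarrow> linear_op H (\<lambda>x. S (T x))"
  unfolding linear_op_def by auto

lemma linear_op_diff:
  "linear_op H S \<Longrightarrow> linear_op H T \<Longrightarrow> linear_op H (\<lambda>x. S x - T x)"
  unfolding linear_op_def by (auto simp: scaleC_diff_right)

lemma linear_op_add:
  "linear_op H S \<Longrightarrow> linear_op H T \<Longrightarrow> linear_op H (\<lambda>x. S x + T x)"
  unfolding linear_op_def by (auto simp: scaleC_add_right)

lemma linear_op_scale:
  "linear_op H T \<Longrightarrow> linear_op H (\<lambda>x. c *\<^sub>C T x)"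
  unfolding linear_op_def by (auto simp: scaleC_add_right scaleC_scaleC mult.commute)

lemma linear_op_id: "linear_op H (\<lambda>x. x)"
  unfolding linear_op_def by auto

lemma linear_op_restrict: "linear_op H T \<Longrightarrow> linear_op H (restrict T H)"
  unfolding linear_op_def by auto

abbreviation "B \<equiv> bounded_ops H ip"
abbreviation "opn \<equiv> op_norm H ip"
abbreviation "opd \<equiv> op_dist H ip"

lemma bounded_opsI:
  assumes "linear_op H T" "T \<in> extensional H" "\<And>x. x \<in> H \<Longrightarrow> nrm (T x) \<le> C * nrm x"
  shows "T \<in> B"
  using assms unfolding bounded_ops_def linear_op_def by (auto simp: PiE_def Pi_def)

lemma bounded_opsI_restrict:
  assumes "linear_op H T" "\<And>x. x \<in> H \<Longrightarrow> nrm (T x) \<le> C * nrm x"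
  shows "restrict T H \<in> B"
  by (rule bounded_opsI[where C=C]) (use assms in \<open>auto intro: linear_op_restrict\<close>)

lemma bounded_opsD:
  assumes "T \<in> B"
  shows "linear_op H T" "T \<in> extensional H" "\<exists>C. \<forall>x\<in>H. nrm (T x) \<le> C * nrm x"
  using assms unfolding bounded_ops_def linear_op_def by (auto simp: PiE_def Pi_def)

lemma bounded_op_mem: "T \<in> B \<Longrightarrow> x \<in> H \<Longrightarrow> T x \<in> H"
  using linear_opD(1) bounded_opsD(1) by blast

lemma op_norm_le:
  assumes "0 \<le> C" "\<And>x. x \<in> H \<Longrightarrow> nrm (T x) \<le> C * nrm x"
  shows "opn T \<le> C"
  unfolding op_norm_def
proof (rule cSUP_least)
  show "{x \<in> H. nrm x \<le> 1} \<noteq> {}" using nrm_zero zero_mem by fastforce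
  show "nrm (T x) \<le> C" if "x \<in> {x \<in> H. nrm x \<le> 1}" for x
    using that assms(2)[of x] mult_left_mono[of "nrm x" 1 C] assms(1) by simp
qed

lemma bounded_const_nonneg:
  assumes "\<exists>C. \<forall>x\<in>H. nrm (T x) \<le> C * nrm x" "\<And>x. x \<in> H \<Longrightarrow> T x \<in> H"
  obtains C where "0 \<le> C" "\<And>x. x \<in> H \<Longrightarrow> nrm (T x) \<le> C * nrm x"
proof -
  from assms(1) obtain C where C: "\<And>x. x \<in> H \<Longrightarrow> nrm (T x) \<le> C * nrm x" by blast
  have "nrm (T x) \<le> max C 0 * nrm x" if "x \<in> H" for x
    using C[OF that] mult_right_mono[of C "max C 0" "nrm x"] that by simp
  then show ?thesis using that[of "max C 0"] by simp
qed

lemma op_norm_upper: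
  assumes "linear_op H T" "\<exists>C. \<forall>x\<in>H. nrm (T x) \<le> C * nrm x" and x: "x \<in> H"
  shows "nrm (T x) \<le> opn T * nrm x" "0 \<le> opn T"
proof -
  obtain C where C: "0 \<le> C" "\<And>x. x \<in> H \<Longrightarrow> nrm (T x) \<le> C * nrm x"
    using bounded_const_nonneg[of T] assms linear_opD(1) by blast
  have bdd: "bdd_above ((\<lambda>x. nrm (T x)) ` {x \<in> H. nrm x \<le> 1})"
  proof (rule bdd_aboveI2)
    show "nrm (T x) \<le> C" if "x \<in> {x \<in> H. nrm x \<le> 1}" for x
      using that C(2)[of x] mult_left_mono[of "nrm x" 1 C] C(1) by simp
  qed
  have ub: "nrm (T y) \<le> opn T" if "y \<in> H" "nrm y \<le> 1" for y
    unfolding op_norm_def by (rule cSUP_upper2[OF bdd, of y]) (use that in auto)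
  show "0 \<le> opn T"
    using ub[of 0] linear_opD(4)[OF assms(1)] by simp
  show "nrm (T x) \<le> opn T * nrm x"
  proof (cases "nrm x = 0")
    \<comment> \<open>A nonzero vector may have seminorm 0 here and cannot be normalised; the bound
      \<open>C\<close> covers it.\<close>
    case True
    then show ?thesis using C(2)[OF x] by simp
  next
    case False
    then have pos: "0 < nrm x" using nrm_ge_0[OF x] by linarith
    define y where "y = complex_of_real (1 / nrm x) *\<^sub>C x"
    have "nrm y = 1" "y \<in> H"
      using x pos by (simp_all add: y_def nrm_scale norm_divide)
    then have "nrm (T y) \<le> opn T" using ub by simp
    moreover have "nrm (T y) = nrm (T x) / nrm x"
      using x pos assms(1) by (simp add: y_def linear_opD nrm_scale norm_divide)
    ultimately show ?thesis using pos by (simp add: field_simps)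
  qed
qed

lemma op_norm_bound: "T \<in> B \<Longrightarrow> x \<in> H \<Longrightarrow> nrm (T x) \<le> opn T * nrm x"
  and op_norm_nonneg: "T \<in> B \<Longrightarrow> 0 \<le> opn T"
  using op_norm_upper[of T] bounded_opsD[of T] zero_mem by blast+

lemma bounded_ops_compose:
  assumes "S \<in> B" "T \<in> B"
  shows "compose H S T \<in> B"
proof (rule bounded_opsI)
  show "linear_op H (compose H S T)"
    unfolding compose_def
    by (rule linear_op_restrict[OF linear_op_compose[OF assms[THEN bounded_opsD(1)]]])
  show "compose H S T \<in> extensional H" by simp
  show "nrm (compose H S T x) \<le> (opn S * opn T) * nrm x" if x: "x \<in> H" for x
  proof -
    have "nrm (S (T x)) \<le> opn S * nrm (T x)"
      using op_norm_bound assms x bounded_op_mem by blast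
    also have "\<dots> \<le> opn S * (opn T * nrm x)"
      by (intro mult_left_mono op_norm_bound op_norm_nonneg assms x)
    finally show ?thesis using x by (simp add: compose_def mult.assoc)
  qed
qed

lemma bounded_ops_diff:
  assumes "S \<in> B" "T \<in> B"
  shows "(\<lambda>x\<in>H. S x - T x) \<in> B"
proof (rule bounded_opsI_restrict)
  show "linear_op H (\<lambda>x. S x - T x)"
    by (rule linear_op_diff[OF assms[THEN bounded_opsD(1)]])
  show "nrm (S x - T x) \<le> (opn S + opn T) * nrm x" if x: "x \<in> H" for x
    using nrm_triangle_diff[of "S x" "T x"] op_norm_bound[OF assms(1) x] op_norm_bound[OF assms(2) x]
      bounded_op_mem[OF assms(1) x] bounded_op_mem[OF assms(2) x]
    by (simp add: algebra_simps)
qed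

lemma bounded_ops_id: "(\<lambda>x\<in>H. x) \<in> B"
  by (rule bounded_opsI_restrict[where C=1]) (auto intro: linear_op_id)

lemma op_dist_bound:
  assumes "S \<in> B" "T \<in> B" "x \<in> H"
  shows "nrm (S x - T x) \<le> opd S T * nrm x"
  using op_norm_bound[OF bounded_ops_diff[OF assms(1,2)] assms(3)] assms
  by (simp add: op_dist_def)

lemma op_dist_le:
  assumes "S \<in> B" "T \<in> B" "0 \<le> C" "\<And>x. x \<in> H \<Longrightarrow> nrm (S x - T x) \<le> C * nrm x"
  shows "opd S T \<le> C"
  using op_norm_le[of C "\<lambda>x\<in>H. S x - T x"] assms by (simp add: op_dist_def)

lemma op_dist_nonneg: "0 \<le> opd S T"
  using op_norm_nonneg[OF bounded_ops_diff] by (simp add: op_dist_def)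

end

locale inner_space = semi_inner +
  assumes definite: "x \<in> H \<Longrightarrow> nrm x = 0 \<Longrightarrow> x = 0"
begin

lemma nrm_pos: "x \<in> H \<Longrightarrow> x \<noteq> 0 \<Longrightarrow> 0 < nrm x"
  using definite[of x] nrm_ge_0[of x] by linarith

lemma eqI_nrm: "x \<in> H \<Longrightarrow> y \<in> H \<Longrightarrow> nrm (x - y) \<le> 0 \<Longrightarrow> x = y"
  by (metis definite diff_mem eq_iff_diff_eq_0 nrm_ge_0 order_antisym)

lemma eqI_ip:
  assumes "x \<in> H" "y \<in> H" "\<And>z. z \<in> H \<Longrightarrow> ip x z = ip y z"
  shows "x = y"
proof (rule eqI_nrm[OF assms(1,2)])
  have "(nrm (x - y))\<^sup>2 = 0"
    using assms by (simp add: nrm_sq diff_left)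
  then show "nrm (x - y) \<le> 0" by simp
qed

lemma limit_unique:
  assumes "\<And>n. s n \<in> H" "x \<in> H" "y \<in> H"
    "(\<lambda>n. nrm (s n - x)) \<longlonglongrightarrow> 0" "(\<lambda>n. nrm (s n - y)) \<longlonglongrightarrow> 0"
  shows "x = y"
proof (rule eqI_nrm[OF assms(2,3)])
  have "(\<lambda>n. nrm (s n - x) + nrm (s n - y)) \<longlonglongrightarrow> 0 + 0"
    by (intro tendsto_add assms)
  moreover have "nrm (x - y) \<le> nrm (s n - x) + nrm (s n - y)" for n
    using nrm_triangle3[of x "s n" y] nrm_minus_commute[of x "s n"] assms(1-3) by simp
  ultimately show "nrm (x - y) \<le> 0"
    by (intro LIMSEQ_le_const[where X="\<lambda>n. nrm (s n - x) + nrm (s n - y)"]) auto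
qed

lemma op_metric: "Metric_space B opd"
proof
  show "0 \<le> opd S T" for S T by (rule op_dist_nonneg)
  have le: "opd S T \<le> opd T S" if "S \<in> B" "T \<in> B" for S T
  proof (rule op_dist_le[OF that op_dist_nonneg])
    show "nrm (S x - T x) \<le> opd T S * nrm x" if "x \<in> H" for x
      using op_dist_bound[OF \<open>T \<in> B\<close> \<open>S \<in> B\<close> that] nrm_minus_commute[of "S x" "T x"]
        bounded_op_mem[OF \<open>T \<in> B\<close> that] bounded_op_mem[OF \<open>S \<in> B\<close> that] by simp
  qed
  show "opd S T = opd T S" for S T
  proof (cases "S \<in> B \<and> T \<in> B")
    case True
    then show ?thesis using le[of S T] le[of T S] by simp
  qed (auto simp: op_dist_def)
  show "opd S T = 0 \<longleftrightarrow> S = T" if "S \<in> B" "T \<in> B" for S T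
  proof
    assume *: "opd S T = 0"
    have "S x = T x" if x: "x \<in> H" for x
      using op_dist_bound[OF \<open>S \<in> B\<close> \<open>T \<in> B\<close> x] *
        eqI_nrm[OF bounded_op_mem[OF \<open>S \<in> B\<close> x] bounded_op_mem[OF \<open>T \<in> B\<close> x]] by simp
    then show "S = T"
      by (rule extensionalityI[OF bounded_opsD(2)[OF \<open>S \<in> B\<close>] bounded_opsD(2)[OF \<open>T \<in> B\<close>]])
  next
    assume "S = T"
    then have "opd S T \<le> 0"
      using op_dist_le[OF that, of 0] bounded_op_mem[OF \<open>S \<in> B\<close>] by simp
    then show "opd S T = 0" using op_dist_nonneg[of S T] by linarith
  qed
  show "opd R T \<le> opd R S + opd S T" if *: "R \<in> B" "S \<in> B" "T \<in> B" for R S T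
  proof (rule op_dist_le)
    show "nrm (R x - T x) \<le> (opd R S + opd S T) * nrm x" if x: "x \<in> H" for x
      using nrm_triangle3[of "R x" "S x" "T x"] op_dist_bound[OF *(1,2) x] op_dist_bound[OF *(2,3) x]
        bounded_op_mem[OF *(1) x] bounded_op_mem[OF *(2) x] bounded_op_mem[OF *(3) x]
      by (simp add: distrib_right)
  qed (simp_all add: * op_dist_nonneg)
qed

text \<open>A subspace of a metric topology is the metric topology of the subset. This reduces both
  the continuity and the discontinuity claim to epsilon and delta.\<close>

lemma continuous_map_norm_topology_iff:
  assumes "S \<subseteq> B" "T \<subseteq> B"
  shows "continuous_map (subtopology (norm_topology H ip) S) (subtopology (norm_topology H ip) T) f \<longleftrightarrow>
    f ` S \<subseteq> T \<and> (\<forall>a\<in>S. \<forall>e>0. \<exists>d>0. \<forall>x. x \<in> S \<and> opd a x < d \<longrightarrow> opd (f a) (f x) < e)"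
proof -
  have *: "subtopology (norm_topology H ip) V = Metric_space.mtopology V opd"
    "Metric_space V opd" if V: "V \<subseteq> B" for V
  proof -
    have "Submetric B opd V"
      by (rule Submetric.intro[OF op_metric Submetric_axioms.intro[OF V]])
    from Submetric.mtopology_submetric[OF this]
    show "subtopology (norm_topology H ip) V = Metric_space.mtopology V opd"
      unfolding norm_topology_def by (rule sym)
    show "Metric_space V opd"
      by (rule Metric_space.subspace[OF op_metric V])
  qed
  note c = Metric_space.metric_continuous_map[OF *(2)[OF assms(1)] *(2)[OF assms(2)], of f]
  show ?thesis
    unfolding *(1)[OF assms(1)] *(1)[OF assms(2)] by (rule c)
qed

lemma group_subset_BijGroup:
  assumes sub: "S \<subseteq> Bij H" and id: "(\<lambda>x\<in>H. x) \<in> S"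
    and comp: "\<And>f g. f \<in> S \<Longrightarrow> g \<in> S \<Longrightarrow> compose H f g \<in> S"
    and inv: "\<And>f. f \<in> S \<Longrightarrow> (\<lambda>x\<in>H. inv_into H f x) \<in> S"
  shows "group ((BijGroup H)\<lparr>carrier := S\<rparr>)"
proof (rule subgroup.subgroup_is_group[OF _ group_BijGroup])
  show "subgroup S (BijGroup H)"
  proof
    show "S \<subseteq> carrier (BijGroup H)" using sub by (simp add: BijGroup_def)
    show "f \<otimes>\<^bsub>BijGroup H\<^esub> g \<in> S" if "f \<in> S" "g \<in> S" for f g
      using that sub comp by (auto simp: BijGroup_def)
    show "\<one>\<^bsub>BijGroup H\<^esub> \<in> S" using id by (simp add: BijGroup_def)
    show "inv\<^bsub>BijGroup H\<^esub> f \<in> S" if "f \<in> S" for f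
      using that sub inv[OF that] by (simp add: inv_BijGroup subsetD)
  qed
qed

end

section \<open>Limits and Riesz representation\<close>

text \<open>The first order condition at a minimum: for small \<open>t\<close> the linear term would
  dominate and could be made negative. The minimiser is \<open>- a / b\<close>; the witness
  \<open>- a / (b + 1)\<close> also covers \<open>b = 0\<close>.\<close>

lemma quadratic_nonneg_imp_zero:
  fixes a b :: real
  assumes "0 \<le> b" "\<And>t. 0 \<le> 2 * t * a + t\<^sup>2 * b"
  shows "a = 0"
proof (rule ccontr)
  assume "a \<noteq> 0"
  define t where "t = - a / (b + 1)"
  have a: "a = - t * (b + 1)" using assms(1) by (simp add: t_def)
  have "2 * t * a + t\<^sup>2 * b = - (t\<^sup>2 * (b + 2))"
    by (subst a) (simp add: algebra_simps power2_eq_square)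
  moreover have "0 < t\<^sup>2 * (b + 2)" using \<open>a \<noteq> 0\<close> assms(1) by (simp add: t_def)
  ultimately have "2 * t * a + t\<^sup>2 * b < 0" by simp
  with assms(2)[of t] show False by simp
qed

context semi_inner
begin

text \<open>Membership of the terms and of the limit belongs to the notion, so that a single fact
  carries all side conditions of the limit rules.\<close>

definition lim_in :: "(nat \<Rightarrow> 'a) \<Rightarrow> 'a \<Rightarrow> bool" where
  "lim_in s x \<longleftrightarrow> (\<forall>n. s n \<in> H) \<and> x \<in> H \<and> (\<lambda>n. nrm (s n - x)) \<longlonglongrightarrow> 0"

lemma lim_inD:
  assumes "lim_in s x"
  shows "s n \<in> H" "x \<in> H" "(\<lambda>n. nrm (s n - x)) \<longlonglongrightarrow> 0" "(\<lambda>n. nrm (s n)) \<longlonglongrightarrow> nrm x"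
    "y \<in> H \<Longrightarrow> (\<lambda>n. ip (s n) y) \<longlonglongrightarrow> ip x y" "y \<in> H \<Longrightarrow> (\<lambda>n. ip y (s n)) \<longlonglongrightarrow> ip y x"
  using assms tendsto_nrm[of s x] tendsto_ip[of s x y] tendsto_ip_right[of s x y]
  unfolding lim_in_def by blast+

lemma lim_in_le:
  assumes "\<And>n. s n \<in> H" "x \<in> H" "g \<longlonglongrightarrow> 0" "\<And>n. nrm (s n - x) \<le> g n"
  shows "lim_in s x"
  unfolding lim_in_def using assms(1,2) null_comparison[OF assms(3), of "\<lambda>n. nrm (s n - x)"] assms(4)
  by simp

lemma lim_in_const: "x \<in> H \<Longrightarrow> lim_in (\<lambda>n. x) x"
  by (simp add: lim_in_def)

lemma lim_in_add:
  assumes "lim_in s x" "lim_in t y"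
  shows "lim_in (\<lambda>n. s n + t n) (x + y)"
proof (rule lim_in_le)
  note s = lim_inD[OF assms(1)] and t = lim_inD[OF assms(2)]
  show "s n + t n \<in> H" for n using s(1) t(1) by simp
  show "x + y \<in> H" using s(2) t(2) by simp
  show "(\<lambda>n. nrm (s n - x) + nrm (t n - y)) \<longlonglongrightarrow> 0"
    using tendsto_add[OF s(3) t(3)] by simp
  show "nrm (s n + t n - (x + y)) \<le> nrm (s n - x) + nrm (t n - y)" for n
    using nrm_triangle[of "s n - x" "t n - y"] s(1)[of n] s(2) t(1)[of n] t(2)
    by (simp add: algebra_simps)
qed

lemma lim_in_bounded:
  assumes "lim_in s x" "linear_op H T" "\<And>x. x \<in> H \<Longrightarrow> nrm (T x) \<le> C * nrm x"
  shows "lim_in (\<lambda>n. T (s n)) (T x)"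
proof (rule lim_in_le)
  note s = lim_inD[OF assms(1)] and T = linear_opD[OF assms(2)]
  show "T (s n) \<in> H" for n using s(1) T(1) by simp
  show "T x \<in> H" using s(2) T(1) by simp
  show "(\<lambda>n. C * nrm (s n - x)) \<longlonglongrightarrow> 0"
    using tendsto_mult_right_zero[OF s(3)] .
  show "nrm (T (s n) - T x) \<le> C * nrm (s n - x)" for n
    using assms(3)[of "s n - x"] s(1)[of n] s(2) T(6)[of "s n" x] by simp
qed

lemma lim_in_scale:
  assumes "lim_in s x"
  shows "lim_in (\<lambda>n. c *\<^sub>C s n) (c *\<^sub>C x)"
  using lim_in_bounded[OF assms linear_op_scale[OF linear_op_id], of c "cmod c"]
  by (simp add: nrm_scale)

lemma lim_in_diff:
  assumes "lim_in s x" "lim_in t y"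
  shows "lim_in (\<lambda>n. s n - t n) (x - y)"
  using lim_in_add[OF assms(1) lim_in_scale[OF assms(2), of "- 1"]]
  by (simp add: scaleC_minus_one)

lemma lim_in_Suc: "lim_in s x \<Longrightarrow> lim_in (\<lambda>n. s (Suc n)) x"
  unfolding lim_in_def by (auto intro: LIMSEQ_Suc)

lemma lim_in_nrm_le:
  assumes "lim_in s x" "\<And>n. nrm (s n) \<le> C"
  shows "nrm x \<le> C"
  using LIMSEQ_le_const2[OF lim_inD(4)[OF assms(1)]] assms(2) by blast

definition dense_in :: "'a set \<Rightarrow> bool" where
  "dense_in V \<longleftrightarrow> (\<forall>v\<in>H. \<exists>s. (\<forall>n. s n \<in> V) \<and> lim_in s v)"

lemma dense_inE:
  assumes "dense_in V" "v \<in> H"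
  obtains s where "\<And>n. s n \<in> V" "lim_in s v"
  using assms unfolding dense_in_def by blast

lemma dense_bound:
  assumes "dense_in V" "linear_op H T" "\<And>x. x \<in> H \<Longrightarrow> nrm (T x) \<le> C * nrm x"
    "\<And>x. x \<in> V \<Longrightarrow> nrm (T x) \<le> D * nrm x" "x \<in> H"
  shows "nrm (T x) \<le> D * nrm x"
proof -
  obtain s where s: "\<And>n. s n \<in> V" "lim_in s x" using dense_inE[OF assms(1,5)] by blast
  have 1: "(\<lambda>n. nrm (T (s n))) \<longlonglongrightarrow> nrm (T x)"
    using lim_inD(4)[OF lim_in_bounded[OF s(2) assms(2), of C]] assms(3) by blast
  have 2: "(\<lambda>n. D * nrm (s n)) \<longlonglongrightarrow> D * nrm x"
    by (rule tendsto_mult_left[OF lim_inD(4)[OF s(2)]])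
  show ?thesis
    by (rule LIMSEQ_le[OF 1 2]) (use assms(4) s(1) in blast)
qed

end

context inner_space
begin

lemma lim_in_unique: "lim_in s x \<Longrightarrow> lim_in s y \<Longrightarrow> x = y"
  using limit_unique[of s x y] unfolding lim_in_def by blast

lemma dense_eq:
  assumes "dense_in V" "linear_op H S" "linear_op H T"
    "\<And>x. x \<in> H \<Longrightarrow> nrm (S x) \<le> C * nrm x" "\<And>x. x \<in> H \<Longrightarrow> nrm (T x) \<le> D * nrm x"
    "\<And>x. x \<in> V \<Longrightarrow> S x = T x" "x \<in> H"
  shows "S x = T x"
proof -
  obtain s where s: "\<And>n. s n \<in> V" "lim_in s x" using dense_inE[OF assms(1,7)] by blast
  have "lim_in (\<lambda>n. S (s n)) (S x)"
    using lim_in_bounded[OF s(2) assms(2), of C] assms(4) by blast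
  moreover have "lim_in (\<lambda>n. S (s n)) (T x)"
    using lim_in_bounded[OF s(2) assms(3), of D] assms(5,6) s(1) by simp
  ultimately show ?thesis by (rule lim_in_unique)
qed

end

locale hilbert = inner_space +
  assumes complete: "\<lbrakk>\<And>n::nat. s n \<in> H; \<And>e. 0 < e \<Longrightarrow> \<exists>N. \<forall>m\<ge>N. \<forall>n\<ge>N. nrm (s m - s n) < e\<rbrakk>
    \<Longrightarrow> \<exists>x. lim_in s x"
begin

text \<open>A representing vector minimises \<open>J\<close>. Since \<open>V\<close> need not be
  closed, a minimising sequence is taken instead; it is Cauchy by the parallelogram law, and its
  limit \<open>u\<close> lies in the closure of \<open>V\<close>. Because the sequence is part of
  the conclusion, the same lemma yields the Riesz theorem, the density criterion and the norm bound
  needed to extend operators from a dense range.\<close>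

lemma riesz_subspace:
  assumes V: "csubspace V" "V \<subseteq> H"
    and add: "\<And>x y. x \<in> V \<Longrightarrow> y \<in> V \<Longrightarrow> \<phi> (x + y) = \<phi> x + \<phi> y"
    and scale: "\<And>c x. x \<in> V \<Longrightarrow> \<phi> (c *\<^sub>C x) = c * \<phi> x"
    and bound: "\<And>x. x \<in> V \<Longrightarrow> cmod (\<phi> x) \<le> C * nrm x"
  obtains s u where "\<And>n. s n \<in> V" "lim_in s u" "\<And>x. x \<in> V \<Longrightarrow> \<phi> x = ip x u"
proof -
  note V' = csubspaceD[OF V(1)]
  have VH: "x \<in> V \<Longrightarrow> x \<in> H" for x using V(2) by blast
  define J where "J = (\<lambda>x. (nrm x)\<^sup>2 - 2 * Re (\<phi> x))"
  have J_lower: "- C\<^sup>2 \<le> J x" if "x \<in> V" for x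
  proof -
    have "Re (\<phi> x) \<le> C * nrm x"
      using bound[OF that] complex_Re_le_cmod[of "\<phi> x"] by linarith
    moreover have "0 \<le> (nrm x - C)\<^sup>2" by simp
    ultimately show ?thesis by (simp add: J_def power2_diff algebra_simps)
  qed
  define m where "m = (INF x\<in>V. J x)"
  have bdd: "bdd_below (J ` V)" using J_lower by (intro bdd_belowI2)
  have m_le: "m \<le> J x" if "x \<in> V" for x
    unfolding m_def by (rule cINF_lower[OF bdd that])
  have "\<exists>x\<in>V. J x < m + 1 / real (Suc n)" for n
    using cINF_less_iff[OF _ bdd, of "m + 1 / real (Suc n)"] V'(1) by (auto simp: m_def)
  then obtain s where s: "\<And>n. s n \<in> V" "\<And>n. J (s n) < m + 1 / real (Suc n)" by metis
  have sH: "s n \<in> H" for n using VH s(1) .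
  \<comment> \<open>At the midpoint, \<open>J\<close> lies below the mean of \<open>J x\<close> and
    \<open>J y\<close> by a quarter of the squared distance, and it is still at least
    \<open>m\<close>.\<close>
  have J_par: "(nrm (x - y))\<^sup>2 \<le> 2 * (J x + J y - 2 * m)" if "x \<in> V" "y \<in> V" for x y
  proof -
    define z where "z = (1/2) *\<^sub>C (x + y)"
    have z: "z \<in> V" using that V' by (simp add: z_def)
    have nz: "nrm z = nrm (x + y) / 2" using VH that by (simp add: z_def nrm_scale)
    have \<phi>z: "\<phi> z = (\<phi> x + \<phi> y) / 2" using that V' by (simp add: z_def scale add)
    have "J z = (nrm (x + y))\<^sup>2 / 4 - (Re (\<phi> x) + Re (\<phi> y))"
      unfolding J_def nz \<phi>z by (simp add: power_divide field_simps)
    then have "J x + J y - 2 * J z = (nrm (x - y))\<^sup>2 / 2"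
      using parallelogram[OF VH[OF that(1)] VH[OF that(2)]] by (simp add: J_def)
    then show ?thesis using m_le[OF z] by simp
  qed
  have cauchy: "\<exists>N. \<forall>i\<ge>N. \<forall>j\<ge>N. nrm (s i - s j) < e" if e: "0 < e" for e
  proof -
    \<comment> \<open>Beyond \<open>N\<close> both values of \<open>J\<close> exceed
      \<open>m\<close> by less than a quarter of \<open>e\<close> squared, so the bound of
      \<open>J_par\<close> stays below \<open>e\<close> squared.\<close>
    obtain N :: nat where N: "4 / e\<^sup>2 < real N" using reals_Archimedean2 by blast
    have "nrm (s i - s j) < e" if "N \<le> i" "N \<le> j" for i j
    proof -
      have small: "J (s k) < m + e\<^sup>2 / 4" if "N \<le> k" for k
      proof -
        have "4 / e\<^sup>2 < real (Suc k)" using N that by simp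
        then have "1 / real (Suc k) < e\<^sup>2 / 4" using e by (simp add: field_simps)
        then show ?thesis by (rule less_trans[OF s(2) add_strict_left_mono])
      qed
      have "(nrm (s i - s j))\<^sup>2 < e\<^sup>2"
        using J_par[OF s(1)[of i] s(1)[of j]] small[OF that(1)] small[OF that(2)]
        by simp
      then show ?thesis using e by (simp add: power2_less_imp_less)
    qed
    then show ?thesis by blast
  qed
  obtain u where u: "lim_in s u" using complete[of s, OF sH cauchy] by blast
  have uH: "u \<in> H" using lim_inD(2)[OF u] .
  have Re_eq: "Re (\<phi> z) = Re (ip z u)" if z: "z \<in> V" for z
  proof -
    \<comment> \<open>The variation is taken at \<open>s n\<close> and not at the limit
      \<open>u\<close>: the functional is only known to be linear and bounded on \<open>V\<close>,
      and \<open>u\<close> may lie outside.\<close>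
    have ineq: "m \<le> J (s n) + 2 * t * (Re (ip z (s n)) - Re (\<phi> z)) + t\<^sup>2 * (nrm z)\<^sup>2" for t :: real and n
    proof -
      define w where "w = of_real t *\<^sub>C z"
      have w: "w \<in> V" "w \<in> H" using z V' VH by (auto simp: w_def)
      have "(nrm (s n + w))\<^sup>2 = (nrm (s n))\<^sup>2 + 2 * Re (ip w (s n)) + (nrm w)\<^sup>2"
        using w sH[of n] cnj_sym[OF w(2) sH[of n]] by (simp add: nrm_sq add_left add_right)
      moreover have "Re (ip w (s n)) = t * Re (ip z (s n))"
        using z VH sH by (simp add: w_def scale_left)
      moreover have "(nrm w)\<^sup>2 = t\<^sup>2 * (nrm z)\<^sup>2"
        using z VH by (simp add: w_def nrm_scale power_mult_distrib)
      moreover have "\<phi> (s n + w) = \<phi> (s n) + of_real t * \<phi> z"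
        using z w s(1) by (simp add: add scale w_def)
      ultimately show ?thesis
        using m_le[of "s n + w"] V'(2)[OF s(1)[of n] w(1)] by (simp add: J_def algebra_simps)
    qed
    have J_lim: "(\<lambda>n. J (s n)) \<longlonglongrightarrow> m"
    proof -
      have "(\<lambda>n. J (s n) - m) \<longlonglongrightarrow> 0"
      proof (rule null_comparison[OF LIMSEQ_inverse_real_of_nat])
        show "norm (J (s n) - m) \<le> inverse (real (Suc n))" for n
          using m_le[OF s(1)[of n]] s(2)[of n] by (simp add: inverse_eq_divide)
      qed
      then show ?thesis by (simp add: LIM_zero_iff)
    qed
    have "Re (ip z u) - Re (\<phi> z) = 0"
    proof (rule quadratic_nonneg_imp_zero)
      show "0 \<le> (nrm z)\<^sup>2" by simp
      show "0 \<le> 2 * t * (Re (ip z u) - Re (\<phi> z)) + t\<^sup>2 * (nrm z)\<^sup>2" for t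
      proof -
        have "(\<lambda>n. J (s n) + 2 * t * (Re (ip z (s n)) - Re (\<phi> z)) + t\<^sup>2 * (nrm z)\<^sup>2) \<longlonglongrightarrow>
            m + 2 * t * (Re (ip z u) - Re (\<phi> z)) + t\<^sup>2 * (nrm z)\<^sup>2"
          by (intro tendsto_intros J_lim lim_inD(6)[OF u] VH z)
        from LIMSEQ_le_const[OF this, of m] ineq show ?thesis by auto
      qed
    qed
    then show ?thesis by simp
  qed
  have "\<phi> x = ip x u" if x: "x \<in> V" for x
  proof -
    have "Re (\<phi> (\<i> *\<^sub>C x)) = Re (ip (\<i> *\<^sub>C x) u)"
      using Re_eq V'(3)[OF x] by blast
    then have "Im (\<phi> x) = Im (ip x u)"
      using x uH VH by (simp add: scale scale_left)
    with Re_eq[OF x] show ?thesis by (simp add: complex_eq_iff)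
  qed
  with that s(1) u show ?thesis by blast
qed

lemma riesz:
  assumes "\<And>x y. x \<in> H \<Longrightarrow> y \<in> H \<Longrightarrow> \<phi> (x + y) = \<phi> x + \<phi> y"
    and "\<And>c x. x \<in> H \<Longrightarrow> \<phi> (c *\<^sub>C x) = c * \<phi> x"
    and "\<And>x. x \<in> H \<Longrightarrow> cmod (\<phi> x) \<le> C * nrm x"
  obtains u where "u \<in> H" "\<And>x. x \<in> H \<Longrightarrow> \<phi> x = ip x u"
  using riesz_subspace[of H \<phi> C] assms H_subspace lim_inD(2) by (metis order_refl)

text \<open>The vector \<open>u\<close> that represents pairing with \<open>v\<close> on
  \<open>V\<close> is the orthogonal projection of \<open>v\<close> to the closure of
  \<open>V\<close>. So \<open>v - u\<close> is orthogonal to \<open>V\<close>, hence 0, and the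
  sequence that comes with \<open>u\<close> approximates \<open>v\<close>.\<close>

lemma dense_inI:
  assumes V: "csubspace V" "V \<subseteq> H" and perp: "\<And>y. y \<in> H \<Longrightarrow> (\<And>x. x \<in> V \<Longrightarrow> ip x y = 0) \<Longrightarrow> y = 0"
  shows "dense_in V"
  unfolding dense_in_def
proof
  fix v assume v: "v \<in> H"
  have VH: "x \<in> V \<Longrightarrow> x \<in> H" for x using V(2) by blast
  obtain s u where s: "\<And>n. s n \<in> V" "lim_in s u" "\<And>x. x \<in> V \<Longrightarrow> ip x v = ip x u"
  proof (rule riesz_subspace[OF V, of "\<lambda>x. ip x v" "nrm v"])
    show "cmod (ip x v) \<le> nrm v * nrm x" if "x \<in> V" for x
      using Cauchy_Schwarz[OF VH[OF that] v] by (simp add: mult.commute)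
  qed (use V v VH in \<open>auto simp: add_left scale_left\<close>)
  have u: "u \<in> H" using lim_inD(2)[OF s(2)] .
  have "v - u = 0"
    using perp[of "v - u"] s(3) u v VH by (simp add: diff_right)
  with s(1,2) show "\<exists>s. (\<forall>n. s n \<in> V) \<and> lim_in s v" by auto
qed

end

section \<open>Positive square roots\<close>

text \<open>The iteration \<open>Y \<mapsto> (X + Y\<^sup>2) / 2\<close> converges to \<open>1 - (1 - X)\<^sup>1\<^sup>/\<^sup>2\<close> when \<open>X\<close> is a contraction. The same
  iteration with \<open>X = 1\<close> in the reals dominates the norms of the iterates and of their differences.\<close>

primrec sqrt_iter :: "('a::complex_vector \<Rightarrow> 'a) \<Rightarrow> nat \<Rightarrow> 'a \<Rightarrow> 'a" where
  "sqrt_iter X 0 x = 0"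
| "sqrt_iter X (Suc n) x = (1/2) *\<^sub>C (X x + sqrt_iter X n (sqrt_iter X n x))"

primrec sqrt_majorant :: "nat \<Rightarrow> real" where
  "sqrt_majorant 0 = 0"
| "sqrt_majorant (Suc n) = (1 + (sqrt_majorant n)\<^sup>2) / 2"

lemma sqrt_majorant_bounds: "0 \<le> sqrt_majorant n \<and> sqrt_majorant n \<le> 1"
proof (induction n)
  case (Suc n)
  then have "(sqrt_majorant n)\<^sup>2 \<le> 1" by (simp add: power_le_one)
  then show ?case by simp
qed simp

lemma sqrt_majorant_Suc: "sqrt_majorant n \<le> sqrt_majorant (Suc n)"
proof -
  have "0 \<le> (1 - sqrt_majorant n)\<^sup>2" by simp
  then show ?thesis by (simp add: power2_diff)
qed

lemma sqrt_majorant_mono: "m \<le> n \<Longrightarrow> sqrt_majorant m \<le> sqrt_majorant n"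
  using lift_Suc_mono_le[of sqrt_majorant] sqrt_majorant_Suc by blast

lemma sqrt_majorant_Cauchy: "Cauchy sqrt_majorant"
proof (rule convergent_Cauchy)
  have "incseq sqrt_majorant" by (rule incseq_SucI) (rule sqrt_majorant_Suc)
  then show "convergent sqrt_majorant"
    using incseq_convergent[of sqrt_majorant 1] sqrt_majorant_bounds by (metis convergentI)
qed

context semi_inner
begin

definition commutes :: "('a \<Rightarrow> 'a) \<Rightarrow> ('a \<Rightarrow> 'a) \<Rightarrow> bool" where
  "commutes S T \<longleftrightarrow> (\<forall>x\<in>H. S (T x) = T (S x))"

lemma commutesD: "commutes S T \<Longrightarrow> x \<in> H \<Longrightarrow> S (T x) = T (S x)"
  by (simp add: commutes_def)

definition self_adjoint :: "('a \<Rightarrow> 'a) \<Rightarrow> bool" where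
  "self_adjoint T \<longleftrightarrow> (\<forall>x\<in>H. \<forall>y\<in>H. ip (T x) y = ip x (T y))"

lemma self_adjointD: "self_adjoint T \<Longrightarrow> x \<in> H \<Longrightarrow> y \<in> H \<Longrightarrow> ip (T x) y = ip x (T y)"
  by (simp add: self_adjoint_def)

lemma positive_semi_inner:
  assumes T: "linear_op H T" and pos: "positive_op H ip T"
  shows "semi_inner H (\<lambda>x y. ip (T x) y)"
proof (rule semi_inner_polarize[OF H_subspace])
  note T' = linear_opD[OF T]
  show "ip (T x) x \<in> \<real>\<^sub>\<ge>\<^sub>0" if "x \<in> H" for x
    using pos that by (simp add: positive_op_def)
qed (simp_all add: linear_opD[OF T] ip_simps)

lemma semi_inner_imp_self_adjoint:
  assumes T: "linear_op H T" and "semi_inner H (\<lambda>x y. ip (T x) y)"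
  shows "self_adjoint T"
  unfolding self_adjoint_def
proof (intro ballI)
  fix x y assume x: "x \<in> H" and y: "y \<in> H"
  interpret q: semi_inner H "\<lambda>x y. ip (T x) y" by fact
  show "ip (T x) y = ip x (T y)"
    using q.cnj_sym[OF y x] cnj_sym[OF linear_opD(1)[OF T y] x] by simp
qed

lemma positive_self_adjoint:
  "linear_op H T \<Longrightarrow> positive_op H ip T \<Longrightarrow> self_adjoint T"
  using positive_semi_inner semi_inner_imp_self_adjoint by blast

text \<open>Cauchy-Schwarz for the form \<open>ip (T x) y\<close>, applied to the pair
  \<open>x\<close> and \<open>T x\<close>, turns the bound on the quadratic form into a bound on the
  norm.\<close>

lemma positive_contraction:
  assumes T: "linear_op H T" and q: "semi_inner H (\<lambda>x y. ip (T x) y)"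
    and le: "\<And>x. x \<in> H \<Longrightarrow> Re (ip (T x) x) \<le> (nrm x)\<^sup>2"
    and x: "x \<in> H"
  shows "nrm (T x) \<le> nrm x"
proof -
  interpret q: semi_inner H "\<lambda>x y. ip (T x) y" by fact
  have Tx: "T x \<in> H" using linear_opD(1)[OF T x] .
  have *: "q.nrm y \<le> nrm y" if "y \<in> H" for y
    using le[OF that] by (simp add: ip_norm_def nonneg that)
  have "(nrm (T x))\<^sup>2 = cmod (ip (T x) (T x))"
    using Tx by (simp add: ip_self norm_power)
  also have "\<dots> \<le> q.nrm x * q.nrm (T x)" by (rule q.Cauchy_Schwarz[OF x Tx])
  also have "\<dots> \<le> nrm x * nrm (T x)"
    using x Tx * by (intro mult_mono) auto
  finally have "nrm (T x) * nrm (T x) \<le> nrm x * nrm (T x)" by (simp add: power2_eq_square)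
  then show ?thesis
    using nrm_ge_0[OF Tx] nrm_ge_0[OF x] by (cases "nrm (T x) = 0") auto
qed

lemma sqrt_iter_linear:
  assumes X: "linear_op H X"
  shows "linear_op H (sqrt_iter X n)"
proof (induction n)
  case 0
  show ?case by (simp add: linear_op_def)
next
  case (Suc n)
  show ?case
    using linear_op_scale[OF linear_op_add[OF X linear_op_compose[OF Suc Suc]], of "1/2"]
    by (simp add: linear_op_def)
qed

lemma sqrt_iter_commutes:
  assumes X: "linear_op H X" and C: "linear_op H C" "commutes C X"
  shows "commutes C (sqrt_iter X n)"
proof (induction n)
  case 0
  show ?case by (simp add: commutes_def linear_opD(4)[OF C(1)])
next
  case (Suc n)
  note Y = linear_opD[OF sqrt_iter_linear[OF X]] and C' = linear_opD[OF C(1)] and X' = linear_opD[OF X]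
  show ?case
    unfolding commutes_def
  proof
    fix x assume x: "x \<in> H"
    then show "C (sqrt_iter X (Suc n) x) = sqrt_iter X (Suc n) (C x)"
      by (simp add: C' X' Y commutesD[OF C(2)] commutesD[OF Suc])
  qed
qed

lemma sqrt_iter_self_adjoint:
  assumes X: "linear_op H X" "self_adjoint X"
  shows "self_adjoint (sqrt_iter X n)"
proof (induction n)
  case 0
  show ?case by (simp add: self_adjoint_def)
next
  case (Suc n)
  note Y = linear_opD[OF sqrt_iter_linear[OF X(1)]] and X' = linear_opD[OF X(1)]
  show ?case
    unfolding self_adjoint_def
    by (simp add: X' Y ip_simps self_adjointD[OF X(2)] self_adjointD[OF Suc])
qed

lemma sqrt_iter_bound:
  assumes X: "linear_op H X" and le: "\<And>x. x \<in> H \<Longrightarrow> nrm (X x) \<le> nrm x" and x: "x \<in> H"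
  shows "nrm (sqrt_iter X n x) \<le> sqrt_majorant n * nrm x"
  using x
proof (induction n arbitrary: x)
  case 0
  then show ?case by simp
next
  case (Suc n)
  note Y = linear_opD(1)[OF sqrt_iter_linear[OF X, of n]] and X' = linear_opD(1)[OF X]
  note x = \<open>x \<in> H\<close>
  have "nrm (sqrt_iter X n (sqrt_iter X n x)) \<le> sqrt_majorant n * nrm (sqrt_iter X n x)"
    using Suc.IH[OF Y[OF x]] .
  also have "\<dots> \<le> sqrt_majorant n * (sqrt_majorant n * nrm x)"
    using Suc.IH[OF x] sqrt_majorant_bounds by (intro mult_left_mono) auto
  finally have "nrm (sqrt_iter X n (sqrt_iter X n x)) \<le> (sqrt_majorant n)\<^sup>2 * nrm x"
    by (simp add: power2_eq_square mult.assoc)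
  moreover have "nrm (X x + sqrt_iter X n (sqrt_iter X n x))
      \<le> nrm (X x) + nrm (sqrt_iter X n (sqrt_iter X n x))"
    using X'[OF x] Y[OF Y[OF x]] by (rule nrm_triangle)
  ultimately show ?case
    using le[OF x] X'[OF x] Y[OF Y[OF x]] by (simp add: nrm_scale field_simps)
qed

lemma sqrt_iter_step:
  assumes X: "linear_op H X" and le: "\<And>x. x \<in> H \<Longrightarrow> nrm (X x) \<le> nrm x" and x: "x \<in> H"
  shows "nrm (sqrt_iter X (Suc n) x - sqrt_iter X n x) \<le> (sqrt_majorant (Suc n) - sqrt_majorant n) * nrm x"
  using x
proof (induction n arbitrary: x)
  case 0
  then show ?case
    using le linear_opD(1)[OF X] by (simp add: nrm_scale)
next
  case (Suc n)
  define Y Z y z where "Y = sqrt_iter X (Suc n)" and "Z = sqrt_iter X n"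
    and "y = sqrt_majorant (Suc n)" and "z = sqrt_majorant n"
  note x = \<open>x \<in> H\<close>
  note Y = linear_opD[OF sqrt_iter_linear[OF X, of "Suc n"], folded Y_def]
    and Z = linear_opD[OF sqrt_iter_linear[OF X, of n], folded Z_def] and X' = linear_opD(1)[OF X]
  have IH: "nrm (Y x - Z x) \<le> (y - z) * nrm x" if "x \<in> H" for x
    using Suc.IH[OF that] by (simp only: Y_def Z_def y_def z_def)
  have yz: "0 \<le> z" "z \<le> y" "0 \<le> y"
    using sqrt_majorant_bounds[of n] sqrt_majorant_bounds[of "Suc n"] sqrt_majorant_Suc[of n]
    unfolding y_def z_def by auto
  have "sqrt_iter X (Suc (Suc n)) x - sqrt_iter X (Suc n) x
      = (1/2) *\<^sub>C (X x + Y (Y x)) - (1/2) *\<^sub>C (X x + Z (Z x))"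
    unfolding Y_def Z_def by simp
  \<comment> \<open>A difference of squares written without commuting \<open>Y\<close> and
    \<open>Z\<close>. The estimates of the two terms add up to \<open>(y - z) * (y + z) / 2\<close>,
    the next increment of the majorant.\<close>
  also have "\<dots> = (1/2) *\<^sub>C (Y (Y x - Z x) + (Y (Z x) - Z (Z x)))"
    using x by (simp add: Y Z flip: scaleC_diff_right)
  finally have eq: "sqrt_iter X (Suc (Suc n)) x - sqrt_iter X (Suc n) x
      = (1/2) *\<^sub>C (Y (Y x - Z x) + (Y (Z x) - Z (Z x)))" .
  have "nrm (Y (Y x - Z x)) \<le> y * nrm (Y x - Z x)"
    using sqrt_iter_bound[OF X le, of "Y x - Z x" "Suc n"] x Y(1) Z(1) unfolding Y_def[symmetric] y_def[symmetric] by auto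
  also have "\<dots> \<le> y * ((y - z) * nrm x)"
    using IH[OF x] yz by (intro mult_left_mono)
  finally have 1: "nrm (Y (Y x - Z x)) \<le> y * ((y - z) * nrm x)" .
  have "nrm (Y (Z x) - Z (Z x)) \<le> (y - z) * nrm (Z x)"
    using IH[OF Z(1)[OF x]] .
  also have "\<dots> \<le> (y - z) * (z * nrm x)"
    using sqrt_iter_bound[OF X le x, of n] yz unfolding Z_def z_def by (intro mult_left_mono) auto
  finally have 2: "nrm (Y (Z x) - Z (Z x)) \<le> (y - z) * (z * nrm x)" .
  have "nrm (Y (Y x - Z x) + (Y (Z x) - Z (Z x))) \<le> nrm (Y (Y x - Z x)) + nrm (Y (Z x) - Z (Z x))"
    using x Y(1) Z(1) by (intro nrm_triangle) auto
  then have "nrm (sqrt_iter X (Suc (Suc n)) x - sqrt_iter X (Suc n) x)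
      \<le> (1/2) * (y * ((y - z) * nrm x) + (y - z) * (z * nrm x))"
    unfolding eq using 1 2 x Y(1) Z(1) by (simp add: nrm_scale)
  also have "\<dots> = ((1 + y\<^sup>2) / 2 - (1 + z\<^sup>2) / 2) * nrm x"
    by (simp add: field_simps power2_eq_square)
  also have "\<dots> = (sqrt_majorant (Suc (Suc n)) - sqrt_majorant (Suc n)) * nrm x"
    by (simp only: y_def z_def sqrt_majorant.simps)
  finally show ?case .
qed

lemma sqrt_iter_diff:
  assumes X: "linear_op H X" and le: "\<And>x. x \<in> H \<Longrightarrow> nrm (X x) \<le> nrm x" and x: "x \<in> H" and "m \<le> n"
  shows "nrm (sqrt_iter X n x - sqrt_iter X m x) \<le> (sqrt_majorant n - sqrt_majorant m) * nrm x"
  using \<open>m \<le> n\<close>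
proof (induction n rule: dec_induct)
  case base
  show ?case by simp
next
  case (step n)
  note Y = linear_opD(1)[OF sqrt_iter_linear[OF X] x]
  have "nrm (sqrt_iter X (Suc n) x - sqrt_iter X m x)
      \<le> nrm (sqrt_iter X (Suc n) x - sqrt_iter X n x) + nrm (sqrt_iter X n x - sqrt_iter X m x)"
    by (rule nrm_triangle3[OF Y Y Y])
  also have "\<dots> \<le> (sqrt_majorant (Suc n) - sqrt_majorant n) * nrm x + (sqrt_majorant n - sqrt_majorant m) * nrm x"
    by (rule add_mono[OF sqrt_iter_step[OF X le x] step.IH])
  finally show ?case by (simp only: left_diff_distrib)
qed

end

context hilbert
begin

lemma sqrt_iter_limit:
  assumes X: "linear_op H X" and le: "\<And>x. x \<in> H \<Longrightarrow> nrm (X x) \<le> nrm x"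
  obtains L where "linear_op H L" "\<And>x. x \<in> H \<Longrightarrow> nrm (L x) \<le> nrm x"
    "\<And>x. x \<in> H \<Longrightarrow> L x = (1/2) *\<^sub>C (X x + L (L x))"
    "\<And>x. x \<in> H \<Longrightarrow> lim_in (\<lambda>n. sqrt_iter X n x) (L x)"
proof -
  let ?Y = "sqrt_iter X"
  note Y = linear_opD[OF sqrt_iter_linear[OF X]]
  have Y_le: "nrm (?Y n x) \<le> nrm x" if x: "x \<in> H" for n x
    using sqrt_iter_bound[OF X le x, of n] sqrt_majorant_bounds[of n]
      mult_right_mono[of "sqrt_majorant n" 1 "nrm x"] x by simp
  have "\<exists>l. lim_in (\<lambda>n. ?Y n x) l" if x: "x \<in> H" for x
  proof (rule complete)
    show "?Y n x \<in> H" for n using Y(1)[OF x] .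
    fix e :: real assume e: "0 < e"
    have pos: "0 < nrm x + 1" using nrm_ge_0[OF x] by linarith
    obtain N where N: "\<And>m n. N \<le> m \<Longrightarrow> N \<le> n \<Longrightarrow> dist (sqrt_majorant m) (sqrt_majorant n) < e / (nrm x + 1)"
      using metric_CauchyD[OF sqrt_majorant_Cauchy, of "e / (nrm x + 1)"] e pos by auto
    have *: "nrm (?Y n x - ?Y m x) < e" if "N \<le> m" "m \<le> n" for m n
    proof -
      have "sqrt_majorant n - sqrt_majorant m < e / (nrm x + 1)"
        using N[of m n] that by (simp add: dist_real_def)
      then have "(sqrt_majorant n - sqrt_majorant m) * (nrm x + 1) < e"
        using pos by (simp add: pos_less_divide_eq)
      moreover have "(sqrt_majorant n - sqrt_majorant m) * nrm x \<le> (sqrt_majorant n - sqrt_majorant m) * (nrm x + 1)"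
        using sqrt_majorant_mono[OF that(2)] by (intro mult_left_mono) auto
      ultimately show ?thesis using sqrt_iter_diff[OF X le x that(2)] by linarith
    qed
    have "nrm (?Y m x - ?Y n x) < e" if "N \<le> m" "N \<le> n" for m n
    proof (cases "m \<le> n")
      case True
      then show ?thesis
        using *[OF that(1) True] nrm_minus_commute[OF Y(1)[OF x] Y(1)[OF x], of m n] by simp
    next
      case False
      then show ?thesis using *[of n m] that by simp
    qed
    then show "\<exists>N. \<forall>m\<ge>N. \<forall>n\<ge>N. nrm (?Y m x - ?Y n x) < e" by blast
  qed
  then obtain L where L: "\<And>x. x \<in> H \<Longrightarrow> lim_in (\<lambda>n. ?Y n x) (L x)" by metis
  have LH: "L x \<in> H" if "x \<in> H" for x using lim_inD(2)[OF L[OF that]] .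
  have lin: "linear_op H L"
    unfolding linear_op_def
  proof (intro conjI ballI allI)
    show "L x \<in> H" if "x \<in> H" for x using LH[OF that] .
    show "L (x + y) = L x + L y" if x: "x \<in> H" and y: "y \<in> H" for x y
      using lim_in_add[OF L[OF x] L[OF y]] L[OF add_mem[OF x y]]
      by (auto simp: Y(2)[OF x y] intro: lim_in_unique)
    show "L (c *\<^sub>C x) = c *\<^sub>C L x" if x: "x \<in> H" for c x
      using lim_in_scale[OF L[OF x], of c] L[OF scale_mem[OF x], of c]
      by (auto simp: Y(3)[OF x] intro: lim_in_unique)
  qed
  have L_le: "nrm (L x) \<le> nrm x" if x: "x \<in> H" for x
    using lim_in_nrm_le[OF L[OF x]] Y_le[OF x] by blast
  have "L x = (1/2) *\<^sub>C (X x + L (L x))" if x: "x \<in> H" for x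
  proof -
    \<comment> \<open>The iterates are contractions, so replacing the inner \<open>?Y n x\<close> by
      \<open>L x\<close> costs at most \<open>nrm (?Y n x - L x)\<close>; what remains is
      convergence at the fixed vector \<open>L x\<close>.\<close>
    have "lim_in (\<lambda>n. ?Y n (?Y n x)) (L (L x))"
    proof (rule lim_in_le)
      show "?Y n (?Y n x) \<in> H" for n using Y(1)[OF Y(1)[OF x]] .
      show "L (L x) \<in> H" using LH[OF LH[OF x]] .
      show "(\<lambda>n. nrm (?Y n x - L x) + nrm (?Y n (L x) - L (L x))) \<longlonglongrightarrow> 0"
        using tendsto_add[OF lim_inD(3)[OF L[OF x]] lim_inD(3)[OF L[OF LH[OF x]]]] by simp
      fix n
      have "nrm (?Y n (?Y n x) - L (L x)) \<le> nrm (?Y n (?Y n x) - ?Y n (L x)) + nrm (?Y n (L x) - L (L x))"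
        by (rule nrm_triangle3[OF Y(1)[OF Y(1)[OF x]] Y(1)[OF LH[OF x]] LH[OF LH[OF x]]])
      also have "nrm (?Y n (?Y n x) - ?Y n (L x)) \<le> nrm (?Y n x - L x)"
        using Y_le[of "?Y n x - L x" n] Y(6)[OF Y(1)[OF x] LH[OF x]] Y(1)[OF x] LH[OF x] by simp
      finally show "nrm (?Y n (?Y n x) - L (L x)) \<le> nrm (?Y n x - L x) + nrm (?Y n (L x) - L (L x))"
        by simp
    qed
    then have "lim_in (\<lambda>n. ?Y (Suc n) x) ((1/2) *\<^sub>C (X x + L (L x)))"
      using lim_in_scale[OF lim_in_add[OF lim_in_const[OF linear_opD(1)[OF X x]]]] by simp
    with lim_in_Suc[OF L[OF x]] show ?thesis by (rule lim_in_unique)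
  qed
  with that[OF lin L_le] L show ?thesis by blast
qed

text \<open>With \<open>X = 1 - A\<close> the fixed point equation \<open>2 L = X + L L\<close> says
  that \<open>1 - L\<close> squares to \<open>A\<close>. The conclusion on commuting operators is
  there for uniqueness: every other root of \<open>A\<close> commutes with \<open>A\<close> and
  therefore with \<open>S\<close>.\<close>

lemma sqrt_exists:
  assumes A: "linear_op H A" "semi_inner H (\<lambda>x y. ip (A x) y)"
    and le: "\<And>x. x \<in> H \<Longrightarrow> Re (ip (A x) x) \<le> (nrm x)\<^sup>2"
  obtains S where "linear_op H S" "positive_op H ip S" "\<And>x. x \<in> H \<Longrightarrow> nrm (S x) \<le> 2 * nrm x"
    "\<And>x. x \<in> H \<Longrightarrow> S (S x) = A x"
    "\<And>C K. linear_op H C \<Longrightarrow> (\<And>x. x \<in> H \<Longrightarrow> nrm (C x) \<le> K * nrm x) \<Longrightarrow> commutes C A \<Longrightarrow> commutes C S"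
proof -
  define X where "X = (\<lambda>x. x - A x)"
  have X: "linear_op H X"
    unfolding X_def by (rule linear_op_diff[OF linear_op_id A(1)])
  note A' = linear_opD[OF A(1)]
  interpret a: semi_inner H "\<lambda>x y. ip (A x) y" by fact
  have "semi_inner H (\<lambda>x y. ip x y - ip (A x) y)"
    by (rule inner_mono_semi[OF A(2)]) (use le in \<open>simp add: nrm_sq\<close>)
  then have X_semi: "semi_inner H (\<lambda>x y. ip (X x) y)"
    by (rule semi_inner.cong_form) (simp add: X_def A' diff_left)
  have X_sa: "self_adjoint X"
    by (rule semi_inner_imp_self_adjoint[OF X X_semi])
  have X_le: "nrm (X x) \<le> nrm x" if "x \<in> H" for x
  proof (rule positive_contraction[OF X X_semi _ that])
    show "Re (ip (X y) y) \<le> (nrm y)\<^sup>2" if "y \<in> H" for y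
      using a.nonneg[OF that] that by (simp add: X_def A' diff_left nrm_sq)
  qed
  obtain L where L: "linear_op H L" "\<And>x. x \<in> H \<Longrightarrow> nrm (L x) \<le> nrm x"
    "\<And>x. x \<in> H \<Longrightarrow> L x = (1/2) *\<^sub>C (X x + L (L x))"
    "\<And>x. x \<in> H \<Longrightarrow> lim_in (\<lambda>n. sqrt_iter X n x) (L x)"
    using sqrt_iter_limit[OF X X_le] by metis
  note L' = linear_opD[OF L(1)]
  note Y = linear_opD(1)[OF sqrt_iter_linear[OF X]]
  have L_sa: "ip (L x) y = ip x (L y)" if x: "x \<in> H" and y: "y \<in> H" for x y
  proof (rule LIMSEQ_unique)
    show "(\<lambda>n. ip (sqrt_iter X n x) y) \<longlonglongrightarrow> ip (L x) y"
      by (rule lim_inD(5)[OF L(4)[OF x] y])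
    show "(\<lambda>n. ip (sqrt_iter X n x) y) \<longlonglongrightarrow> ip x (L y)"
      using lim_inD(6)[OF L(4)[OF y] x]
      by (simp add: self_adjointD[OF sqrt_iter_self_adjoint[OF X X_sa] x y])
  qed
  define S where "S = (\<lambda>x. x - L x)"
  show thesis
  proof (rule that)
    show S: "linear_op H S"
      unfolding S_def by (rule linear_op_diff[OF linear_op_id L(1)])
    show "nrm (S x) \<le> 2 * nrm x" if x: "x \<in> H" for x
      using nrm_triangle_diff[OF x L'(1)[OF x]] L(2)[OF x] by (simp add: S_def)
    show "positive_op H ip S"
      unfolding positive_op_def
    proof
      fix x assume x: "x \<in> H"
      have "cmod (ip (L x) x) \<le> nrm (L x) * nrm x"
        by (rule Cauchy_Schwarz[OF L'(1)[OF x] x])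
      also have "\<dots> \<le> nrm x * nrm x"
        using L(2)[OF x] x by (intro mult_right_mono) auto
      finally have "Re (ip (L x) x) \<le> Re (ip x x)"
        using complex_Re_le_cmod[of "ip (L x) x"] nrm_sq[OF x] by (simp add: power2_eq_square)
      moreover have "Im (ip (L x) x) = 0" "Im (ip x x) = 0"
        using cnj_sym[OF L'(1)[OF x] x] L_sa[OF x x] cnj_sym[OF x x]
        by (simp_all add: complex_eq_iff)
      ultimately show "ip (S x) x \<in> \<real>\<^sub>\<ge>\<^sub>0"
        using x L'(1)[OF x] by (simp add: S_def diff_left complex_nonneg_Reals_iff)
    qed
    show "S (S x) = A x" if x: "x \<in> H" for x
    proof -
      have "2 *\<^sub>C L x = (2 * (1/2)) *\<^sub>C (X x + L (L x))"
        by (subst L(3)[OF x]) (simp only: scaleC_scaleC)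
      then have "L x + L x = X x + L (L x)"
        using scaleC_add_left[of 1 1 "L x"] by (simp add: scaleC_one)
      then have "X x = L x + L x - L (L x)" by (simp add: algebra_simps)
      then have "A x = x - (L x + L x - L (L x))"
        by (simp add: X_def algebra_simps)
      also have "\<dots> = S (S x)"
        using x L'(1)[OF x] by (simp add: S_def L'(6) algebra_simps)
      finally show ?thesis ..
    qed
    fix C K
    assume C: "linear_op H C" "\<And>x. x \<in> H \<Longrightarrow> nrm (C x) \<le> K * nrm x" "commutes C A"
    note C' = linear_opD[OF C(1)]
    have CX: "commutes C X"
      unfolding commutes_def using C' A' commutesD[OF C(3)] by (simp add: X_def)
    have "C (L x) = L (C x)" if x: "x \<in> H" for x
    proof (rule lim_in_unique)
      show "lim_in (\<lambda>n. C (sqrt_iter X n x)) (C (L x))"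
        by (rule lim_in_bounded[OF L(4)[OF x] C(1,2)])
      show "lim_in (\<lambda>n. C (sqrt_iter X n x)) (L (C x))"
        using L(4)[OF C'(1)[OF x]] by (simp add: commutesD[OF sqrt_iter_commutes[OF X C(1) CX] x])
    qed
    then show "commutes C S"
      unfolding commutes_def using C' L' by (simp add: S_def)
  qed
qed

text \<open>Uniqueness of the positive root is what gives the definite description in
  \<open>sqrt_op\<close> its meaning.\<close>

lemma sqrt_op_properties:
  assumes A: "A \<in> B" "semi_inner H (\<lambda>x y. ip (A x) y)"
    and le: "\<And>x. x \<in> H \<Longrightarrow> Re (ip (A x) x) \<le> (nrm x)\<^sup>2"
  shows "sqrt_op H ip A \<in> B \<and> positive_op H ip (sqrt_op H ip A) \<and>
    compose H (sqrt_op H ip A) (sqrt_op H ip A) = A"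
proof -
  note A' = bounded_opsD[OF A(1)]
  obtain S where S: "linear_op H S" "positive_op H ip S" "\<And>x. x \<in> H \<Longrightarrow> nrm (S x) \<le> 2 * nrm x"
    "\<And>x. x \<in> H \<Longrightarrow> S (S x) = A x"
    "\<And>C K. linear_op H C \<Longrightarrow> (\<And>x. x \<in> H \<Longrightarrow> nrm (C x) \<le> K * nrm x) \<Longrightarrow> commutes C A \<Longrightarrow> commutes C S"
    using sqrt_exists[OF A'(1) A(2) le] by metis
  note S' = linear_opD[OF S(1)]
  have "\<exists>!S. S \<in> B \<and> positive_op H ip S \<and> compose H S S = A"
  proof (intro ex1I conjI)
    show "restrict S H \<in> B" by (rule bounded_opsI_restrict[OF S(1,3)])
    show "positive_op H ip (restrict S H)" using S(2) by (simp add: positive_op_def)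
    show "compose H (restrict S H) (restrict S H) = A"
      by (rule extensionalityI[OF compose_extensional A'(2)]) (simp add: compose_def S(4) S'(1))
    fix T assume T: "T \<in> B \<and> positive_op H ip T \<and> compose H T T = A"
    then have TB: "T \<in> B" and T_pos: "positive_op H ip T" and TT: "\<And>x. x \<in> H \<Longrightarrow> T (T x) = A x"
      using compose_eq[of _ H T T] by auto
    note T' = linear_opD[OF bounded_opsD(1)[OF TB]]
    have "commutes T A" unfolding commutes_def by (simp add: T'(1) flip: TT)
    then have TS: "commutes T S"
      using S(5)[OF bounded_opsD(1)[OF TB] op_norm_bound[OF TB]] by blast
    interpret s: semi_inner H "\<lambda>x y. ip (S x) y" by (rule positive_semi_inner[OF S(1,2)])
    interpret t: semi_inner H "\<lambda>x y. ip (T x) y" by (rule positive_semi_inner[OF bounded_opsD(1)[OF TB] T_pos])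
    have "T x = S x" if x: "x \<in> H" for x
    proof -
      \<comment> \<open>Since \<open>S\<close> and \<open>T\<close> commute,
        \<open>S y + T y = S (S x) - T (T x) = 0\<close>. The two positive forms then both vanish at
        \<open>y\<close>, and Cauchy-Schwarz for each of them makes \<open>S y\<close> and
        \<open>T y\<close> orthogonal to \<open>x\<close>; by self-adjointness \<open>y\<close> is
        orthogonal to itself.\<close>
      define y where "y = S x - T x"
      have y: "y \<in> H" using S'(1) T'(1) x by (simp add: y_def)
      have "S y + T y = 0"
        using x by (simp add: y_def S' T' S(4) TT commutesD[OF TS x])
      then have "Re (ip (S y) y) + Re (ip (T y) y) = 0"
        using add_left[OF S'(1)[OF y] T'(1)[OF y] y] y by (simp add: complex_eq_iff)
      then have 0: "s.nrm y = 0" "t.nrm y = 0"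
        using s.nonneg[OF y] t.nonneg[OF y] by (simp_all add: ip_norm_def)
      have "ip (S y) x = 0" "ip (T y) x = 0"
        using s.Cauchy_Schwarz[OF y x] t.Cauchy_Schwarz[OF y x] 0 by simp_all
      then have "ip y (S x) - ip y (T x) = 0"
        using self_adjointD[OF positive_self_adjoint[OF S(1,2)] y x]
          self_adjointD[OF positive_self_adjoint[OF bounded_opsD(1)[OF TB] T_pos] y x] by simp
      then have "ip y y = 0"
        using y x S'(1) T'(1) by (simp add: y_def diff_right)
      then have "nrm y = 0" by (simp add: ip_norm_def)
      then show ?thesis using definite[OF y] by (simp add: y_def)
    qed
    then show "T = restrict S H"
      by (intro extensionalityI[OF bounded_opsD(2)[OF TB] restrict_extensional]) simp
  qed
  from theI'[OF this] show ?thesis unfolding sqrt_op_def .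
qed

end

section \<open>Isometries, inverses and uniform boundedness\<close>

text \<open>Log-convexity makes the ratios \<open>a (Suc n) / a n\<close> nondecreasing. An initial
  ratio \<open>r > M\<close> would therefore force growth like \<open>r ^ n\<close>, against the
  bound \<open>C * M ^ n\<close>.\<close>

lemma log_convex_growth:
  fixes a :: "nat \<Rightarrow> real"
  assumes nonneg: "\<And>n. 0 \<le> a n" and convex: "\<And>n. (a (Suc n))\<^sup>2 \<le> a n * a (Suc (Suc n))"
    and M: "0 \<le> M" and growth: "\<And>n. a n \<le> C * M ^ n"
  shows "a 1 \<le> M * a 0"
proof (rule ccontr)
  assume "\<not> a 1 \<le> M * a 0"
  then have less: "M * a 0 < a 1" by simp
  have "a 1 > 0" using less M nonneg[of 0] by (smt (verit) mult_nonneg_nonneg)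
  have "a 0 \<noteq> 0" using convex[of 0] \<open>a 1 > 0\<close> by auto
  then have a0: "a 0 > 0" using nonneg[of 0] by linarith
  have M0: "M > 0"
  proof (rule ccontr)
    assume "\<not> M > 0"
    then have "M = 0" using M by simp
    then show False using growth[of 1] \<open>a 1 > 0\<close> by simp
  qed
  define r where "r = a 1 / a 0"
  have r: "M < r" using less a0 by (simp add: r_def field_simps)
  then have r0: "r > 0" using M0 by simp
  have step: "a n > 0 \<and> r * a n \<le> a (Suc n)" for n
  proof (induction n)
    case 0
    then show ?case using a0 by (simp add: r_def)
  next
    case (Suc n)
    then have pos: "a (Suc n) > 0" using r0 by (smt (verit) mult_pos_pos)
    have "r * a n * a (Suc n) \<le> (a (Suc n))\<^sup>2"
      using Suc pos by (simp add: power2_eq_square)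
    also have "\<dots> \<le> a n * a (Suc (Suc n))" by (rule convex)
    finally have "a n * (r * a (Suc n)) \<le> a n * a (Suc (Suc n))" by (simp add: ac_simps)
    then show ?case using Suc pos by simp
  qed
  have "r ^ n * a 0 \<le> a n" for n
  proof (induction n)
    case (Suc n)
    have "r ^ Suc n * a 0 = r * (r ^ n * a 0)" by simp
    also have "\<dots> \<le> r * a n" using Suc r0 by simp
    finally show ?case using step[of n] by linarith
  qed simp
  then have "r ^ n * a 0 \<le> C * M ^ n" for n using growth[of n] order_trans by blast
  then have bd: "(r / M) ^ n \<le> C / a 0" for n
    using M0 a0 by (simp add: power_divide field_simps)
  have "1 < r / M" using r M0 by simp
  then obtain n where "C / a 0 < (r / M) ^ n" using real_arch_pow by blast
  with bd[of n] show False by simp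
qed

context semi_inner
begin

text \<open>Polarisation; the imaginary part comes from replacing \<open>x\<close> by
  \<open>\<i> *\<^sub>C x\<close>.\<close>

lemma isometry_ip:
  assumes U: "linear_op H U" and iso: "\<And>x. x \<in> H \<Longrightarrow> nrm (U x) = nrm x" and x: "x \<in> H" and y: "y \<in> H"
  shows "ip (U x) (U y) = ip x y"
proof -
  note U' = linear_opD[OF U]
  have Re: "Re (ip (U x) (U y)) = Re (ip x y)" if x: "x \<in> H" for x
  proof -
    have "(nrm (U (x + y)))\<^sup>2 = (nrm (x + y))\<^sup>2" using iso x y by simp
    moreover have "(nrm (U x))\<^sup>2 = (nrm x)\<^sup>2" "(nrm (U y))\<^sup>2 = (nrm y)\<^sup>2" using iso x y by simp_all
    ultimately show ?thesis
      using x y U'(1)[OF x] U'(1)[OF y] cnj_sym[OF x y] cnj_sym[OF U'(1)[OF x] U'(1)[OF y]]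
      by (simp add: nrm_sq U'(2) add_left add_right)
  qed
  have "Re (\<i> * ip (U x) (U y)) = Re (\<i> * ip x y)"
    using Re[OF scale_mem[OF x], of \<i>] x y U'(1) by (simp add: U'(3) scale_left)
  with Re[OF x] show ?thesis by (simp add: complex_eq_iff)
qed

lemma invertible_opsE:
  assumes "G \<in> invertible_ops H ip"
  obtains G' where "G \<in> B" "G' \<in> B" "\<And>x. x \<in> H \<Longrightarrow> G' (G x) = x" "\<And>x. x \<in> H \<Longrightarrow> G (G' x) = x"
proof -
  obtain G' where "G \<in> B" "G' \<in> B" "compose H G' G = (\<lambda>x\<in>H. x)" "compose H G G' = (\<lambda>x\<in>H. x)"
    using assms unfolding invertible_ops_def by blast
  then show ?thesis
    using that[of G'] compose_eq[of _ H G' G] compose_eq[of _ H G G'] by simp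
qed

lemma invertible_opsI:
  assumes "G \<in> B" "G' \<in> B" "\<And>x. x \<in> H \<Longrightarrow> G' (G x) = x" "\<And>x. x \<in> H \<Longrightarrow> G (G' x) = x"
  shows "G \<in> invertible_ops H ip"
proof -
  have "compose H G' G = (\<lambda>x\<in>H. x)" "compose H G G' = (\<lambda>x\<in>H. x)"
    using assms(3,4) by (simp_all add: compose_def cong: restrict_cong)
  then show ?thesis using assms(1,2) unfolding invertible_ops_def by blast
qed

lemma invertible_op_bij:
  assumes "G \<in> B" "G' \<in> B" "\<And>x. x \<in> H \<Longrightarrow> G' (G x) = x" "\<And>x. x \<in> H \<Longrightarrow> G (G' x) = x"
  shows "G \<in> Bij H" "(\<lambda>x\<in>H. inv_into H G x) = G'" "G ` H = H"
proof -
  have bij: "bij_betw G H H"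
    by (rule bij_betw_byWitness[where f'=G'])
      (auto simp: assms(3,4) bounded_op_mem[OF assms(1)] bounded_op_mem[OF assms(2)])
  then show "G \<in> Bij H" using bounded_opsD(2)[OF assms(1)] by (simp add: Bij_def)
  show "G ` H = H" using bij by (simp add: bij_betw_def)
  show "(\<lambda>x\<in>H. inv_into H G x) = G'"
  proof (rule extensionalityI[OF restrict_extensional bounded_opsD(2)[OF assms(2)]])
    fix x assume x: "x \<in> H"
    have "inv_into H G (G (G' x)) = G' x"
      using bij bounded_op_mem[OF assms(2) x] by (intro inv_into_f_f) (auto simp: bij_betw_def)
    then show "(\<lambda>x\<in>H. inv_into H G x) x = G' x" using x assms(4) by simp
  qed
qed

end

context hilbert
begin

text \<open>The proof is the gliding hump argument of Sokal, which does not need Baire's theorem.\<close>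

lemma uniform_boundedness:
  assumes F: "F \<subseteq> H" and bd: "\<And>x. x \<in> H \<Longrightarrow> \<exists>C. \<forall>w\<in>F. cmod (ip x w) \<le> C"
  shows "\<exists>C. \<forall>w\<in>F. nrm w \<le> C"
proof (rule ccontr)
  assume "\<nexists>C. \<forall>w\<in>F. nrm w \<le> C"
  \<comment> \<open>The base 4 is chosen against steps of length \<open>(1/3) ^ n\<close> below, so
    that the products still grow like \<open>(4/3) ^ n\<close>.\<close>
  then have "\<forall>n::nat. \<exists>w\<in>F. 4 ^ n < nrm w" by (meson not_le)
  then obtain w :: "nat \<Rightarrow> 'a" where w: "\<And>n. w n \<in> F" "\<And>n. 4 ^ n < nrm (w n)" by metis
  have wH: "w n \<in> H" for n using F w(1) by blast
  have w_pos: "0 < nrm (w n)" for n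
    using w(2)[of n] zero_less_power[of "4::real" n] by linarith
  have "\<exists>x. \<forall>n. x n \<in> H \<and> (nrm (x (Suc n) - x n) \<le> (1/3) ^ n \<and>
      (1/3) ^ n * nrm (w n) \<le> cmod (ip (x (Suc n)) (w n)))"
  proof (rule dependent_nat_choice)
    show "\<exists>x. x \<in> H" using zero_mem by blast
    fix y and n :: nat
    assume y: "y \<in> H"
    define d where "d = complex_of_real ((1/3) ^ n / nrm (w n)) *\<^sub>C w n"
    have d: "d \<in> H" using wH by (simp add: d_def)
    have nd: "nrm d = (1/3) ^ n" using wH w_pos[of n] by (simp add: d_def nrm_scale norm_divide norm_power)
    have "ip d (w n) = complex_of_real ((1/3) ^ n / nrm (w n) * (nrm (w n))\<^sup>2)"
      using wH[of n] by (simp add: d_def scale_left ip_self)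
    also have "\<dots> = complex_of_real ((1/3) ^ n * nrm (w n))"
      using w_pos[of n] by (simp add: power2_eq_square)
    finally have "cmod (ip d (w n)) = (1/3) ^ n * nrm (w n)"
      using w_pos[of n] by (simp add: norm_mult norm_power)
    \<comment> \<open>One of the signs in \<open>y + d\<close> and \<open>y - d\<close> must give a
      pairing at least as large as that of \<open>d\<close> alone, whatever the pairing of
      \<open>y\<close> is.\<close>
    moreover have "2 * cmod (ip d (w n)) \<le> cmod (ip (y + d) (w n)) + cmod (ip (y - d) (w n))"
    proof -
      have "2 * cmod (ip d (w n)) = cmod (ip (y + d) (w n) - ip (y - d) (w n))"
        using y d wH by (simp add: add_left diff_left norm_mult flip: mult_2)
      then show ?thesis using norm_triangle_ineq4 by metis
    qed
    ultimately have "(1/3) ^ n * nrm (w n) \<le> cmod (ip (y + d) (w n)) \<or>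
        (1/3) ^ n * nrm (w n) \<le> cmod (ip (y - d) (w n))" by linarith
    then show "\<exists>z. z \<in> H \<and> (nrm (z - y) \<le> (1/3) ^ n \<and> (1/3) ^ n * nrm (w n) \<le> cmod (ip z (w n)))"
    proof
      assume "(1/3) ^ n * nrm (w n) \<le> cmod (ip (y + d) (w n))"
      then show ?thesis using y d nd by (intro exI[of _ "y + d"]) simp
    next
      assume "(1/3) ^ n * nrm (w n) \<le> cmod (ip (y - d) (w n))"
      then show ?thesis using y d nd by (intro exI[of _ "y - d"]) simp
    qed
  qed
  then obtain x where xH: "\<And>n. x n \<in> H" and x_step: "\<And>n. nrm (x (Suc n) - x n) \<le> (1/3) ^ n"
    and x_big: "\<And>n. (1/3) ^ n * nrm (w n) \<le> cmod (ip (x (Suc n)) (w n))" by blast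
  define r where "r = (\<lambda>n. (1/3::real) ^ n)"
  have r_pos: "0 < r n" and r_Suc: "r (Suc n) = r n / 3" and r_anti: "m \<le> n \<Longrightarrow> r n \<le> r m" for m n
    by (simp_all add: r_def power_decreasing)
  have tail: "nrm (x m - x n) \<le> 3/2 * (r n - r m)" if "n \<le> m" for m n
    using that
  proof (induction m rule: dec_induct)
    case (step m)
    have "nrm (x (Suc m) - x n) \<le> nrm (x (Suc m) - x m) + nrm (x m - x n)"
      by (rule nrm_triangle3[OF xH xH xH])
    then show ?case using x_step[of m] step.IH r_Suc[of m] by (simp add: r_def)
  qed simp
  have tail': "nrm (x m - x n) \<le> 3/2 * r n" if "n \<le> m" for m n
    using tail[OF that] r_pos[of m] by simp
  have "\<exists>l. lim_in x l"
  proof (rule complete[OF xH])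
    fix e :: real assume e: "0 < e"
    have "\<exists>N. (1/3::real) ^ N < 2/3 * e" by (rule real_arch_pow_inv) (use e in auto)
    then obtain N where N: "r N < 2/3 * e" unfolding r_def ..
    have *: "nrm (x m - x n) < e" if "N \<le> n" "n \<le> m" for m n
      using tail'[OF that(2)] N r_anti[OF that(1)] by simp
    have "nrm (x m - x n) < e" if "N \<le> m" "N \<le> n" for m n
    proof (cases "n \<le> m")
      case True
      then show ?thesis using *[OF that(2)] by blast
    next
      case False
      then show ?thesis using *[OF that(1), of n] nrm_minus_commute[OF xH xH, of m n] by simp
    qed
    then show "\<exists>N. \<forall>m\<ge>N. \<forall>n\<ge>N. nrm (x m - x n) < e" by blast
  qed
  then obtain l where l: "lim_in x l" ..
  have lH: "l \<in> H" by (rule lim_inD(2)[OF l])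
  have close: "nrm (l - x n) \<le> 3/2 * (1/3) ^ n" for n
  proof (rule LIMSEQ_le_const2)
    show "(\<lambda>m. nrm (x m - x n)) \<longlonglongrightarrow> nrm (l - x n)"
      by (rule lim_inD(4)[OF lim_in_diff[OF l lim_in_const[OF xH]]])
    show "\<exists>N. \<forall>m\<ge>N. nrm (x m - x n) \<le> 3/2 * (1/3) ^ n" using tail'[unfolded r_def] by blast
  qed
  \<comment> \<open>The steps after index \<open>Suc n\<close> move the point by at most
    \<open>3/2 * (1/3) ^ Suc n\<close>, which is half of \<open>(1/3) ^ n\<close>. So half of the
    pairing reached at step \<open>n\<close> survives in the limit.\<close>
  have big: "(4/3) ^ n / 2 \<le> cmod (ip l (w n))" for n
  proof -
    have "ip l (w n) = ip (x (Suc n)) (w n) + ip (l - x (Suc n)) (w n)"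
      using lH xH wH by (simp add: diff_left)
    then have "cmod (ip (x (Suc n)) (w n)) \<le> cmod (ip l (w n)) + cmod (ip (l - x (Suc n)) (w n))"
      by (metis add_diff_cancel_right' norm_triangle_ineq4)
    moreover have "cmod (ip (l - x (Suc n)) (w n)) \<le> nrm (l - x (Suc n)) * nrm (w n)"
      by (rule Cauchy_Schwarz[OF diff_mem[OF lH xH] wH])
    moreover have "nrm (l - x (Suc n)) * nrm (w n) \<le> (3/2 * (1/3) ^ Suc n) * nrm (w n)"
      by (rule mult_right_mono[OF close nrm_ge_0[OF wH]])
    moreover have "(1/3) ^ n * nrm (w n) = (3/2 * (1/3) ^ Suc n) * nrm (w n) + (1/3) ^ n * nrm (w n) / 2"
      by simp
    ultimately have "(1/3) ^ n * nrm (w n) / 2 \<le> cmod (ip l (w n))"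
      using x_big[of n] by linarith
    moreover have "(1/3::real) ^ n * 4 ^ n \<le> (1/3) ^ n * nrm (w n)"
      using w(2)[of n] by (intro mult_left_mono) auto
    moreover have "(1/3::real) ^ n * 4 ^ n = (4/3) ^ n" by (simp flip: power_mult_distrib)
    ultimately show ?thesis by linarith
  qed
  obtain C where C: "\<And>v. v \<in> F \<Longrightarrow> cmod (ip l v) \<le> C" using bd[OF lH] by blast
  obtain n where "2 * C < (4/3) ^ n" using real_arch_pow[of "4/3::real" "2 * C"] by auto
  with big[of n] C[OF w(1), of n] show False by linarith
qed

end

section \<open>A Hilbert space with a second, weaker inner product\<close>

text \<open>Here \<open>ip\<close> plays the role of the inner product of H^1_0 and
  \<open>jp\<close> that of L^2. The definitions of the locale repeat those of the theorem with
  these parameters, so that the final instantiation is a matter of unfolding.\<close>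

locale two_inner = hilbert H ip + q: inner_space H jp for H :: "'a::complex_vector set" and ip jp +
  assumes jp_le: "x \<in> H \<Longrightarrow> Re (jp x x) \<le> Re (ip x x)"
begin

definition A :: "'a \<Rightarrow> 'a" where
  "A = (THE A. A \<in> B \<and> (\<forall>f\<in>H. \<forall>g\<in>H. ip (A f) g = jp f g))"

definition S :: "'a \<Rightarrow> 'a" where "S = sqrt_op H ip A"

definition isom :: "('a \<Rightarrow> 'a) set" where
  "isom = {G \<in> invertible_ops H ip. \<forall>f\<in>H. \<forall>g\<in>H. jp (G f) (G g) = jp f g}"

definition unit_R :: "('a \<Rightarrow> 'a) set" where
  "unit_R = {U \<in> unitary_ops H ip. U ` (S ` H) = S ` H}"

definition Umap :: "('a \<Rightarrow> 'a) \<Rightarrow> 'a \<Rightarrow> 'a" where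
  "Umap G = (THE U. U \<in> unitary_ops H ip \<and> compose H U S = compose H S G)"

lemma q_nrm_le: "x \<in> H \<Longrightarrow> q.nrm x \<le> nrm x"
  using jp_le by (simp add: ip_norm_def)

lemma A_ex1: "\<exists>!A. A \<in> B \<and> (\<forall>f\<in>H. \<forall>g\<in>H. ip (A f) g = jp f g)"
proof -
  have "\<exists>u. u \<in> H \<and> (\<forall>g\<in>H. jp g f = ip g u)" if f: "f \<in> H" for f
  proof -
    have "cmod (jp x f) \<le> nrm f * nrm x" if x: "x \<in> H" for x
    proof -
      have "cmod (jp x f) \<le> q.nrm x * q.nrm f" by (rule q.Cauchy_Schwarz[OF x f])
      also have "\<dots> \<le> nrm x * nrm f"
        by (intro mult_mono q_nrm_le x f) (use x f in auto)
      finally show ?thesis by (simp add: mult.commute)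
    qed
    then show ?thesis
      using riesz[of "\<lambda>g. jp g f" "nrm f"] q.add_left q.scale_left f by metis
  qed
  then obtain T where TH: "\<And>f. f \<in> H \<Longrightarrow> T f \<in> H" and T: "\<And>f g. f \<in> H \<Longrightarrow> g \<in> H \<Longrightarrow> jp g f = ip g (T f)"
    by metis
  have T': "ip (T f) g = jp f g" if "f \<in> H" "g \<in> H" for f g
    using T[OF that] cnj_sym[OF that(2) TH[OF that(1)]] q.cnj_sym[OF that(2,1)] by simp
  have lin: "linear_op H T"
    unfolding linear_op_def
  proof (intro conjI ballI allI)
    show "T x \<in> H" if "x \<in> H" for x using TH[OF that] .
    show "T (x + y) = T x + T y" if x: "x \<in> H" and y: "y \<in> H" for x y
    proof (rule eqI_ip[OF TH[OF add_mem[OF x y]] add_mem[OF TH[OF x] TH[OF y]]])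
      fix z assume z: "z \<in> H"
      show "ip (T (x + y)) z = ip (T x + T y) z"
        using x y z by (simp add: T' TH add_left q.add_left)
    qed
    show "T (c *\<^sub>C x) = c *\<^sub>C T x" if x: "x \<in> H" for c x
    proof (rule eqI_ip[OF TH[OF scale_mem[OF x]] scale_mem[OF TH[OF x]]])
      fix z assume z: "z \<in> H"
      show "ip (T (c *\<^sub>C x)) z = ip (c *\<^sub>C T x) z"
        using x z by (simp add: T' TH scale_left q.scale_left)
    qed
  qed
  have bd: "nrm (T x) \<le> 1 * nrm x" if x: "x \<in> H" for x
  proof -
    have "(nrm (T x))\<^sup>2 = cmod (ip (T x) (T x))"
      using TH[OF x] by (simp add: ip_self norm_power)
    also have "\<dots> = cmod (jp x (T x))"
      using T'[OF x TH[OF x]] by simp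
    also have "\<dots> \<le> q.nrm x * q.nrm (T x)" by (rule q.Cauchy_Schwarz[OF x TH[OF x]])
    also have "\<dots> \<le> nrm x * nrm (T x)"
      by (intro mult_mono q_nrm_le TH x) (use x TH in auto)
    finally have "nrm (T x) * nrm (T x) \<le> nrm x * nrm (T x)" by (simp add: power2_eq_square)
    then show ?thesis
      using nrm_ge_0[OF TH[OF x]] nrm_ge_0[OF x] by (cases "nrm (T x) = 0") auto
  qed
  show ?thesis
  proof (intro ex1I[of _ "restrict T H"] conjI ballI)
    show "restrict T H \<in> B" by (rule bounded_opsI_restrict[OF lin bd])
    show "ip (restrict T H f) g = jp f g" if "f \<in> H" "g \<in> H" for f g using T' that by simp
    fix T2 assume T2: "T2 \<in> B \<and> (\<forall>f\<in>H. \<forall>g\<in>H. ip (T2 f) g = jp f g)"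
    then have TB: "T2 \<in> B" by blast
    show "T2 = restrict T H"
    proof (rule extensionalityI[OF bounded_opsD(2)[OF TB] restrict_extensional])
      fix x assume x: "x \<in> H"
      then show "T2 x = restrict T H x"
        using T2 T' eqI_ip[OF bounded_op_mem[OF TB x] TH[OF x]] by simp
    qed
  qed
qed

lemma A_bounded: "A \<in> B" and A_ip: "f \<in> H \<Longrightarrow> g \<in> H \<Longrightarrow> ip (A f) g = jp f g"
  using theI'[OF A_ex1] unfolding A_def[symmetric] by blast+

lemmas A_linear = linear_opD[OF bounded_opsD(1)[OF A_bounded]]

lemma A_ip_right: "f \<in> H \<Longrightarrow> g \<in> H \<Longrightarrow> ip f (A g) = jp f g"
  using A_ip[of g f] cnj_sym[of "A g" f] q.cnj_sym[of g f] A_linear(1) by simp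

lemma S_props: "S \<in> B" "positive_op H ip S" "x \<in> H \<Longrightarrow> S (S x) = A x"
proof -
  have "semi_inner H (\<lambda>x y. ip (A x) y)"
    by (rule q.cong_form) (rule A_ip)
  moreover have "Re (ip (A x) x) \<le> (nrm x)\<^sup>2" if "x \<in> H" for x
    using jp_le that by (simp add: A_ip nrm_sq)
  ultimately have *: "S \<in> B \<and> positive_op H ip S \<and> compose H S S = A"
    unfolding S_def using sqrt_op_properties[OF A_bounded] by blast
  then show "S \<in> B" "positive_op H ip S" by blast+
  show "x \<in> H \<Longrightarrow> S (S x) = A x"
    using * compose_eq[of x H S S] by simp
qed

lemmas S_linear = linear_opD[OF bounded_opsD(1)[OF S_props(1)]]

lemma S_self_adjoint: "f \<in> H \<Longrightarrow> g \<in> H \<Longrightarrow> ip (S f) g = ip f (S g)"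
  using self_adjointD[OF positive_self_adjoint[OF bounded_opsD(1)[OF S_props(1)] S_props(2)]] .

lemma S_ip: "f \<in> H \<Longrightarrow> g \<in> H \<Longrightarrow> ip (S f) (S g) = jp f g"
  by (simp add: S_linear(1) S_props(3) A_ip flip: S_self_adjoint)

lemma S_nrm: "f \<in> H \<Longrightarrow> nrm (S f) = q.nrm f"
  by (simp add: ip_norm_def S_ip)

lemma S_inj: "f \<in> H \<Longrightarrow> g \<in> H \<Longrightarrow> S f = S g \<Longrightarrow> f = g"
  using S_nrm[of "f - g"] q.eqI_nrm[of f g] by (simp add: S_linear(6))

lemma S_inj_on: "inj_on S H"
  using S_inj by (rule inj_onI)

lemma range_subspace:
  assumes "linear_op H T"
  shows "csubspace (T ` H)"
  unfolding csubspace_def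
proof (intro conjI ballI allI)
  note T = linear_opD[OF assms]
  show "0 \<in> T ` H" using T(4) zero_mem by (metis imageI)
  show "x + y \<in> T ` H" if "x \<in> T ` H" "y \<in> T ` H" for x y
    using that T(2) add_mem by (metis (no_types, lifting) imageE imageI)
  show "c *\<^sub>C x \<in> T ` H" if "x \<in> T ` H" for c x
    using that T(3) scale_mem by (metis (no_types, lifting) imageE imageI)
qed

lemma S_range_subset: "S ` H \<subseteq> H"
  using S_linear(1) by blast

lemma S_range_subspace: "csubspace (S ` H)"
  by (rule range_subspace[OF bounded_opsD(1)[OF S_props(1)]])

text \<open>\<open>S\<close> is self-adjoint, so a vector orthogonal to its range lies in its
  kernel, which is trivial.\<close>

lemma S_dense: "dense_in (S ` H)"
proof (rule dense_inI[OF S_range_subspace S_range_subset])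
  fix y assume y: "y \<in> H" and *: "\<And>x. x \<in> S ` H \<Longrightarrow> ip x y = 0"
  have "S y = S 0"
  proof (rule eqI_ip[OF S_linear(1)[OF y] S_linear(1)[OF zero_mem]])
    fix z assume z: "z \<in> H"
    have "ip z (S y) = 0" using *[of "S z"] z y by (simp add: S_self_adjoint)
    then show "ip (S y) z = ip (S 0) z"
      using cnj_sym[OF z S_linear(1)[OF y]] z by (simp add: S_linear(4))
  qed
  then show "y = 0" using S_inj[OF y zero_mem] by simp
qed

lemma A_dense: "dense_in (A ` H)"
proof (rule dense_inI)
  show "csubspace (A ` H)" by (rule range_subspace[OF bounded_opsD(1)[OF A_bounded]])
  show "A ` H \<subseteq> H" using A_linear(1) by blast
  fix y assume y: "y \<in> H" and *: "\<And>x. x \<in> A ` H \<Longrightarrow> ip x y = 0"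
  have "jp y y = 0" using *[of "A y"] y by (simp add: A_ip)
  then have "q.nrm y = 0" by (simp add: ip_norm_def)
  then show "y = 0" by (rule q.definite[OF y])
qed

text \<open>Used to identify vectors that are known only through their pairings with the range of
  \<open>S\<close>.\<close>

lemma S_separates:
  assumes "a \<in> H" "b \<in> H" "\<And>g. g \<in> H \<Longrightarrow> ip (S g) a = ip (S g) b"
  shows "a = b"
proof (rule S_inj[OF assms(1,2)], rule eqI_ip[OF assms(1,2)[THEN S_linear(1)]])
  fix z assume z: "z \<in> H"
  have "ip z (S a) = ip z (S b)"
    using assms(3)[OF z] S_self_adjoint[OF z assms(1)] S_self_adjoint[OF z assms(2)] by simp
  then show "ip (S a) z = ip (S b) z"
    using cnj_sym[OF z S_linear(1)[OF assms(1)]] cnj_sym[OF z S_linear(1)[OF assms(2)]] by simp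
qed

text \<open>The extension from the range of \<open>S\<close> to \<open>H\<close> is obtained by representing the functionals
  \<open>S g \<mapsto> [S (G' g), v]\<close>, so that no choice of approximating sequences has to be justified.\<close>

lemma transfer_contraction:
  assumes G: "linear_op H G" and G': "linear_op H G'"
    and adj: "\<And>f g. f \<in> H \<Longrightarrow> g \<in> H \<Longrightarrow> jp (G f) g = jp f (G' g)"
    and contr: "\<And>f. f \<in> H \<Longrightarrow> q.nrm (G' f) \<le> q.nrm f"
  obtains U where "U \<in> B" "\<And>x. x \<in> H \<Longrightarrow> nrm (U x) \<le> nrm x" "\<And>f. f \<in> H \<Longrightarrow> U (S f) = S (G f)"
proof -
  note GD = linear_opD[OF G] and GD' = linear_opD[OF G']
  define R where "R = inv_into H S"
  have R: "R (S g) = g" if "g \<in> H" for g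
    unfolding R_def by (rule inv_into_f_f[OF S_inj_on that])
  \<comment> \<open>The vector \<open>u\<close> is the value at \<open>v\<close> of the adjoint of
    the map \<open>S g\<close> to \<open>S (G' g)\<close>. Since \<open>G\<close> and
    \<open>G'\<close> are adjoint for \<open>jp\<close>, that adjoint extends the map
    \<open>S f\<close> to \<open>S (G f)\<close>.\<close>
  have "\<exists>u. u \<in> H \<and> nrm u \<le> nrm v \<and> (\<forall>g\<in>H. ip (S (G' g)) v = ip (S g) u)" if v: "v \<in> H" for v
  proof -
    obtain s u where s: "\<And>n. s n \<in> S ` H" and u: "lim_in s u"
      and eq: "\<And>x. x \<in> S ` H \<Longrightarrow> ip (S (G' (R x))) v = ip x u"
    proof (rule riesz_subspace[OF S_range_subspace S_range_subset, of "\<lambda>x. ip (S (G' (R x))) v" "nrm v"])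
      show "ip (S (G' (R (x + y)))) v = ip (S (G' (R x))) v + ip (S (G' (R y))) v"
        if xy: "x \<in> S ` H" "y \<in> S ` H" for x y
      proof -
        obtain f g where fg: "f \<in> H" "g \<in> H" "x = S f" "y = S g" using xy by blast
        have "R (x + y) = f + g" using R[OF add_mem[OF fg(1,2)]] fg by (simp add: S_linear(2))
        then show ?thesis using fg v by (simp add: R GD' S_linear(1,2) add_left)
      qed
      show "ip (S (G' (R (c *\<^sub>C x)))) v = c * ip (S (G' (R x))) v" if x: "x \<in> S ` H" for c x
      proof -
        obtain f where f: "f \<in> H" "x = S f" using x by blast
        have "R (c *\<^sub>C x) = c *\<^sub>C f" using R[OF scale_mem[OF f(1)], of c] f by (simp add: S_linear(3))
        then show ?thesis using f v by (simp add: R GD' S_linear(1,3) scale_left)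
      qed
      show "cmod (ip (S (G' (R x))) v) \<le> nrm v * nrm x" if x: "x \<in> S ` H" for x
      proof -
        obtain f where f: "f \<in> H" "x = S f" using x by blast
        have "cmod (ip (S (G' f)) v) \<le> nrm (S (G' f)) * nrm v"
          by (rule Cauchy_Schwarz[OF S_linear(1)[OF GD'(1)[OF f(1)]] v])
        also have "\<dots> \<le> nrm (S f) * nrm v"
          unfolding S_nrm[OF f(1)] S_nrm[OF GD'(1)[OF f(1)]]
          by (rule mult_right_mono[OF contr[OF f(1)] nrm_ge_0[OF v]])
        finally show ?thesis using f by (simp add: R mult.commute)
      qed
    qed (use that in blast)
    note u' = lim_inD[OF u]
    \<comment> \<open>Evaluating the represented functional along \<open>s n\<close>, which lies in
      the range of \<open>S\<close> and tends to \<open>u\<close>, carries its bound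
      \<open>nrm v\<close> over to \<open>u\<close>.\<close>
    have "nrm u * nrm u \<le> nrm v * nrm u"
    proof (rule LIMSEQ_le)
      have "cmod (ip u u) = nrm u * nrm u"
        unfolding ip_self[OF u'(2)] by (simp add: norm_mult power2_eq_square)
      then show "(\<lambda>n. cmod (ip (s n) u)) \<longlonglongrightarrow> nrm u * nrm u"
        using tendsto_norm[OF u'(5)[OF u'(2)]] by simp
      show "(\<lambda>n. nrm v * nrm (s n)) \<longlonglongrightarrow> nrm v * nrm u"
        by (rule tendsto_mult_left[OF u'(4)])
      have "cmod (ip (s n) u) \<le> nrm v * nrm (s n)" for n
      proof -
        obtain f where f: "f \<in> H" "s n = S f" using s[of n] by blast
        have "ip (s n) u = ip (S (G' f)) v" using eq[OF s[of n]] f R by simp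
        also have "cmod \<dots> \<le> nrm (S (G' f)) * nrm v"
          by (rule Cauchy_Schwarz[OF S_linear(1)[OF GD'(1)[OF f(1)]] v])
        also have "\<dots> \<le> nrm (S f) * nrm v"
          unfolding S_nrm[OF f(1)] S_nrm[OF GD'(1)[OF f(1)]]
          by (rule mult_right_mono[OF contr[OF f(1)] nrm_ge_0[OF v]])
        finally show ?thesis using f by (simp add: mult.commute)
      qed
      then show "\<exists>N. \<forall>n\<ge>N. cmod (ip (s n) u) \<le> nrm v * nrm (s n)" by blast
    qed
    then have "nrm u \<le> nrm v"
      using nrm_ge_0[OF u'(2)] nrm_ge_0[OF v] by (cases "nrm u = 0") auto
    moreover have "\<forall>g\<in>H. ip (S (G' g)) v = ip (S g) u"
      using eq R by (metis imageI)
    ultimately show ?thesis using u'(2) by blast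
  qed
  then obtain U where UH: "\<And>v. v \<in> H \<Longrightarrow> U v \<in> H" and U_le: "\<And>v. v \<in> H \<Longrightarrow> nrm (U v) \<le> nrm v"
    and U: "\<And>v g. v \<in> H \<Longrightarrow> g \<in> H \<Longrightarrow> ip (S (G' g)) v = ip (S g) (U v)"
    by metis
  have lin: "linear_op H U"
    unfolding linear_op_def
  proof (intro conjI ballI allI)
    show "U x \<in> H" if "x \<in> H" for x using UH[OF that] .
    show "U (x + y) = U x + U y" if x: "x \<in> H" and y: "y \<in> H" for x y
    proof (rule S_separates[OF UH[OF add_mem[OF x y]] add_mem[OF UH[OF x] UH[OF y]]])
      fix g assume g: "g \<in> H"
      show "ip (S g) (U (x + y)) = ip (S g) (U x + U y)"
        using x y g by (simp add: add_right UH S_linear(1) GD'(1) flip: U)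
    qed
    show "U (c *\<^sub>C x) = c *\<^sub>C U x" if x: "x \<in> H" for c x
    proof (rule S_separates[OF UH[OF scale_mem[OF x]] scale_mem[OF UH[OF x]]])
      fix g assume g: "g \<in> H"
      show "ip (S g) (U (c *\<^sub>C x)) = ip (S g) (c *\<^sub>C U x)"
        using x g by (simp add: scale_right UH S_linear(1) GD'(1) flip: U)
    qed
  qed
  show thesis
  proof (rule that)
    show "restrict U H \<in> B"
      by (rule bounded_opsI_restrict[OF lin, of 1]) (simp add: U_le)
    show "nrm (restrict U H x) \<le> nrm x" if "x \<in> H" for x using U_le that by simp
    show "restrict U H (S f) = S (G f)" if f: "f \<in> H" for f
    proof -
      have "U (S f) = S (G f)"
      proof (rule S_separates[OF UH[OF S_linear(1)[OF f]] S_linear(1)[OF GD(1)[OF f]]])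
        fix g assume g: "g \<in> H"
        have "jp (G' g) f = jp g (G f)"
          using adj[OF f g] q.cnj_sym[OF f GD'(1)[OF g]] q.cnj_sym[OF GD(1)[OF f] g] by simp
        then show "ip (S g) (U (S f)) = ip (S g) (S (G f))"
          using f g by (simp add: S_ip GD(1) GD'(1) S_linear(1) flip: U)
      qed
      then show ?thesis using S_linear(1)[OF f] by simp
    qed
  qed
qed

lemma operator_eqI:
  assumes "U \<in> B" "V \<in> B" "\<And>f. f \<in> H \<Longrightarrow> U (S f) = V (S f)"
  shows "U = V"
proof (rule extensionalityI[OF bounded_opsD(2)[OF assms(1)] bounded_opsD(2)[OF assms(2)]])
  fix x assume x: "x \<in> H"
  show "U x = V x"
  proof (rule dense_eq[OF S_dense _ _ _ _ _ x])
    show "linear_op H U" "linear_op H V" by (rule bounded_opsD(1)[OF assms(1)], rule bounded_opsD(1)[OF assms(2)])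
    show "nrm (U x) \<le> opn U * nrm x" "nrm (V x) \<le> opn V * nrm x" if "x \<in> H" for x
      by (rule op_norm_bound[OF assms(1) that], rule op_norm_bound[OF assms(2) that])
    show "U x = V x" if "x \<in> S ` H" for x using that assms(3) by blast
  qed
qed

lemma inverse_operator_eqI:
  assumes "U \<in> B" "V \<in> B" "\<And>f. f \<in> H \<Longrightarrow> U (V (S f)) = S f" "x \<in> H"
  shows "U (V x) = x"
proof -
  have "compose H U V = (\<lambda>x\<in>H. x)"
    by (rule operator_eqI[OF bounded_ops_compose[OF assms(1,2)] bounded_ops_id])
      (simp add: compose_def S_linear(1) assms(3))
  then show ?thesis using compose_eq[OF assms(4), of U V] assms(4) by simp
qed

text \<open>\<open>G\<close> and its inverse induce contractions that are inverse to each other on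
  the dense range of \<open>S\<close>, hence everywhere. A contraction whose inverse is a
  contraction preserves the norm.\<close>

lemma transfer_unitary:
  assumes G: "linear_op H G" and G': "linear_op H G'"
    and inv: "\<And>x. x \<in> H \<Longrightarrow> G' (G x) = x" "\<And>x. x \<in> H \<Longrightarrow> G (G' x) = x"
    and iso: "\<And>f g. f \<in> H \<Longrightarrow> g \<in> H \<Longrightarrow> jp (G f) (G g) = jp f g"
  obtains U U' where "U \<in> unitary_ops H ip" "U \<in> B" "U' \<in> B"
    "\<And>x. x \<in> H \<Longrightarrow> U' (U x) = x" "\<And>x. x \<in> H \<Longrightarrow> U (U' x) = x"
    "\<And>f. f \<in> H \<Longrightarrow> U (S f) = S (G f)"
proof -
  note GD = linear_opD(1)[OF G] and GD' = linear_opD(1)[OF G']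
  have iso': "jp (G' f) (G' g) = jp f g" if "f \<in> H" "g \<in> H" for f g
    using iso[OF GD'[OF that(1)] GD'[OF that(2)]] that inv by simp
  have adj: "jp (G f) g = jp f (G' g)" "jp (G' f) g = jp f (G g)" if "f \<in> H" "g \<in> H" for f g
    using iso[OF that(1) GD'[OF that(2)]] iso'[OF that(1) GD[OF that(2)]] inv that by simp_all
  have nrm_eq: "q.nrm (G f) \<le> q.nrm f" "q.nrm (G' f) \<le> q.nrm f" if "f \<in> H" for f
    using iso[OF that that] iso'[OF that that] by (simp_all add: ip_norm_def)
  obtain U where U: "U \<in> B" "\<And>x. x \<in> H \<Longrightarrow> nrm (U x) \<le> nrm x" "\<And>f. f \<in> H \<Longrightarrow> U (S f) = S (G f)"
    using transfer_contraction[OF G G' adj(1) nrm_eq(2)] by metis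
  obtain U' where U': "U' \<in> B" "\<And>x. x \<in> H \<Longrightarrow> nrm (U' x) \<le> nrm x" "\<And>f. f \<in> H \<Longrightarrow> U' (S f) = S (G' f)"
    using transfer_contraction[OF G' G adj(2) nrm_eq(1)] by metis
  have UU': "U' (U x) = x" if "x \<in> H" for x
    by (rule inverse_operator_eqI[OF U'(1) U(1) _ that]) (simp add: U(3) U'(3) GD inv)
  have U'U: "U (U' x) = x" if "x \<in> H" for x
    by (rule inverse_operator_eqI[OF U(1) U'(1) _ that]) (simp add: U(3) U'(3) GD' inv)
  have "nrm (U x) = nrm x" if "x \<in> H" for x
    using U(2)[OF that] U'(2)[OF bounded_op_mem[OF U(1) that]] UU'[OF that] by simp
  then have "\<And>x y. x \<in> H \<Longrightarrow> y \<in> H \<Longrightarrow> ip (U x) (U y) = ip x y"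
    using isometry_ip[OF bounded_opsD(1)[OF U(1)]] by blast
  then have "U \<in> unitary_ops H ip"
    using invertible_opsI[OF U(1) U'(1) UU' U'U] by (simp add: unitary_ops_def)
  with that U U'(1) UU' U'U show thesis by blast
qed

lemma Umap_eqI:
  assumes "U \<in> unitary_ops H ip" "\<And>f. f \<in> H \<Longrightarrow> U (S f) = S (G f)"
  shows "Umap G = U"
  unfolding Umap_def
proof (rule the_equality)
  show "U \<in> unitary_ops H ip \<and> compose H U S = compose H S G"
    using assms by (simp add: compose_def cong: restrict_cong)
  fix V assume V: "V \<in> unitary_ops H ip \<and> compose H V S = compose H S G"
  have "U \<in> B" "V \<in> B" using assms(1) V by (auto simp: unitary_ops_def invertible_ops_def)
  moreover have "U (S f) = V (S f)" if "f \<in> H" for f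
    using V assms(2) compose_eq[OF that, of V S] compose_eq[OF that, of S G] that by simp
  ultimately show "V = U" using operator_eqI by metis
qed

text \<open>The inverse of an isometry is its adjoint for \<open>jp\<close>. This supplies an
  adjoint that is bounded for \<open>ip\<close>, as the norm comparison by Lax's theorem
  requires.\<close>

lemma isomE:
  assumes "G \<in> isom"
  obtains G' where "G \<in> B" "G' \<in> B" "\<And>x. x \<in> H \<Longrightarrow> G' (G x) = x" "\<And>x. x \<in> H \<Longrightarrow> G (G' x) = x"
    "G' \<in> isom" "\<And>f g. f \<in> H \<Longrightarrow> g \<in> H \<Longrightarrow> jp (G f) (G g) = jp f g"
    "\<And>f g. f \<in> H \<Longrightarrow> g \<in> H \<Longrightarrow> jp (G f) g = jp f (G' g)"
proof -
  obtain G' where G: "G \<in> B" "G' \<in> B" "\<And>x. x \<in> H \<Longrightarrow> G' (G x) = x" "\<And>x. x \<in> H \<Longrightarrow> G (G' x) = x"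
    using assms invertible_opsE[of G] unfolding isom_def by blast
  have iso: "jp (G f) (G g) = jp f g" if "f \<in> H" "g \<in> H" for f g
    using assms that unfolding isom_def by blast
  note m = bounded_op_mem[OF G(2)]
  have "jp (G' f) (G' g) = jp f g" if "f \<in> H" "g \<in> H" for f g
    using iso[OF m[OF that(1)] m[OF that(2)]] that G(4) by simp
  then have "G' \<in> isom"
    using invertible_opsI[OF G(2,1,4,3)] unfolding isom_def by simp
  moreover have "jp (G f) g = jp f (G' g)" if "f \<in> H" "g \<in> H" for f g
    using iso[OF that(1) m[OF that(2)]] G(4)[OF that(2)] by simp
  ultimately show ?thesis using that[OF G] iso by blast
qed

lemma Umap:
  assumes "G \<in> isom"
  shows "Umap G \<in> unitary_ops H ip" "Umap G \<in> B" "\<And>f. f \<in> H \<Longrightarrow> Umap G (S f) = S (G f)" "Umap G \<in> unit_R"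
proof -
  obtain G' where G: "G \<in> B" "G' \<in> B" "\<And>x. x \<in> H \<Longrightarrow> G' (G x) = x" "\<And>x. x \<in> H \<Longrightarrow> G (G' x) = x"
    and iso: "\<And>f g. f \<in> H \<Longrightarrow> g \<in> H \<Longrightarrow> jp (G f) (G g) = jp f g"
    using isomE[OF assms] by metis
  obtain U U' where U: "U \<in> unitary_ops H ip" "U \<in> B" "\<And>f. f \<in> H \<Longrightarrow> U (S f) = S (G f)"
    using transfer_unitary[OF bounded_opsD(1)[OF G(1)] bounded_opsD(1)[OF G(2)] G(3,4) iso] by metis
  have eq: "Umap G = U" by (rule Umap_eqI[OF U(1,3)])
  show "Umap G \<in> unitary_ops H ip" "Umap G \<in> B" and U_S: "\<And>f. f \<in> H \<Longrightarrow> Umap G (S f) = S (G f)"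
    unfolding eq using U by blast+
  have "Umap G ` (S ` H) = S ` (G ` H)"
    unfolding image_image by (rule image_cong[OF refl U_S])
  also have "\<dots> = S ` H"
    using invertible_op_bij(3)[OF G] by simp
  finally show "Umap G \<in> unit_R"
    using \<open>Umap G \<in> unitary_ops H ip\<close> by (simp add: unit_R_def)
qed

text \<open>A Hellinger-Toeplitz theorem in which the adjoint relation belongs to the weaker product
  and the boundedness to the stronger one. Multiplication by \<open>A\<close> translates the former
  into an \<open>ip\<close> relation that is available on a dense set only.\<close>

lemma bounded_of_adjoint:
  assumes G: "linear_op H G" and G': "linear_op H G'"
    and adj: "\<And>f g. f \<in> H \<Longrightarrow> g \<in> H \<Longrightarrow> jp (G f) g = jp f (G' g)"
  shows "\<exists>C. \<forall>f\<in>H. nrm (G f) \<le> C * nrm f"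
proof -
  note GD = linear_opD[OF G] and GD' = linear_opD[OF G']
  define F where "F = {A (G' g) | g. g \<in> H \<and> nrm (A g) \<le> 1}"
  have key: "ip f (A (G' g)) = ip (G f) (A g)" if "f \<in> H" "g \<in> H" for f g
    using that by (simp add: A_ip_right GD(1) GD'(1) adj)
  have "\<exists>C. \<forall>w\<in>F. nrm w \<le> C"
  proof (rule uniform_boundedness)
    show "F \<subseteq> H" using A_linear(1) GD'(1) by (auto simp: F_def)
    fix x assume x: "x \<in> H"
    have "cmod (ip x w) \<le> nrm (G x)" if w: "w \<in> F" for w
    proof -
      obtain g where g: "g \<in> H" "nrm (A g) \<le> 1" "w = A (G' g)" using w by (auto simp: F_def)
      have "cmod (ip (G x) (A g)) \<le> nrm (G x) * nrm (A g)"
        by (rule Cauchy_Schwarz[OF GD(1)[OF x] A_linear(1)[OF g(1)]])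
      also have "\<dots> \<le> nrm (G x) * 1"
        by (rule mult_left_mono[OF g(2) nrm_ge_0[OF GD(1)[OF x]]])
      finally show ?thesis using key[OF x g(1)] g(3) by simp
    qed
    then show "\<exists>C. \<forall>w\<in>F. cmod (ip x w) \<le> C" by blast
  qed
  then obtain C where C: "\<And>w. w \<in> F \<Longrightarrow> nrm w \<le> C" by blast
  have bound: "cmod (ip (G f) (A g)) \<le> C * nrm f * nrm (A g)" if f: "f \<in> H" and g: "g \<in> H" for f g
  proof (cases "nrm (A g) = 0")
    case True
    then have "A g = 0" by (rule definite[OF A_linear(1)[OF g]])
    then show ?thesis using GD(1)[OF f] by simp
  next
    case False
    then have pos: "0 < nrm (A g)" using nrm_ge_0[OF A_linear(1)[OF g]] by linarith
    define c where "c = complex_of_real (1 / nrm (A g))"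
    define h where "h = c *\<^sub>C g"
    have h: "h \<in> H" using g by (simp add: h_def)
    have "nrm (A h) = 1"
      using pos g A_linear(1)[OF g] by (simp add: h_def c_def A_linear(3) nrm_scale norm_divide)
    then have "A (G' h) \<in> F" using h unfolding F_def by (intro CollectI exI[of _ h]) simp
    then have le: "nrm (A (G' h)) \<le> C" by (rule C)
    have "cmod (ip (G f) (A h)) \<le> nrm f * nrm (A (G' h))"
      unfolding key[OF f h, symmetric] by (rule Cauchy_Schwarz[OF f A_linear(1)[OF GD'(1)[OF h]]])
    also have "\<dots> \<le> nrm f * C" by (rule mult_left_mono[OF le nrm_ge_0[OF f]])
    finally have "cmod (ip (G f) (A h)) \<le> nrm f * C" .
    moreover have "cmod (ip (G f) (A h)) = cmod (ip (G f) (A g)) / nrm (A g)"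
      using pos g f A_linear(1)[OF g] GD(1)[OF f]
      by (simp add: h_def c_def A_linear(3) scale_right norm_mult norm_divide)
    ultimately show ?thesis using pos by (simp add: field_simps)
  qed
  have "nrm (G f) \<le> C * nrm f" if f: "f \<in> H" for f
  proof -
    note u = GD(1)[OF f]
    obtain s where s: "\<And>n. s n \<in> A ` H" "lim_in s (G f)"
      using dense_inE[OF A_dense u] by blast
    \<comment> \<open>The estimate \<open>bound\<close> holds for pairings with the range of
      \<open>A\<close>; letting vectors of this range tend to \<open>G f\<close> itself produces the
      norm.\<close>
    have "nrm (G f) * nrm (G f) \<le> C * nrm f * nrm (G f)"
    proof (rule LIMSEQ_le)
      have "cmod (ip (G f) (G f)) = nrm (G f) * nrm (G f)"
        unfolding ip_self[OF u] by (simp add: norm_mult power2_eq_square u)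
      then show "(\<lambda>n. cmod (ip (G f) (s n))) \<longlonglongrightarrow> nrm (G f) * nrm (G f)"
        using tendsto_norm[OF lim_inD(6)[OF s(2) u]] by simp
      show "(\<lambda>n. C * nrm f * nrm (s n)) \<longlonglongrightarrow> C * nrm f * nrm (G f)"
        by (rule tendsto_mult_left[OF lim_inD(4)[OF s(2)]])
      have "cmod (ip (G f) (s n)) \<le> C * nrm f * nrm (s n)" for n
      proof -
        obtain g where "g \<in> H" "s n = A g" using s(1)[of n] by blast
        then show ?thesis using bound[OF f] by simp
      qed
      then show "\<exists>N. \<forall>n\<ge>N. cmod (ip (G f) (s n)) \<le> C * nrm f * nrm (s n)" by blast
    qed
    \<comment> \<open>For \<open>G f = 0\<close> the product inequality gives no information. That
      \<open>C\<close> is nonnegative follows from the element 0 of \<open>F\<close>.\<close>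
    moreover have "0 \<le> C * nrm f" if "nrm (G f) = 0"
    proof -
      have "A (G' 0) \<in> F" unfolding F_def by (intro CollectI exI[of _ 0]) (simp add: A_linear(4))
      then have "0 \<le> C" using C[of "A (G' 0)"] by (simp add: GD'(4) A_linear(4))
      then show ?thesis using f by simp
    qed
    ultimately show ?thesis
      using nrm_ge_0[OF u] by (cases "nrm (G f) = 0") auto
  qed
  then show ?thesis by blast
qed

lemma Umap_surj:
  assumes "U \<in> unit_R"
  shows "\<exists>G\<in>isom. Umap G = U"
proof -
  have U_unit: "U \<in> unitary_ops H ip" and U_R: "U ` (S ` H) = S ` H"
    using assms by (auto simp: unit_R_def)
  obtain U' where U: "U \<in> B" "U' \<in> B" "\<And>x. x \<in> H \<Longrightarrow> U' (U x) = x" "\<And>x. x \<in> H \<Longrightarrow> U (U' x) = x"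
    using U_unit invertible_opsE[of U] unfolding unitary_ops_def by blast
  have U_ip: "ip (U x) (U y) = ip x y" if "x \<in> H" "y \<in> H" for x y
    using U_unit that by (simp add: unitary_ops_def)
  have "\<exists>h. h \<in> H \<and> U (S f) = S h" if "f \<in> H" for f
    using U_R that by blast
  then obtain G where GH: "\<And>f. f \<in> H \<Longrightarrow> G f \<in> H" and G: "\<And>f. f \<in> H \<Longrightarrow> U (S f) = S (G f)" by metis
  have "\<exists>h. h \<in> H \<and> U' (S f) = S h" if f: "f \<in> H" for f
  proof -
    \<comment> \<open>The inclusion of the range of \<open>S\<close> in its image under
      \<open>U\<close> makes the inverse of \<open>U\<close> preserve the range as well, so that
      \<open>G\<close> has an inverse on all of \<open>H\<close>.\<close>
    have "S f \<in> U ` (S ` H)" using U_R f by simp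
    then obtain h where "h \<in> H" "S f = U (S h)" by blast
    then show ?thesis using U(3)[OF S_linear(1)] by metis
  qed
  then obtain G' where GH': "\<And>f. f \<in> H \<Longrightarrow> G' f \<in> H" and G': "\<And>f. f \<in> H \<Longrightarrow> U' (S f) = S (G' f)" by metis
  have lin: "linear_op H K" if KH: "\<And>f. f \<in> H \<Longrightarrow> K f \<in> H" and K: "\<And>f. f \<in> H \<Longrightarrow> V (S f) = S (K f)" and V: "V \<in> B" for K V
  proof -
    note V' = linear_opD[OF bounded_opsD(1)[OF V]]
    show ?thesis
      unfolding linear_op_def
    proof (intro conjI ballI allI)
      show "K x \<in> H" if "x \<in> H" for x using KH[OF that] .
      show "K (x + y) = K x + K y" if x: "x \<in> H" and y: "y \<in> H" for x y
      proof (rule S_inj[OF KH[OF add_mem[OF x y]] add_mem[OF KH[OF x] KH[OF y]]])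
        show "S (K (x + y)) = S (K x + K y)"
          using x y by (simp add: S_linear(1,2) KH V' flip: K)
      qed
      show "K (c *\<^sub>C x) = c *\<^sub>C K x" if x: "x \<in> H" for c x
      proof (rule S_inj[OF KH[OF scale_mem[OF x]] scale_mem[OF KH[OF x]]])
        show "S (K (c *\<^sub>C x)) = S (c *\<^sub>C K x)"
          using x by (simp add: S_linear(1,3) KH V' flip: K)
      qed
    qed
  qed
  have GG': "G (G' f) = f" if f: "f \<in> H" for f
  proof (rule S_inj[OF GH[OF GH'[OF f]] f])
    show "S (G (G' f)) = S f"
      using f U(4)[OF S_linear(1)[OF f]] by (simp add: GH' flip: G G')
  qed
  have G'G: "G' (G f) = f" if f: "f \<in> H" for f
  proof (rule S_inj[OF GH'[OF GH[OF f]] f])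
    show "S (G' (G f)) = S f"
      using f U(3)[OF S_linear(1)[OF f]] by (simp add: GH flip: G G')
  qed
  have iso: "jp (G f) (G g) = jp f g" if "f \<in> H" "g \<in> H" for f g
    using U_ip[OF S_linear(1)[OF that(1)] S_linear(1)[OF that(2)]] that by (simp add: G S_ip GH)
  have adj: "jp (G f) g = jp f (G' g)" if "f \<in> H" "g \<in> H" for f g
    using iso[OF that(1) GH'[OF that(2)]] GG'[OF that(2)] by simp
  have adj': "jp (G' f) g = jp f (G g)" if "f \<in> H" "g \<in> H" for f g
    using iso[OF GH'[OF that(1)] that(2)] GG'[OF that(1)] by simp
  have linG: "linear_op H G" by (rule lin[OF GH G U(1)])
  have linG': "linear_op H G'" by (rule lin[OF GH' G' U(2)])
  obtain C C' where C: "\<And>f. f \<in> H \<Longrightarrow> nrm (G f) \<le> C * nrm f" and C': "\<And>f. f \<in> H \<Longrightarrow> nrm (G' f) \<le> C' * nrm f"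
    using bounded_of_adjoint[OF linG linG' adj] bounded_of_adjoint[OF linG' linG adj'] by blast
  have "restrict G H \<in> invertible_ops H ip"
    by (rule invertible_opsI[OF bounded_opsI_restrict[OF linG C] bounded_opsI_restrict[OF linG' C']])
      (simp_all add: GH GH' GG' G'G)
  then have "restrict G H \<in> isom" by (simp add: isom_def iso)
  moreover have "Umap (restrict G H) = U"
    by (rule Umap_eqI[OF U_unit]) (simp add: G)
  ultimately show ?thesis by blast
qed

lemma Umap_inj: "inj_on Umap isom"
proof (rule inj_onI)
  fix G K assume G: "G \<in> isom" and K: "K \<in> isom" and eq: "Umap G = Umap K"
  have "G \<in> B" "K \<in> B" using isomE[OF G] isomE[OF K] by metis+
  show "G = K"
  proof (rule extensionalityI[OF bounded_opsD(2)[OF \<open>G \<in> B\<close>] bounded_opsD(2)[OF \<open>K \<in> B\<close>]])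
    fix x assume x: "x \<in> H"
    have "S (G x) = S (K x)" using Umap(3)[OF G x] Umap(3)[OF K x] eq by simp
    then show "G x = K x"
      by (rule S_inj[OF bounded_op_mem[OF \<open>G \<in> B\<close> x] bounded_op_mem[OF \<open>K \<in> B\<close> x]])
  qed
qed

lemma Umap_bij: "bij_betw Umap isom unit_R"
  unfolding bij_betw_def using Umap_inj Umap(4) Umap_surj by blast

end

section \<open>The two groups and the homomorphism property\<close>

context semi_inner
begin

lemma compose_invertible:
  assumes "G \<in> invertible_ops H ip" "K \<in> invertible_ops H ip"
  shows "compose H G K \<in> invertible_ops H ip"
proof -
  obtain G' where G: "G \<in> B" "G' \<in> B" "\<And>x. x \<in> H \<Longrightarrow> G' (G x) = x" "\<And>x. x \<in> H \<Longrightarrow> G (G' x) = x"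
    using invertible_opsE[OF assms(1)] by metis
  obtain K' where K: "K \<in> B" "K' \<in> B" "\<And>x. x \<in> H \<Longrightarrow> K' (K x) = x" "\<And>x. x \<in> H \<Longrightarrow> K (K' x) = x"
    using invertible_opsE[OF assms(2)] by metis
  show ?thesis
    by (rule invertible_opsI[OF bounded_ops_compose[OF G(1) K(1)] bounded_ops_compose[OF K(2) G(2)]])
      (simp_all add: compose_def bounded_op_mem[OF K(1)] bounded_op_mem[OF G(2)] bounded_op_mem[OF G(1)]
        bounded_op_mem[OF K(2)] G K)
qed

lemma id_invertible: "(\<lambda>x\<in>H. x) \<in> invertible_ops H ip"
  by (rule invertible_opsI[OF bounded_ops_id bounded_ops_id]) simp_all

lemma inv_invertible:
  assumes "G \<in> invertible_ops H ip"
  shows "G \<in> Bij H" "(\<lambda>x\<in>H. inv_into H G x) \<in> invertible_ops H ip"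
    "x \<in> H \<Longrightarrow> G (inv_into H G x) = x" "x \<in> H \<Longrightarrow> inv_into H G x \<in> H" "G ` H = H"
proof -
  obtain G' where G: "G \<in> B" "G' \<in> B" "\<And>x. x \<in> H \<Longrightarrow> G' (G x) = x" "\<And>x. x \<in> H \<Longrightarrow> G (G' x) = x"
    using invertible_opsE[OF assms(1)] by metis
  note bij = invertible_op_bij[OF G]
  show "G \<in> Bij H" by (rule bij(1))
  show "G ` H = H" by (rule bij(3))
  have eq: "restrict (inv_into H G) H = G'" using bij(2) by simp
  show "(\<lambda>x\<in>H. inv_into H G x) \<in> invertible_ops H ip"
    unfolding eq by (rule invertible_opsI[OF G(2,1,4,3)])
  have "inv_into H G x = G' x" if "x \<in> H" using fun_cong[OF bij(2), of x] that by simp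
  then show "x \<in> H \<Longrightarrow> G (inv_into H G x) = x" "x \<in> H \<Longrightarrow> inv_into H G x \<in> H"
    using G(4) bounded_op_mem[OF G(2)] by simp_all
qed

lemma invertible_op_mem: "G \<in> invertible_ops H ip \<Longrightarrow> x \<in> H \<Longrightarrow> G x \<in> H"
  using bounded_op_mem[of G x] by (simp add: invertible_ops_def)

end

context two_inner
begin

text \<open>An element of \<open>iso\<close> is just a multiplicative bijection between the
  carriers, so the group axioms are established separately for both sides.\<close>

lemma group_isom: "group ((BijGroup H)\<lparr>carrier := isom\<rparr>)"
proof (rule group_subset_BijGroup)
  show "isom \<subseteq> Bij H" using inv_invertible(1) by (auto simp: isom_def)
  show "(\<lambda>x\<in>H. x) \<in> isom" using id_invertible by (simp add: isom_def)
  show "compose H f g \<in> isom" if "f \<in> isom" "g \<in> isom" for f g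
    using that compose_invertible[of f g] invertible_op_mem[of g]
    by (simp add: isom_def compose_def)
  show "(\<lambda>x\<in>H. inv_into H f x) \<in> isom" if f: "f \<in> isom" for f
  proof -
    have inv: "f \<in> invertible_ops H ip" and iso: "\<And>x y. x \<in> H \<Longrightarrow> y \<in> H \<Longrightarrow> jp (f x) (f y) = jp x y"
      using f by (simp_all add: isom_def)
    note i = inv_invertible[OF inv]
    have "jp (inv_into H f x) (inv_into H f y) = jp x y" if "x \<in> H" "y \<in> H" for x y
      using iso[OF i(4)[OF that(1)] i(4)[OF that(2)]] i(3) that by simp
    then show ?thesis using i(2) by (simp add: isom_def)
  qed
qed

lemma group_unit_R: "group ((BijGroup H)\<lparr>carrier := unit_R\<rparr>)"
proof (rule group_subset_BijGroup)
  have unitD: "f \<in> invertible_ops H ip" "\<And>x y. x \<in> H \<Longrightarrow> y \<in> H \<Longrightarrow> ip (f x) (f y) = ip x y"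
    "f ` (S ` H) = S ` H" if "f \<in> unit_R" for f
    using that by (simp_all add: unit_R_def unitary_ops_def)
  have unitI: "f \<in> unit_R" if "f \<in> invertible_ops H ip" "\<And>x y. x \<in> H \<Longrightarrow> y \<in> H \<Longrightarrow> ip (f x) (f y) = ip x y"
    "f ` (S ` H) = S ` H" for f
    using that by (simp add: unit_R_def unitary_ops_def)
  show "unit_R \<subseteq> Bij H" using inv_invertible(1) unitD(1) by blast
  show "(\<lambda>x\<in>H. x) \<in> unit_R"
    by (rule unitI[OF id_invertible]) (use S_range_subset in \<open>force+\<close>)
  show "compose H f g \<in> unit_R" if f: "f \<in> unit_R" and g: "g \<in> unit_R" for f g
  proof (rule unitI[OF compose_invertible[OF unitD(1)[OF f] unitD(1)[OF g]]])
    show "ip (compose H f g x) (compose H f g y) = ip x y" if "x \<in> H" "y \<in> H" for x y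
      using that unitD(2)[OF f] unitD(2)[OF g] invertible_op_mem[OF unitD(1)[OF g]] by (simp add: compose_def)
    have "compose H f g ` (S ` H) = f ` (g ` (S ` H))"
      unfolding image_image by (rule image_cong[OF refl]) (simp add: compose_def S_linear(1))
    then show "compose H f g ` (S ` H) = S ` H"
      using unitD(3)[OF f] unitD(3)[OF g] by simp
  qed
  show "(\<lambda>x\<in>H. inv_into H f x) \<in> unit_R" if f: "f \<in> unit_R" for f
  proof (rule unitI)
    note i = inv_invertible[OF unitD(1)[OF f]]
    show "(\<lambda>x\<in>H. inv_into H f x) \<in> invertible_ops H ip" by (rule i(2))
    show "ip ((\<lambda>x\<in>H. inv_into H f x) x) ((\<lambda>x\<in>H. inv_into H f x) y) = ip x y" if "x \<in> H" "y \<in> H" for x y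
      using unitD(2)[OF f i(4)[OF that(1)] i(4)[OF that(2)]] i(3) that by simp
    have inj: "inj_on f H" using i(1) by (simp add: Bij_def bij_betw_def)
    have "(\<lambda>x\<in>H. inv_into H f x) ` (S ` H) = inv_into H f ` (f ` (S ` H))"
      using S_range_subset unfolding unitD(3)[OF f] by (intro image_cong[OF refl]) auto
    also have "\<dots> = S ` H"
      by (rule inv_into_image_cancel[OF inj S_range_subset])
    finally show "(\<lambda>x\<in>H. inv_into H f x) ` (S ` H) = S ` H" .
  qed
qed

lemma Umap_compose:
  assumes G: "G \<in> isom" and K: "K \<in> isom"
  shows "Umap (compose H G K) = compose H (Umap G) (Umap K)"
proof (rule Umap_eqI)
  have KB: "K \<in> B" using isomE[OF K] by metis
  have inv: "Umap G \<in> invertible_ops H ip" "Umap K \<in> invertible_ops H ip"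
    using Umap(1)[OF G] Umap(1)[OF K] by (simp_all add: unitary_ops_def)
  show "compose H (Umap G) (Umap K) \<in> unitary_ops H ip"
    using compose_invertible[OF inv] Umap(1)[OF G] Umap(1)[OF K] invertible_op_mem[OF inv(2)]
    by (simp add: unitary_ops_def compose_def)
  show "compose H (Umap G) (Umap K) (S f) = S (compose H G K f)" if f: "f \<in> H" for f
    using Umap(3)[OF K f] Umap(3)[OF G bounded_op_mem[OF KB f]] f S_linear(1)[OF f] by (simp add: compose_def)
qed

lemma Umap_iso: "Umap \<in> iso ((BijGroup H)\<lparr>carrier := isom\<rparr>) ((BijGroup H)\<lparr>carrier := unit_R\<rparr>)"
proof (rule isoI)
  have sub: "G \<in> Bij H" if "G \<in> isom \<or> G \<in> unit_R" for G
    using that inv_invertible(1) by (auto simp: isom_def unit_R_def unitary_ops_def)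
  show "Umap \<in> hom ((BijGroup H)\<lparr>carrier := isom\<rparr>) ((BijGroup H)\<lparr>carrier := unit_R\<rparr>)"
    by (rule homI) (simp_all add: Umap(4) BijGroup_def sub Umap_compose)
  show "bij_betw Umap (carrier ((BijGroup H)\<lparr>carrier := isom\<rparr>)) (carrier ((BijGroup H)\<lparr>carrier := unit_R\<rparr>))"
    using Umap_bij by simp
qed

text \<open>Lax's theorem. The norms of the iterates of \<open>W\<close> at \<open>f\<close> for the weaker inner product form a
  log-convex sequence, so the ratio of the first two is at most the exponential growth rate.\<close>

lemma symmetric_q_bound:
  assumes W: "linear_op H W" and sym: "\<And>f g. f \<in> H \<Longrightarrow> g \<in> H \<Longrightarrow> jp (W f) g = jp f (W g)"
    and M: "0 \<le> M" "\<And>f. f \<in> H \<Longrightarrow> nrm (W f) \<le> M * nrm f" and f: "f \<in> H"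
  shows "q.nrm (W f) \<le> M * q.nrm f"
proof -
  define a where "a n = q.nrm ((W ^^ n) f)" for n
  note WD = linear_opD(1)[OF W]
  have mem: "(W ^^ n) f \<in> H" for n by (induction n) (simp_all add: f WD)
  \<comment> \<open>Growth is measured in the stronger norm, in which \<open>W\<close> is bounded by
    \<open>M\<close>. The factor \<open>nrm f\<close>, which no multiple of \<open>q.nrm f\<close>
    need control, drops out because only the exponential rate matters.\<close>
  have growth: "nrm ((W ^^ n) f) \<le> nrm f * M ^ n" for n
  proof (induction n)
    case (Suc n)
    have "nrm ((W ^^ Suc n) f) \<le> M * nrm ((W ^^ n) f)" using M(2)[OF mem] by simp
    also have "\<dots> \<le> M * (nrm f * M ^ n)" by (rule mult_left_mono[OF Suc M(1)])
    finally show ?case by (simp add: ac_simps)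
  qed simp
  have "a 1 \<le> M * a 0"
  proof (rule log_convex_growth)
    show "0 \<le> a n" for n unfolding a_def by (rule q.nrm_ge_0[OF mem])
    show "a n \<le> nrm f * M ^ n" for n
      unfolding a_def using q_nrm_le[OF mem[of n]] growth[of n] by linarith
    show "(a (Suc n))\<^sup>2 \<le> a n * a (Suc (Suc n))" for n
    proof -
      define v where "v = (W ^^ n) f"
      have v: "v \<in> H" unfolding v_def by (rule mem)
      have "(q.nrm (W v))\<^sup>2 = Re (jp v (W (W v)))"
        using q.nrm_sq[OF WD[OF v]] sym[OF v WD[OF v]] by simp
      also have "\<dots> \<le> q.nrm v * q.nrm (W (W v))"
        using q.Cauchy_Schwarz[OF v WD[OF WD[OF v]]] complex_Re_le_cmod order_trans by blast
      finally show ?thesis by (simp add: a_def v_def)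
    qed
  qed (rule M)
  then show ?thesis by (simp add: a_def)
qed

lemma op_dist_Umap_le:
  assumes G: "G \<in> isom" and K: "K \<in> isom" and C: "0 \<le> C" "\<And>f. f \<in> H \<Longrightarrow> q.nrm (G f - K f) \<le> C * q.nrm f"
  shows "opd (Umap G) (Umap K) \<le> C"
proof (rule op_dist_le[OF Umap(2)[OF G] Umap(2)[OF K] C(1)])
  fix x assume x: "x \<in> H"
  have GB: "G \<in> B" and KB: "K \<in> B" using isomE[OF G] isomE[OF K] by metis+
  show "nrm (Umap G x - Umap K x) \<le> C * nrm x"
  proof (rule dense_bound[where T="\<lambda>x. Umap G x - Umap K x" and C="opd (Umap G) (Umap K)", OF S_dense _ _ _ x])
    show "linear_op H (\<lambda>x. Umap G x - Umap K x)"
      by (rule linear_op_diff[OF bounded_opsD(1)[OF Umap(2)[OF G]] bounded_opsD(1)[OF Umap(2)[OF K]]])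
    show "nrm (Umap G x - Umap K x) \<le> opd (Umap G) (Umap K) * nrm x" if "x \<in> H" for x
      by (rule op_dist_bound[OF Umap(2)[OF G] Umap(2)[OF K] that])
    show "nrm (Umap G x - Umap K x) \<le> C * nrm x" if x: "x \<in> S ` H" for x
    proof -
      obtain f where f: "x = S f" "f \<in> H" using x by blast
      have Gf: "G f \<in> H" and Kf: "K f \<in> H"
        using bounded_op_mem[OF GB f(2)] bounded_op_mem[OF KB f(2)] by simp_all
      have "Umap G x - Umap K x = S (G f - K f)"
        using f Umap(3)[OF G f(2)] Umap(3)[OF K f(2)] S_linear(6)[OF Gf Kf] by simp
      then show ?thesis using C(2)[OF f(2)] f Gf Kf by (simp add: S_nrm)
    qed
  qed
qed

text \<open>The bound is the geometric mean of the distance of the operators and the distance of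
  their adjoints. Near a fixed \<open>K\<close> the second is at most a multiple of the first, which
  makes \<open>Umap\<close> locally Lipschitz.\<close>

lemma Umap_lipschitz:
  assumes G: "G \<in> isom" and K: "K \<in> isom"
    and "G' \<in> B" "K' \<in> B"
    and adjG: "\<And>f g. f \<in> H \<Longrightarrow> g \<in> H \<Longrightarrow> jp (G f) g = jp f (G' g)"
    and adjK: "\<And>f g. f \<in> H \<Longrightarrow> g \<in> H \<Longrightarrow> jp (K f) g = jp f (K' g)"
  shows "opd (Umap G) (Umap K) \<le> sqrt (opd G' K' * opd G K)"
proof (rule op_dist_Umap_le[OF G K])
  have GB: "G \<in> B" and KB: "K \<in> B" using isomE[OF G] isomE[OF K] by metis+
  show "0 \<le> sqrt (opd G' K' * opd G K)" by (simp add: op_dist_nonneg)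
  define T T' where "T = (\<lambda>x. G x - K x)" and "T' = (\<lambda>x. G' x - K' x)"
  have T: "linear_op H T" unfolding T_def by (rule linear_op_diff[OF bounded_opsD(1)[OF GB] bounded_opsD(1)[OF KB]])
  have T': "linear_op H T'" unfolding T'_def by (rule linear_op_diff[OF assms(3,4)[THEN bounded_opsD(1)]])
  note TD = linear_opD(1)[OF T] and TD' = linear_opD(1)[OF T']
  note mem = bounded_op_mem[OF GB] bounded_op_mem[OF KB] bounded_op_mem[OF assms(3)] bounded_op_mem[OF assms(4)]
  have adj: "jp (T f) g = jp f (T' g)" if "f \<in> H" "g \<in> H" for f g
    using that adjG adjK by (simp add: T_def T'_def q.diff_left q.diff_right mem)
  have adj': "jp (T' f) g = jp f (T g)" if "f \<in> H" "g \<in> H" for f g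
    using adj[OF that(2,1)] q.cnj_sym[OF TD[OF that(2)] that(1)] q.cnj_sym[OF that(2) TD'[OF that(1)]] by simp
  fix f assume f: "f \<in> H"
  have W: "q.nrm (T' (T f)) \<le> (opd G' K' * opd G K) * q.nrm f"
  proof (rule symmetric_q_bound[OF linear_op_compose[OF T' T] _ _ _ f])
    show "jp (T' (T f)) g = jp f (T' (T g))" if "f \<in> H" "g \<in> H" for f g
      using that by (simp add: adj adj' TD TD')
    show "0 \<le> opd G' K' * opd G K" by (simp add: op_dist_nonneg)
    show "nrm (T' (T f)) \<le> opd G' K' * opd G K * nrm f" if f: "f \<in> H" for f
    proof -
      have "nrm (T' (T f)) \<le> opd G' K' * nrm (T f)"
        unfolding T'_def by (rule op_dist_bound[OF assms(3,4) TD[OF f]])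
      also have "\<dots> \<le> opd G' K' * (opd G K * nrm f)"
        unfolding T_def by (rule mult_left_mono[OF op_dist_bound[OF GB KB f] op_dist_nonneg])
      finally show ?thesis by (simp add: mult.assoc)
    qed
  qed
  have "(q.nrm (T f))\<^sup>2 = Re (jp f (T' (T f)))"
    using q.nrm_sq[OF TD[OF f]] adj[OF f TD[OF f]] by simp
  also have "\<dots> \<le> q.nrm f * q.nrm (T' (T f))"
    using q.Cauchy_Schwarz[OF f TD'[OF TD[OF f]]] complex_Re_le_cmod order_trans by blast
  also have "\<dots> \<le> q.nrm f * ((opd G' K' * opd G K) * q.nrm f)"
    by (rule mult_left_mono[OF W q.nrm_ge_0[OF f]])
  also have "\<dots> = (sqrt (opd G' K' * opd G K) * q.nrm f)\<^sup>2"
    by (simp add: power_mult_distrib op_dist_nonneg) (simp add: power2_eq_square ac_simps)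
  finally show "q.nrm (G f - K f) \<le> sqrt (opd G' K' * opd G K) * q.nrm f"
    unfolding T_def by (rule power2_le_imp_le) (simp add: op_dist_nonneg f)
qed

lemma isom_continuous:
  assumes K: "K \<in> isom" and e: "0 < e"
  shows "\<exists>d>0. \<forall>G. G \<in> isom \<and> opd K G < d \<longrightarrow> opd (Umap K) (Umap G) < e"
proof -
  obtain K' where KB: "K \<in> B" "K' \<in> B" "\<And>x. x \<in> H \<Longrightarrow> K' (K x) = x" "\<And>x. x \<in> H \<Longrightarrow> K (K' x) = x"
    and adjK: "\<And>f g. f \<in> H \<Longrightarrow> g \<in> H \<Longrightarrow> jp (K f) g = jp f (K' g)"
    using isomE[OF K] by metis
  define c where "c = opn K' + 1"
  have c: "1 \<le> c" using op_norm_nonneg[OF KB(2)] by (simp add: c_def)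
  have K'_le: "nrm (K' x) \<le> c * nrm x" if "x \<in> H" for x
    using op_norm_bound[OF KB(2) that] that by (simp add: c_def distrib_right add_increasing2)
  \<comment> \<open>The first term makes the correction in \<open>G'_le\<close> absorbable, the
    second one makes the final estimate \<open>t * (2 * c)\<close> smaller than
    \<open>e\<close>.\<close>
  define d where "d = min (1 / (2 * c)) (e / (2 * c))"
  have d: "0 < d" using c e by (simp add: d_def)
  have "opd (Umap K) (Umap G) < e" if G: "G \<in> isom" and less: "opd K G < d" for G
  proof -
    obtain G' where GB: "G \<in> B" "G' \<in> B" "\<And>x. x \<in> H \<Longrightarrow> G' (G x) = x" "\<And>x. x \<in> H \<Longrightarrow> G (G' x) = x"
      and adjG: "\<And>f g. f \<in> H \<Longrightarrow> g \<in> H \<Longrightarrow> jp (G f) g = jp f (G' g)"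
      using isomE[OF G] by metis
    define t where "t = opd K G"
    have t: "0 \<le> t" "t * c \<le> 1/2" "t * (2 * c) < e"
    proof -
      show "0 \<le> t" by (simp add: t_def op_dist_nonneg)
      have "t < 1 / (2 * c)" "t < e / (2 * c)" using less by (simp_all add: t_def d_def)
      then show "t * c \<le> 1/2" "t * (2 * c) < e" using c by (simp_all add: field_simps)
    qed
    note mem = bounded_op_mem[OF GB(1)] bounded_op_mem[OF GB(2)] bounded_op_mem[OF KB(1)] bounded_op_mem[OF KB(2)]
    have diff: "nrm (K' x - G' x) \<le> c * t * nrm (G' x)" if x: "x \<in> H" for x
    proof -
      \<comment> \<open>The resolvent identity \<open>K' - G' = K' (G - K) G'\<close>.\<close>
      have "K' x - G' x = K' (G (G' x) - K (G' x))"
        using x by (simp add: mem GB(4) KB(3) linear_opD(6)[OF bounded_opsD(1)[OF KB(2)]])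
      then have "nrm (K' x - G' x) \<le> c * nrm (G (G' x) - K (G' x))"
        using K'_le[of "G (G' x) - K (G' x)"] x mem by simp
      also have "nrm (G (G' x) - K (G' x)) = nrm (K (G' x) - G (G' x))"
        using x mem by (intro nrm_minus_commute) simp_all
      also have "c * \<dots> \<le> c * (t * nrm (G' x))"
        unfolding t_def using op_dist_bound[OF KB(1) GB(1)] mem(2)[OF x] c by (intro mult_left_mono) auto
      finally show ?thesis by (simp add: mult.assoc)
    qed
    \<comment> \<open>As \<open>G'\<close> is already known to exist, no Neumann series is needed:
      the resolvent identity bounds \<open>nrm (G' x)\<close> by \<open>c * nrm x\<close> plus half
      of itself.\<close>
    have G'_le: "nrm (G' x) \<le> 2 * c * nrm x" if x: "x \<in> H" for x
    proof -
      have "nrm (G' x) \<le> nrm (K' x) + nrm (K' x - G' x)"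
        using nrm_diff_ge[OF mem(4)[OF x] mem(2)[OF x]] by linarith
      also have "\<dots> \<le> c * nrm x + 1/2 * nrm (G' x)"
        using K'_le[OF x] diff[OF x] mult_right_mono[OF t(2) nrm_ge_0[OF mem(2)[OF x]]]
        by (simp add: mult.commute)
      finally show ?thesis by simp
    qed
    have dist': "opd K' G' \<le> c * t * (2 * c)"
    proof (rule op_dist_le[OF KB(2) GB(2)])
      show "0 \<le> c * t * (2 * c)" using c t(1) by simp
      fix x assume x: "x \<in> H"
      have "nrm (K' x - G' x) \<le> c * t * nrm (G' x)" by (rule diff[OF x])
      also have "\<dots> \<le> c * t * (2 * c * nrm x)"
        using G'_le[OF x] c t(1) by (intro mult_left_mono) auto
      finally show "nrm (K' x - G' x) \<le> c * t * (2 * c) * nrm x" by (simp add: mult.assoc)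
    qed
    have "opd (Umap K) (Umap G) \<le> sqrt (opd K' G' * opd K G)"
      by (rule Umap_lipschitz[OF K G KB(2) GB(2) adjK adjG])
    also have "\<dots> \<le> sqrt ((c * t * (2 * c)) * t)"
      unfolding t_def[symmetric] using mult_right_mono[OF dist' t(1)] by simp
    \<comment> \<open>The radicand is twice the square of \<open>c * t\<close>; rounding it up to
      four times that square makes the root explicit.\<close>
    also have "\<dots> \<le> sqrt ((t * (2 * c))\<^sup>2)"
      using c t(1) by (intro real_sqrt_le_mono) (simp add: power2_eq_square)
    also have "\<dots> = t * (2 * c)" using c t(1) by simp
    finally show ?thesis using t(3) by simp
  qed
  with d show ?thesis by blast
qed

lemma isom_subset: "isom \<subseteq> B" and unit_R_subset: "unit_R \<subseteq> B"
  by (auto simp: isom_def unit_R_def unitary_ops_def invertible_ops_def)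

lemma Umap_continuous:
  "continuous_map (subtopology (norm_topology H ip) isom) (subtopology (norm_topology H ip) unit_R) Umap"
  unfolding continuous_map_norm_topology_iff[OF isom_subset unit_R_subset]
  using Umap(4) isom_continuous by blast

text \<open>For \<open>jp z z\<close> nonzero this is the identity plus \<open>c\<close> times the
  \<open>jp\<close>-orthogonal projection to the line of \<open>z\<close>: it multiplies
  \<open>z\<close> by \<open>1 + c\<close> and fixes the \<open>jp\<close>-orthogonal complement. It
  therefore preserves \<open>jp\<close> when \<open>1 + c\<close> has modulus 1.\<close>

definition rank_one_pert :: "complex \<Rightarrow> 'a \<Rightarrow> 'a \<Rightarrow> 'a" where
  "rank_one_pert c z = (\<lambda>f. f + (c / jp z z * jp f z) *\<^sub>C z)"

lemma rank_one_pert_mem: "z \<in> H \<Longrightarrow> f \<in> H \<Longrightarrow> rank_one_pert c z f \<in> H"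
  by (simp add: rank_one_pert_def)

lemma rank_one_pert_linear:
  assumes z: "z \<in> H"
  shows "linear_op H (rank_one_pert c z)"
  unfolding linear_op_def
proof (intro conjI ballI allI)
  show "rank_one_pert c z x \<in> H" if "x \<in> H" for x using z that by (rule rank_one_pert_mem)
  show "rank_one_pert c z (x + y) = rank_one_pert c z x + rank_one_pert c z y"
    if "x \<in> H" "y \<in> H" for x y
    using that z by (simp add: rank_one_pert_def q.add_left distrib_left scaleC_add_left add_divide_distrib)
  show "rank_one_pert c z (d *\<^sub>C x) = d *\<^sub>C rank_one_pert c z x" if "x \<in> H" for d x
    using that z by (simp add: rank_one_pert_def q.scale_left scaleC_add_right scaleC_scaleC ac_simps)
qed

lemma rank_one_pert_bounded:
  assumes z: "z \<in> H" and f: "f \<in> H"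
  shows "nrm (rank_one_pert c z f) \<le> (1 + cmod (c / jp z z) * q.nrm z * nrm z) * nrm f"
proof -
  have "cmod (jp f z) \<le> q.nrm z * nrm f"
    using q.Cauchy_Schwarz[OF f z] mult_right_mono[OF q_nrm_le[OF f] q.nrm_ge_0[OF z]]
    by (simp add: mult.commute)
  then have "cmod (c / jp z z) * cmod (jp f z) * nrm z \<le> cmod (c / jp z z) * (q.nrm z * nrm f) * nrm z"
    using z by (intro mult_right_mono mult_left_mono) auto
  moreover have "nrm (rank_one_pert c z f) \<le> nrm f + cmod (c / jp z z) * cmod (jp f z) * nrm z"
    using nrm_triangle[OF f scale_mem[OF z], of "c / jp z z * jp f z"] z
    by (simp only: rank_one_pert_def nrm_scale[OF z] norm_mult)
  moreover have "(1 + cmod (c / jp z z) * q.nrm z * nrm z) * nrm f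
      = nrm f + cmod (c / jp z z) * (q.nrm z * nrm f) * nrm z" by (simp add: distrib_right)
  ultimately show ?thesis by linarith
qed

text \<open>The condition on \<open>c\<close> and \<open>d\<close> says that the factors
  \<open>1 + c\<close> and \<open>1 + d\<close> on the line of \<open>z\<close> have product
  1.\<close>

lemma rank_one_pert_inverse:
  assumes z: "z \<in> H" "jp z z \<noteq> 0" and f: "f \<in> H" and c: "c + d + c * d = 0"
  shows "rank_one_pert c z (rank_one_pert d z f) = f"
proof -
  define a where "a = jp f z / jp z z"
  have "jp (rank_one_pert d z f) z = (1 + d) * jp f z"
    using z f by (simp add: rank_one_pert_def q.add_left q.scale_left algebra_simps)
  then have "rank_one_pert c z (rank_one_pert d z f) = f + ((d * a) *\<^sub>C z + (c * (1 + d) * a) *\<^sub>C z)"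
    by (simp add: rank_one_pert_def a_def add.assoc mult.assoc)
  also have "(d * a) *\<^sub>C z + (c * (1 + d) * a) *\<^sub>C z = ((c + d + c * d) * a) *\<^sub>C z"
    by (simp add: algebra_simps flip: scaleC_add_left)
  finally show ?thesis by (simp add: c)
qed

lemma rank_one_pert_isom:
  assumes z: "z \<in> H" "jp z z \<noteq> 0" and c: "cmod (1 + c) = 1"
  shows "restrict (rank_one_pert c z) H \<in> isom"
proof -
  have "(1 + c) * cnj (1 + c) = 1"
    using c by (simp only: complex_norm_square[symmetric]) simp
  \<comment> \<open>For \<open>1 + c\<close> of modulus 1 the reciprocal is
    \<open>1 + cnj c\<close>, so the inverse is the perturbation with \<open>cnj c\<close>.\<close>
  then have c': "c + cnj c + c * cnj c = 0" "cnj c + c + cnj c * c = 0"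
    by (simp_all add: algebra_simps)
  have inv: "rank_one_pert c z (rank_one_pert (cnj c) z f) = f"
    "rank_one_pert (cnj c) z (rank_one_pert c z f) = f" if "f \<in> H" for f
    using rank_one_pert_inverse[OF z that] c' by simp_all
  have bounded: "restrict (rank_one_pert d z) H \<in> B" for d
    by (rule bounded_opsI_restrict[OF rank_one_pert_linear[OF z(1)] rank_one_pert_bounded[OF z(1)]])
  have "restrict (rank_one_pert c z) H \<in> invertible_ops H ip"
    by (rule invertible_opsI[OF bounded bounded[of "cnj c"]])
      (simp_all add: inv rank_one_pert_mem[OF z(1)])
  moreover have "jp (rank_one_pert c z f) (rank_one_pert c z g) = jp f g" if f: "f \<in> H" and g: "g \<in> H" for f g
  proof -
    define p where "p = jp z z"
    have p: "p \<noteq> 0" "cnj p = p" using z q.cnj_sym[OF z(1) z(1)] by (simp_all add: p_def)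
    have zg: "jp z g = cnj (jp g z)" by (rule q.cnj_sym[OF g z(1)])
    have "jp (rank_one_pert c z f) (rank_one_pert c z g)
        = jp f g + cnj (c / p * jp g z) * jp f z + c / p * jp f z * (cnj (jp g z) + cnj (c / p * jp g z) * p)"
      using f g z(1) unfolding rank_one_pert_def
      by (simp add: q.add_left q.add_right q.scale_left q.scale_right zg p_def[symmetric] algebra_simps)
    also have "\<dots> = jp f g + (c + cnj c + c * cnj c) * (jp f z * cnj (jp g z) / p)"
      using p by (simp add: field_simps)
    finally show ?thesis by (simp add: c')
  qed
  ultimately show ?thesis by (simp add: isom_def)
qed

lemma id_isom: "(\<lambda>x\<in>H. x) \<in> isom"
  using id_invertible by (simp add: isom_def)

text \<open>Perturbing the identity by \<open>c / p \<cdot> \<langle>\<cdot>, z\<rangle> z\<close> with \<open>z = f + h\<close>, where \<open>\<langle>f, f\<rangle> = \<langle>h, h\<rangle> = 1\<close>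
  and \<open>\<parallel>h\<parallel>\<close> is large, moves \<open>f\<close> by about \<open>|c| \<parallel>h\<parallel>\<close>, whereas the corresponding unitary moves by
  at most \<open>|c|\<close>.\<close>

lemma inv_Umap_discontinuous:
  assumes unb: "\<And>C. \<exists>h\<in>H. C * q.nrm h < nrm h"
  shows "\<not> continuous_map (subtopology (norm_topology H ip) unit_R) (subtopology (norm_topology H ip) isom)
    (inv_into isom Umap)"
proof
  assume cont: "continuous_map (subtopology (norm_topology H ip) unit_R) (subtopology (norm_topology H ip) isom)
    (inv_into isom Umap)"
  define I where "I = (\<lambda>x\<in>H. x)"
  have I: "I \<in> isom" using id_isom by (simp add: I_def)
  have inv: "inv_into isom Umap (Umap G) = G" if "G \<in> isom" for G
    by (rule inv_into_f_f[OF Umap_inj that])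
  obtain d where d: "0 < d" and dist: "\<And>G. G \<in> isom \<Longrightarrow> opd (Umap I) (Umap G) < d \<Longrightarrow> opd I G < 1"
  proof -
    have "\<exists>d>0. \<forall>V. V \<in> unit_R \<and> opd (Umap I) V < d \<longrightarrow> opd (inv_into isom Umap (Umap I)) (inv_into isom Umap V) < 1"
      using cont Umap(4)[OF I] unfolding continuous_map_norm_topology_iff[OF unit_R_subset isom_subset]
      by (meson zero_less_one)
    then show ?thesis using that inv I Umap(4) by metis
  qed
  \<comment> \<open>The bound 1 keeps \<open>t\<close> in the range where the sine is positive,
    which makes \<open>c\<close> below nonzero; \<open>t < d\<close> makes the perturbation
    admissible.\<close>
  define t where "t = min 1 (d / 2)"
  have t: "0 < t" "t \<le> 1" "t < d" using d by (auto simp: t_def)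
  \<comment> \<open>A rotation by the angle \<open>t\<close> on the line of \<open>z\<close>: then
    \<open>1 + c\<close> has modulus 1 and the chord \<open>cmod c\<close> is at most the arc
    \<open>t\<close>.\<close>
  define c where "c = cis t - 1"
  have c1: "cmod (1 + c) = 1" by (simp add: c_def)
  have c2: "cmod c \<le> t"
  proof -
    have "(cmod c)\<^sup>2 = ((cos t)\<^sup>2 + (sin t)\<^sup>2) + 1 - 2 * cos t"
      unfolding c_def cmod_power2 by (simp add: power2_diff del: sin_cos_squared_add sin_cos_squared_add2)
    also have "\<dots> = 2 - 2 * cos t" by simp
    also have "\<dots> = (2 * sin (t / 2))\<^sup>2"
      using cos_double_sin[of "t / 2"] by (simp add: power_mult_distrib)
    also have "\<dots> \<le> t\<^sup>2"
      using abs_sin_x_le_abs_x[of "t / 2"] by (intro power2_le_iff_abs_le[THEN iffD2]) (use t in auto)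
    finally show ?thesis using t(1) by (simp add: power2_le_iff_abs_le)
  qed
  have "0 < sin t" using t pi_gt3 by (intro sin_gt_zero) auto
  then have "c \<noteq> 0" by (auto simp: c_def complex_eq_iff)
  then have c0: "0 < cmod c" by simp
  have unit: "\<exists>h\<in>H. q.nrm h = 1 \<and> C < nrm h" for C
  proof -
    obtain h where h: "h \<in> H" "C * q.nrm h < nrm h" using unb by blast
    have "h \<noteq> 0" using h(2) by (auto simp: ip_norm_def)
    then have pos: "0 < q.nrm h" using q.nrm_pos h(1) by blast
    define k where "k = complex_of_real (1 / q.nrm h) *\<^sub>C h"
    have "q.nrm k = 1" "nrm k = nrm h / q.nrm h"
      using h(1) pos by (simp_all add: k_def q.nrm_scale nrm_scale norm_divide)
    moreover have "k \<in> H" using h(1) by (simp add: k_def)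
    moreover have "C < nrm h / q.nrm h" using h(2) pos by (simp add: field_simps)
    ultimately show ?thesis by auto
  qed
  obtain f where f: "f \<in> H" "q.nrm f = 1" using unit by blast
  have ff: "jp f f = 1" using q.ip_self[OF f(1)] f(2) by simp
  \<comment> \<open>The threshold is read off from the end of the proof, where \<open>nrm z\<close>
    is at most \<open>4 * nrm f / cmod c\<close> and \<open>nrm h\<close> at most
    \<open>nrm z + nrm f\<close>. Replacing \<open>h\<close> by \<open>- h\<close> arranges the sign
    of the real part, which keeps \<open>jp z z\<close> between 2 and 4 and \<open>jp f z\<close> at
    least 1 in modulus.\<close>
  obtain h where h: "h \<in> H" "q.nrm h = 1" "4 * nrm f / cmod c + nrm f < nrm h" "0 \<le> Re (jp f h)"
  proof -
    obtain h where h: "h \<in> H" "q.nrm h = 1" "4 * nrm f / cmod c + nrm f < nrm h" using unit by blast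
    show ?thesis
    proof (cases "0 \<le> Re (jp f h)")
      case True
      then show ?thesis using that h by blast
    next
      case False
      show ?thesis
        by (rule that[of "- h"]) (use h False f(1) in \<open>simp_all add: q.minus_right\<close>)
    qed
  qed
  define z where "z = f + h"
  have z: "z \<in> H" using f(1) h(1) by (simp add: z_def)
  have hh: "jp h h = 1" using q.ip_self[OF h(1)] h(2) by simp
  have hf: "jp h f = cnj (jp f h)" by (rule q.cnj_sym[OF f(1) h(1)])
  have "jp z z = complex_of_real (2 + 2 * Re (jp f h))"
    using f(1) h(1) by (simp add: z_def q.add_left q.add_right ff hh hf complex_eq_iff)
  moreover have "Re (jp f h) \<le> 1"
    using q.Cauchy_Schwarz[OF f(1) h(1)] complex_Re_le_cmod[of "jp f h"] f(2) h(2) by simp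
  ultimately obtain p where p: "jp z z = complex_of_real p" "2 \<le> p" "p \<le> 4"
    using h(4) by fastforce
  have zz: "jp z z \<noteq> 0" using p by simp
  have q_z: "(q.nrm z)\<^sup>2 = p" using q.nrm_sq[OF z] p(1) by simp
  define G where "G = restrict (rank_one_pert c z) H"
  have G: "G \<in> isom" unfolding G_def by (rule rank_one_pert_isom[OF z zz c1])
  have diff: "G x - I x = (c / jp z z * jp x z) *\<^sub>C z" if "x \<in> H" for x
    using that by (simp add: G_def I_def rank_one_pert_def)
  \<comment> \<open>The normalisation \<open>p\<close> is the square of \<open>q.nrm z\<close> and
    cancels, so the bound is independent of \<open>z\<close> and hence of the size of
    \<open>h\<close>.\<close>
  have "opd (Umap I) (Umap G) \<le> cmod c"
  proof (rule op_dist_Umap_le[OF I G])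
    show "0 \<le> cmod c" by simp
    fix x assume x: "x \<in> H"
    have "q.nrm (I x - G x) = q.nrm (G x - I x)"
      using x by (intro q.nrm_minus_commute) (simp_all add: I_def G_def rank_one_pert_mem z)
    also have "\<dots> = cmod c / p * cmod (jp x z) * q.nrm z"
      unfolding diff[OF x] q.nrm_scale[OF z] using p by (simp add: norm_mult norm_divide)
    also have "\<dots> \<le> cmod c / p * (q.nrm x * q.nrm z) * q.nrm z"
      using q.Cauchy_Schwarz[OF x z] p(2) z by (intro mult_right_mono mult_left_mono) auto
    also have "\<dots> = cmod c / p * q.nrm x * (q.nrm z)\<^sup>2" by (simp add: power2_eq_square)
    also have "\<dots> = cmod c * q.nrm x" unfolding q_z using p(2) by simp
    finally show "q.nrm (I x - G x) \<le> cmod c * q.nrm x" .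
  qed
  then have "opd I G < 1" using dist[OF G] c2 t(3) by simp
  moreover have "nrm (I f - G f) \<le> opd I G * nrm f"
    by (rule op_dist_bound) (use I G isom_subset f(1) in auto)
  ultimately have "nrm (I f - G f) \<le> nrm f"
    using mult_right_mono[of "opd I G" 1 "nrm f"] f(1) by simp
  moreover have "nrm (I f - G f) = nrm (G f - I f)"
    using f(1) by (intro nrm_minus_commute) (simp_all add: I_def G_def rank_one_pert_mem z)
  moreover have "nrm (G f - I f) = cmod c / p * cmod (jp f z) * nrm z"
    unfolding diff[OF f(1)] nrm_scale[OF z] using p by (simp add: norm_mult norm_divide)
  ultimately have small: "cmod c / p * cmod (jp f z) * nrm z \<le> nrm f" by simp
  have "jp f z = 1 + jp f h" using f(1) h(1) by (simp add: z_def q.add_right ff)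
  then have "1 \<le> cmod (jp f z)" using h(4) complex_Re_le_cmod[of "jp f z"] by simp
  then have "cmod c / 4 * 1 * nrm z \<le> cmod c / p * cmod (jp f z) * nrm z"
    using p c0 z by (intro mult_right_mono mult_mono divide_left_mono) auto
  then have "cmod c / 4 * 1 * nrm z \<le> nrm f" using small by (rule order_trans)
  then have "nrm z \<le> 4 * nrm f / cmod c" using c0 by (simp add: field_simps)
  moreover have "nrm h \<le> nrm z + nrm f"
    using nrm_triangle_diff[OF z f(1)] by (simp add: z_def)
  ultimately show False using h(3) by simp
qed

end

section \<open>The space \<open>L\<^sup>2\<close>\<close>

lemma rep_ae_fun_measurable [measurable, simp]: "rep_ae_fun f \<in> borel_measurable lebesgue"
  using Quotient3_rep_reflp[OF Quotient3_ae_fun, of f] by blast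

lemma AE_rep_abs_ae_fun:
  "f \<in> borel_measurable lebesgue \<Longrightarrow> AE x in lebesgue. rep_ae_fun (abs_ae_fun f) x = f x"
  using Quotient3_rep_abs[OF Quotient3_ae_fun, of f] by simp

lemma ae_fun_eqI: "AE x in lebesgue. rep_ae_fun f x = rep_ae_fun g x \<Longrightarrow> f = g"
  using Quotient3_rel_rep[OF Quotient3_ae_fun, of f g] by simp

lemma ae_fun_eqD: "abs_ae_fun f = g \<Longrightarrow> f \<in> borel_measurable lebesgue \<Longrightarrow> AE x in lebesgue. rep_ae_fun g x = f x"
  using AE_rep_abs_ae_fun by blast

lemma AE_rep_add: "AE x in lebesgue. rep_ae_fun (f + g) x = rep_ae_fun f x + rep_ae_fun g x"
  by (rule ae_fun_eqD) (simp_all add: plus_ae_fun_def)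

lemma AE_rep_diff: "AE x in lebesgue. rep_ae_fun (f - g) x = rep_ae_fun f x - rep_ae_fun g x"
  by (rule ae_fun_eqD) (simp_all add: minus_ae_fun_def)

lemma AE_rep_scale: "AE x in lebesgue. rep_ae_fun (c *\<^sub>C f) x = c * rep_ae_fun f x"
  by (rule ae_fun_eqD) (simp_all add: scaleC_ae_fun_def)

lemma AE_rep_zero: "AE x in lebesgue. rep_ae_fun (0 :: 'n::finite ae_fun) x = 0"
  by (rule ae_fun_eqD) (simp_all add: zero_ae_fun_def)

lemma abs_ae_fun_add:
  assumes "f \<in> borel_measurable lebesgue" "g \<in> borel_measurable lebesgue"
  shows "abs_ae_fun (\<lambda>x. f x + g x) = abs_ae_fun f + abs_ae_fun g"
proof (rule ae_fun_eqI)
  show "AE x in lebesgue. rep_ae_fun (abs_ae_fun (\<lambda>x. f x + g x)) x = rep_ae_fun (abs_ae_fun f + abs_ae_fun g) x"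
    using AE_rep_abs_ae_fun[OF borel_measurable_add[OF assms]] AE_rep_add[of "abs_ae_fun f" "abs_ae_fun g"]
      AE_rep_abs_ae_fun[OF assms(1)] AE_rep_abs_ae_fun[OF assms(2)]
    by eventually_elim simp
qed

lemma abs_ae_fun_scale:
  assumes "f \<in> borel_measurable lebesgue"
  shows "abs_ae_fun (\<lambda>x. c * f x) = c *\<^sub>C abs_ae_fun f"
proof (rule ae_fun_eqI)
  have "(\<lambda>x. c * f x) \<in> borel_measurable lebesgue" using assms by simp
  from AE_rep_abs_ae_fun[OF this]
  show "AE x in lebesgue. rep_ae_fun (abs_ae_fun (\<lambda>x. c * f x)) x = rep_ae_fun (c *\<^sub>C abs_ae_fun f) x"
    using AE_rep_scale[of c "abs_ae_fun f"] AE_rep_abs_ae_fun[OF assms]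
    by eventually_elim simp
qed

text \<open>Members of \<open>L2 \<Omega>\<close> vanish almost everywhere outside the domain, so
  all later computations can use integrals over the whole space.\<close>

lemma set_integral_eq_integral:
  fixes f :: "real^'n::finite \<Rightarrow> complex"
  assumes "\<Omega> \<in> sets lebesgue" "f \<in> borel_measurable lebesgue" "AE x in lebesgue. x \<notin> \<Omega> \<longrightarrow> f x = 0"
  shows "(LINT x:\<Omega>|lebesgue. f x) = integral\<^sup>L lebesgue f"
  unfolding set_lebesgue_integral_def
proof (rule integral_cong_AE)
  show "(\<lambda>x. indicator \<Omega> x *\<^sub>R f x) \<in> borel_measurable lebesgue"
    using assms(1,2) by measurable
  show "AE x in lebesgue. indicator \<Omega> x *\<^sub>R f x = f x"
    using assms(3) by eventually_elim (auto simp: indicator_def)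
qed (rule assms(2))

lemma L2_iff:
  assumes "\<Omega> \<in> sets lebesgue"
  shows "f \<in> L2 \<Omega> \<longleftrightarrow> integrable lebesgue (\<lambda>x. (cmod (rep_ae_fun f x))\<^sup>2) \<and>
    (AE x in lebesgue. x \<notin> \<Omega> \<longrightarrow> rep_ae_fun f x = 0)"
proof -
  have "set_integrable lebesgue \<Omega> (\<lambda>x. (cmod (rep_ae_fun f x))\<^sup>2)
      \<longleftrightarrow> integrable lebesgue (\<lambda>x. (cmod (rep_ae_fun f x))\<^sup>2)"
    if *: "AE x in lebesgue. x \<notin> \<Omega> \<longrightarrow> rep_ae_fun f x = 0"
    unfolding set_integrable_def
  proof (rule integrable_cong_AE)
    show "(\<lambda>x. indicator \<Omega> x *\<^sub>R (cmod (rep_ae_fun f x))\<^sup>2) \<in> borel_measurable lebesgue"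
      using assms by measurable
    show "AE x in lebesgue. indicator \<Omega> x *\<^sub>R (cmod (rep_ae_fun f x))\<^sup>2 = (cmod (rep_ae_fun f x))\<^sup>2"
      using * by eventually_elim (auto simp: indicator_def)
  qed measurable
  then show ?thesis by (auto simp: L2_def)
qed

lemma integrable_mult_of_square_integrable:
  fixes f g :: "'a \<Rightarrow> complex"
  assumes [measurable]: "f \<in> borel_measurable M" "g \<in> borel_measurable M"
    and "integrable M (\<lambda>x. (cmod (f x))\<^sup>2)" "integrable M (\<lambda>x. (cmod (g x))\<^sup>2)"
  shows "integrable M (\<lambda>x. f x * cnj (g x))"
proof (rule Bochner_Integration.integrable_bound)
  show "integrable M (\<lambda>x. (cmod (f x))\<^sup>2 + (cmod (g x))\<^sup>2)" using assms(3,4) by simp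
  have "(\<lambda>x. cnj (g x)) \<in> borel_measurable M"
    by (rule borel_measurable_continuous_on[OF _ assms(2)]) (intro continuous_intros)
  then show "(\<lambda>x. f x * cnj (g x)) \<in> borel_measurable M" by measurable
  have "norm (f x * cnj (g x)) \<le> norm ((cmod (f x))\<^sup>2 + (cmod (g x))\<^sup>2)" for x
  proof -
    have "0 \<le> (cmod (f x) - cmod (g x))\<^sup>2" by simp
    then have "2 * (cmod (f x) * cmod (g x)) \<le> (cmod (f x))\<^sup>2 + (cmod (g x))\<^sup>2"
      by (simp add: power2_diff)
    moreover have "0 \<le> cmod (f x) * cmod (g x)" by simp
    ultimately have "cmod (f x) * cmod (g x) \<le> (cmod (f x))\<^sup>2 + (cmod (g x))\<^sup>2" by linarith
    then show ?thesis by (simp add: norm_mult)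
  qed
  then show "AE x in M. norm (f x * cnj (g x)) \<le> norm ((cmod (f x))\<^sup>2 + (cmod (g x))\<^sup>2)" by simp
qed

lemma square_integrable_add:
  fixes f g :: "'a \<Rightarrow> complex"
  assumes [measurable]: "f \<in> borel_measurable M" "g \<in> borel_measurable M"
    and "integrable M (\<lambda>x. (cmod (f x))\<^sup>2)" "integrable M (\<lambda>x. (cmod (g x))\<^sup>2)"
  shows "integrable M (\<lambda>x. (cmod (f x + g x))\<^sup>2)"
proof (rule Bochner_Integration.integrable_bound)
  show "integrable M (\<lambda>x. 2 * (cmod (f x))\<^sup>2 + 2 * (cmod (g x))\<^sup>2)" using assms(3,4) by simp
  show "(\<lambda>x. (cmod (f x + g x))\<^sup>2) \<in> borel_measurable M" by measurable
  have "norm ((cmod (f x + g x))\<^sup>2) \<le> norm (2 * (cmod (f x))\<^sup>2 + 2 * (cmod (g x))\<^sup>2)" for x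
  proof -
    have "(cmod (f x + g x))\<^sup>2 \<le> (cmod (f x) + cmod (g x))\<^sup>2"
      by (intro power_mono norm_triangle_ineq norm_ge_zero)
    moreover have "0 \<le> (cmod (f x) - cmod (g x))\<^sup>2" by simp
    ultimately show ?thesis by (simp add: power2_diff power2_sum)
  qed
  then show "AE x in M. norm ((cmod (f x + g x))\<^sup>2) \<le> norm (2 * (cmod (f x))\<^sup>2 + 2 * (cmod (g x))\<^sup>2)" by simp
qed

locale measurable_domain =
  fixes \<Omega> :: "(real^'n::finite) set"
  assumes meas: "\<Omega> \<in> sets lebesgue"
begin

lemma L2D:
  assumes "f \<in> L2 \<Omega>"
  shows "integrable lebesgue (\<lambda>x. (cmod (rep_ae_fun f x))\<^sup>2)" "AE x in lebesgue. x \<notin> \<Omega> \<longrightarrow> rep_ae_fun f x = 0"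
  using assms by (simp_all add: L2_iff[OF meas])

lemma L2_inner_eq:
  assumes "f \<in> L2 \<Omega>"
  shows "L2_inner \<Omega> f g = (LINT x|lebesgue. rep_ae_fun f x * cnj (rep_ae_fun g x))"
  unfolding L2_inner_def
proof (rule set_integral_eq_integral[OF meas])
  have "(\<lambda>x. cnj (rep_ae_fun g x)) \<in> borel_measurable lebesgue"
    by (rule borel_measurable_continuous_on[OF _ rep_ae_fun_measurable]) (intro continuous_intros)
  then show "(\<lambda>x. rep_ae_fun f x * cnj (rep_ae_fun g x)) \<in> borel_measurable lebesgue" by measurable
  show "AE x in lebesgue. x \<notin> \<Omega> \<longrightarrow> rep_ae_fun f x * cnj (rep_ae_fun g x) = 0"
    using L2D(2)[OF assms] by eventually_elim simp
qed

lemma L2_integrable_mult: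
  "f \<in> L2 \<Omega> \<Longrightarrow> g \<in> L2 \<Omega> \<Longrightarrow> integrable lebesgue (\<lambda>x. rep_ae_fun f x * cnj (rep_ae_fun g x))"
  by (intro integrable_mult_of_square_integrable L2D) simp_all

lemma L2_subspace: "csubspace (L2 \<Omega>)"
  unfolding csubspace_def
proof (intro conjI ballI allI)
  show "0 \<in> L2 \<Omega>"
  proof -
    have "integrable lebesgue (\<lambda>x. (cmod (rep_ae_fun (0::'n ae_fun) x))\<^sup>2) \<longleftrightarrow> integrable lebesgue (\<lambda>x::real^'n. 0::real)"
    proof (rule integrable_cong_AE)
      show "AE x in lebesgue. (cmod (rep_ae_fun (0::'n ae_fun) x))\<^sup>2 = 0"
        using AE_rep_zero by eventually_elim simp
    qed measurable
    moreover have "AE x in lebesgue. x \<notin> \<Omega> \<longrightarrow> rep_ae_fun (0::'n ae_fun) x = 0"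
      using AE_rep_zero by eventually_elim simp
    ultimately show ?thesis by (simp add: L2_iff[OF meas])
  qed
  show "f + g \<in> L2 \<Omega>" if f: "f \<in> L2 \<Omega>" and g: "g \<in> L2 \<Omega>" for f g
  proof -
    have "integrable lebesgue (\<lambda>x. (cmod (rep_ae_fun (f + g) x))\<^sup>2) \<longleftrightarrow>
        integrable lebesgue (\<lambda>x. (cmod (rep_ae_fun f x + rep_ae_fun g x))\<^sup>2)"
    proof (rule integrable_cong_AE)
      show "AE x in lebesgue. (cmod (rep_ae_fun (f + g) x))\<^sup>2 = (cmod (rep_ae_fun f x + rep_ae_fun g x))\<^sup>2"
        using AE_rep_add[of f g] by eventually_elim simp
    qed measurable
    moreover have "integrable lebesgue (\<lambda>x. (cmod (rep_ae_fun f x + rep_ae_fun g x))\<^sup>2)"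
      by (rule square_integrable_add[OF rep_ae_fun_measurable rep_ae_fun_measurable L2D(1)[OF f] L2D(1)[OF g]])
    moreover have "AE x in lebesgue. x \<notin> \<Omega> \<longrightarrow> rep_ae_fun (f + g) x = 0"
      using AE_rep_add[of f g] L2D(2)[OF f] L2D(2)[OF g] by eventually_elim simp
    ultimately show ?thesis by (simp add: L2_iff[OF meas])
  qed
  show "c *\<^sub>C f \<in> L2 \<Omega>" if f: "f \<in> L2 \<Omega>" for c f
  proof -
    have "integrable lebesgue (\<lambda>x. (cmod (rep_ae_fun (c *\<^sub>C f) x))\<^sup>2) \<longleftrightarrow>
        integrable lebesgue (\<lambda>x. (cmod c)\<^sup>2 * (cmod (rep_ae_fun f x))\<^sup>2)"
    proof (rule integrable_cong_AE)
      show "AE x in lebesgue. (cmod (rep_ae_fun (c *\<^sub>C f) x))\<^sup>2 = (cmod c)\<^sup>2 * (cmod (rep_ae_fun f x))\<^sup>2"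
        using AE_rep_scale[of c f] by eventually_elim (simp add: norm_mult power_mult_distrib)
    qed measurable
    moreover have "integrable lebesgue (\<lambda>x. (cmod c)\<^sup>2 * (cmod (rep_ae_fun f x))\<^sup>2)"
      using L2D(1)[OF f] by simp
    moreover have "AE x in lebesgue. x \<notin> \<Omega> \<longrightarrow> rep_ae_fun (c *\<^sub>C f) x = 0"
      using AE_rep_scale[of c f] L2D(2)[OF f] by eventually_elim simp
    ultimately show ?thesis by (simp add: L2_iff[OF meas])
  qed
qed

lemmas L2_closed = csubspaceD[OF L2_subspace]

lemma L2_inner_self: "f \<in> L2 \<Omega> \<Longrightarrow> Re (L2_inner \<Omega> f f) = (LINT x|lebesgue. (cmod (rep_ae_fun f x))\<^sup>2)"
proof -
  assume f: "f \<in> L2 \<Omega>"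
  have "L2_inner \<Omega> f f = (LINT x|lebesgue. complex_of_real ((cmod (rep_ae_fun f x))\<^sup>2))"
    unfolding L2_inner_eq[OF f] by (simp only: complex_norm_square)
  also have "\<dots> = complex_of_real (LINT x|lebesgue. (cmod (rep_ae_fun f x))\<^sup>2)"
    by (rule integral_complex_of_real)
  finally show ?thesis by simp
qed

lemma L2_semi_inner: "semi_inner (L2 \<Omega>) (L2_inner \<Omega>)"
proof
  show "csubspace (L2 \<Omega>)" by (rule L2_subspace)
  have cnj_meas: "(\<lambda>x. cnj (rep_ae_fun g x)) \<in> borel_measurable lebesgue" for g :: "'n ae_fun"
    by (rule borel_measurable_continuous_on[OF _ rep_ae_fun_measurable]) (intro continuous_intros)
  note [measurable] = cnj_meas
  show "L2_inner \<Omega> (f + g) h = L2_inner \<Omega> f h + L2_inner \<Omega> g h"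
    if f: "f \<in> L2 \<Omega>" and g: "g \<in> L2 \<Omega>" and h: "h \<in> L2 \<Omega>" for f g h
  proof -
    have "(LINT x|lebesgue. rep_ae_fun (f + g) x * cnj (rep_ae_fun h x))
      = (LINT x|lebesgue. rep_ae_fun f x * cnj (rep_ae_fun h x) + rep_ae_fun g x * cnj (rep_ae_fun h x))"
    proof (rule integral_cong_AE)
      show "AE x in lebesgue. rep_ae_fun (f + g) x * cnj (rep_ae_fun h x)
          = rep_ae_fun f x * cnj (rep_ae_fun h x) + rep_ae_fun g x * cnj (rep_ae_fun h x)"
        using AE_rep_add[of f g] by eventually_elim (simp add: distrib_right)
    qed measurable
    also have "\<dots> = L2_inner \<Omega> f h + L2_inner \<Omega> g h"
      unfolding L2_inner_eq[OF f] L2_inner_eq[OF g]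
      by (rule Bochner_Integration.integral_add[OF L2_integrable_mult[OF f h] L2_integrable_mult[OF g h]])
    finally show ?thesis by (simp add: L2_inner_eq[OF L2_closed(2)[OF f g]])
  qed
  show "L2_inner \<Omega> (c *\<^sub>C f) g = c * L2_inner \<Omega> f g" if f: "f \<in> L2 \<Omega>" and g: "g \<in> L2 \<Omega>" for f g c
  proof -
    have "(LINT x|lebesgue. rep_ae_fun (c *\<^sub>C f) x * cnj (rep_ae_fun g x))
      = (LINT x|lebesgue. c * (rep_ae_fun f x * cnj (rep_ae_fun g x)))"
    proof (rule integral_cong_AE)
      show "AE x in lebesgue. rep_ae_fun (c *\<^sub>C f) x * cnj (rep_ae_fun g x)
          = c * (rep_ae_fun f x * cnj (rep_ae_fun g x))"
        using AE_rep_scale[of c f] by eventually_elim simp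
    qed measurable
    also have "\<dots> = c * L2_inner \<Omega> f g" unfolding L2_inner_eq[OF f] by simp
    finally show ?thesis by (simp add: L2_inner_eq[OF L2_closed(3)[OF f]])
  qed
  show "L2_inner \<Omega> g f = cnj (L2_inner \<Omega> f g)" if f: "f \<in> L2 \<Omega>" and g: "g \<in> L2 \<Omega>" for f g
    unfolding L2_inner_eq[OF f] L2_inner_eq[OF g]
    using Bochner_Integration.integral_cnj[of lebesgue "\<lambda>x. rep_ae_fun f x * cnj (rep_ae_fun g x)"] by (simp add: mult.commute)
  show "0 \<le> Re (L2_inner \<Omega> f f)" if "f \<in> L2 \<Omega>" for f
    unfolding L2_inner_self[OF that] by simp
qed

end

sublocale measurable_domain \<subseteq> L2: semi_inner "L2 \<Omega>" "L2_inner \<Omega>"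
  by (rule L2_semi_inner)

context measurable_domain
begin

lemma L2_nrm_sq: "f \<in> L2 \<Omega> \<Longrightarrow> (L2.nrm f)\<^sup>2 = (LINT x|lebesgue. (cmod (rep_ae_fun f x))\<^sup>2)"
  by (simp add: L2.nrm_sq L2_inner_self)

lemma L2_nn_integral:
  "f \<in> L2 \<Omega> \<Longrightarrow> (\<integral>\<^sup>+x. ennreal ((cmod (rep_ae_fun f x))\<^sup>2) \<partial>lebesgue) = ennreal ((L2.nrm f)\<^sup>2)"
  by (simp add: L2_nrm_sq nn_integral_eq_integral[OF L2D(1)])

lemma L2_definite: "f \<in> L2 \<Omega> \<Longrightarrow> L2.nrm f = 0 \<Longrightarrow> f = 0"
proof -
  assume f: "f \<in> L2 \<Omega>" and "L2.nrm f = 0"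
  then have "(LINT x|lebesgue. (cmod (rep_ae_fun f x))\<^sup>2) = 0" using L2_nrm_sq[OF f] by simp
  then have "AE x in lebesgue. (cmod (rep_ae_fun f x))\<^sup>2 = 0"
    using integral_nonneg_eq_0_iff_AE[OF L2D(1)[OF f]] by simp
  then have "AE x in lebesgue. rep_ae_fun f x = rep_ae_fun 0 x"
    using AE_rep_zero by eventually_elim simp
  then show "f = 0" by (rule ae_fun_eqI)
qed

end

text \<open>The weighted terms are bounded, so \<open>cmod (d n)\<close> decays geometrically with
  ratio the square root of 1/2. The weight allows the convergence proof to use integrals of squares
  only; on a domain of infinite measure the increments themselves need not be integrable.\<close>

lemma summable_of_weighted_squares:
  fixes d :: "nat \<Rightarrow> complex"
  assumes "summable (\<lambda>n. 2 ^ n * (cmod (d n))\<^sup>2)"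
  shows "summable d"
proof -
  have "Bseq (\<lambda>n. 2 ^ n * (cmod (d n))\<^sup>2)"
    using summable_LIMSEQ_zero[OF assms] by (rule convergentI[THEN convergent_imp_Bseq])
  then obtain K where K: "0 < K" "\<And>n. norm (2 ^ n * (cmod (d n))\<^sup>2) \<le> K"
    by (auto elim: BseqE)
  define r where "r = sqrt (1/2 :: real)"
  have r: "0 < r" "r < 1" by (simp_all add: r_def)
  have "cmod (d n) \<le> sqrt K * r ^ n" for n
  proof -
    have "(cmod (d n))\<^sup>2 \<le> K * (1/2) ^ n"
      using K(2)[of n] by (simp add: field_simps)
    also have "\<dots> = (sqrt K * r ^ n)\<^sup>2"
    proof -
      have "(r ^ n)\<^sup>2 = (r\<^sup>2) ^ n" by (simp add: mult.commute flip: power_mult)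
      then show ?thesis using K(1) by (simp add: power_mult_distrib) (simp add: r_def)
    qed
    finally show ?thesis
      by (rule power2_le_imp_le) (use K(1) r(1) in simp)
  qed
  moreover have "summable (\<lambda>n. sqrt K * r ^ n)"
    by (rule summable_mult, rule summable_geometric) (use r in simp)
  ultimately show ?thesis
    using summable_comparison_test'[of "\<lambda>n. sqrt K * r ^ n" 0 d] by blast
qed

section \<open>Completeness of L^2\<close>

context semi_inner
begin

lemma Cauchy_fast_subseq:
  assumes "\<And>n. s n \<in> H" "\<And>e. 0 < e \<Longrightarrow> \<exists>N. \<forall>m\<ge>N. \<forall>n\<ge>N. nrm (s m - s n) < e"
  obtains k :: "nat \<Rightarrow> nat" where "strict_mono k" "\<And>n. nrm (s (k (Suc n)) - s (k n)) \<le> (1/2) ^ n"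
proof -
  obtain N where N: "\<And>j m n. N j \<le> m \<Longrightarrow> N j \<le> n \<Longrightarrow> nrm (s m - s n) < (1/2) ^ j"
  proof -
    have "\<forall>j::nat. \<exists>N. \<forall>m\<ge>N. \<forall>n\<ge>N. nrm (s m - s n) < (1/2) ^ j"
      by (intro allI assms(2)) simp
    then show ?thesis using that by metis
  qed
  define k where "k = rec_nat (N 0) (\<lambda>j a. Suc (a + N (Suc j)))"
  have k_Suc: "k (Suc j) = Suc (k j + N (Suc j))" for j by (simp add: k_def)
  have k_ge: "N j \<le> k j" for j by (cases j) (simp_all add: k_def)
  have mono: "strict_mono k" by (rule strict_monoI_Suc) (simp add: k_Suc)
  show thesis
  proof (rule that[OF mono])
    show "nrm (s (k (Suc n)) - s (k n)) \<le> (1/2) ^ n" for n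
      using N[of n "k (Suc n)" "k n"] k_ge[of n] k_Suc[of n] by simp
  qed
qed

end

context measurable_domain
begin

text \<open>The squared increments have integral at most \<open>(1/4) ^ n\<close>, so with the
  weight \<open>2 ^ n\<close> the integrals are still summable. Monotone convergence makes the
  weighted series of squares finite almost everywhere.\<close>

lemma AE_convergent_fast:
  assumes s: "\<And>n. s n \<in> L2 \<Omega>" and fast: "\<And>n. L2.nrm (s (Suc n) - s n) \<le> (1/2) ^ n"
  shows "AE x in lebesgue. convergent (\<lambda>n. rep_ae_fun (s n) x)"
proof -
  define d where "d n = s (Suc n) - s n" for n
  have d: "d n \<in> L2 \<Omega>" for n unfolding d_def by (rule L2_closed(5)[OF s s])
  define g where "g n x = ennreal (2 ^ n * (cmod (rep_ae_fun (d n) x))\<^sup>2)" for n x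
  have g_meas [measurable]: "g n \<in> borel_measurable lebesgue" for n unfolding g_def by measurable
  have g_int: "(\<integral>\<^sup>+x. g n x \<partial>lebesgue) \<le> ennreal ((1/2) ^ n)" for n
  proof -
    have "(\<integral>\<^sup>+x. g n x \<partial>lebesgue) = ennreal (2 ^ n) * (\<integral>\<^sup>+x. ennreal ((cmod (rep_ae_fun (d n) x))\<^sup>2) \<partial>lebesgue)"
      unfolding g_def by (subst nn_integral_cmult[symmetric]) (simp_all add: ennreal_mult)
    also have "\<dots> = ennreal (2 ^ n * (L2.nrm (d n))\<^sup>2)"
      by (simp add: L2_nn_integral[OF d] ennreal_mult)
    also have "\<dots> \<le> ennreal ((1/2) ^ n)"
    proof (rule ennreal_leI)
      have "(L2.nrm (d n))\<^sup>2 \<le> ((1/2) ^ n)\<^sup>2"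
        using fast[of n] L2.nrm_ge_0[OF d] by (intro power_mono) (simp_all add: d_def)
      then have "2 ^ n * (L2.nrm (d n))\<^sup>2 \<le> 2 ^ n * ((1/2) ^ n)\<^sup>2" by simp
      also have "\<dots> = (1/2) ^ n" by (simp add: power2_eq_square field_simps flip: power_mult_distrib)
      finally show "2 ^ n * (L2.nrm (d n))\<^sup>2 \<le> (1/2) ^ n" .
    qed
    finally show ?thesis .
  qed
  have "(\<integral>\<^sup>+x. (\<Sum>n. g n x) \<partial>lebesgue) = (\<Sum>n. \<integral>\<^sup>+x. g n x \<partial>lebesgue)"
    by (rule nn_integral_suminf) measurable
  also have "\<dots> \<le> (\<Sum>n. ennreal ((1/2) ^ n))"
    by (rule suminf_le[OF g_int]) auto
  also have "\<dots> < \<infinity>"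
    by (subst suminf_ennreal2) (auto intro: summable_geometric)
  finally have "(\<integral>\<^sup>+x. (\<Sum>n. g n x) \<partial>lebesgue) \<noteq> \<infinity>" by simp
  then have "AE x in lebesgue. (\<Sum>n. g n x) \<noteq> \<infinity>"
    by (rule nn_integral_noteq_infinite[rotated]) measurable
  moreover have "AE x in lebesgue. \<forall>n. rep_ae_fun (d n) x = rep_ae_fun (s (Suc n)) x - rep_ae_fun (s n) x"
    unfolding AE_all_countable d_def using AE_rep_diff by blast
  ultimately show ?thesis
  proof eventually_elim
    case (elim x)
    have "summable (\<lambda>n. 2 ^ n * (cmod (rep_ae_fun (d n) x))\<^sup>2)"
      using elim(1) unfolding g_def by (intro summable_suminf_not_top) (auto simp: top_ennreal_def)
    then have "summable (\<lambda>n. rep_ae_fun (s (Suc n)) x - rep_ae_fun (s n) x)"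
      using summable_of_weighted_squares elim(2) by simp
    then have "convergent (\<lambda>n. \<Sum>i<n. rep_ae_fun (s (Suc i)) x - rep_ae_fun (s i) x)"
      by (simp add: summable_iff_convergent)
    then have "convergent (\<lambda>n. rep_ae_fun (s n) x - rep_ae_fun (s 0) x)"
      unfolding sum_lessThan_telescope[of "\<lambda>n. rep_ae_fun (s n) x"] .
    then have "convergent (\<lambda>n. rep_ae_fun (s n) x - rep_ae_fun (s 0) x + rep_ae_fun (s 0) x)"
      by (intro convergent_add convergent_const)
    then show ?case by simp
  qed
qed

text \<open>Riesz-Fischer: a fast subsequence converges almost everywhere, and Fatou's lemma applied
  to \<open>s m - s (k n)\<close> for fixed \<open>m\<close> gives the distance from
  \<open>s m\<close> to the limit. This covers the whole sequence, and not merely the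
  subsequence.\<close>

lemma L2_complete:
  assumes s: "\<And>n::nat. s n \<in> L2 \<Omega>" and Cauchy: "\<And>e. 0 < e \<Longrightarrow> \<exists>N. \<forall>m\<ge>N. \<forall>n\<ge>N. L2.nrm (s m - s n) < e"
  shows "\<exists>l. L2.lim_in s l"
proof -
  obtain k where k: "strict_mono k" "\<And>n. L2.nrm (s (k (Suc n)) - s (k n)) \<le> (1/2) ^ n"
    using L2.Cauchy_fast_subseq[OF s Cauchy] by metis
  \<comment> \<open>\<open>lim\<close> has an unspecified value where the subsequence diverges, but
    this happens only on a null set.\<close>
  define F where "F x = lim (\<lambda>n. rep_ae_fun (s (k n)) x)" for x
  have F_meas: "F \<in> borel_measurable lebesgue"
    unfolding F_def by (rule borel_measurable_lim_metric) measurable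
  have conv: "AE x in lebesgue. (\<lambda>n. rep_ae_fun (s (k n)) x) \<longlonglongrightarrow> F x"
    using AE_convergent_fast[of "\<lambda>n. s (k n)", OF s k(2)]
    by eventually_elim (simp add: F_def convergent_LIMSEQ_iff)
  define l where "l = abs_ae_fun F"
  have l: "AE x in lebesgue. (\<lambda>n. rep_ae_fun (s (k n)) x) \<longlonglongrightarrow> rep_ae_fun l x"
    using conv AE_rep_abs_ae_fun[OF F_meas] unfolding l_def by eventually_elim simp
  have l_out: "AE x in lebesgue. x \<notin> \<Omega> \<longrightarrow> rep_ae_fun l x = 0"
  proof -
    have "AE x in lebesgue. \<forall>n. x \<notin> \<Omega> \<longrightarrow> rep_ae_fun (s (k n)) x = 0"
      unfolding AE_all_countable using L2D(2)[OF s] by blast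
    with l show ?thesis
    proof eventually_elim
      case (elim x)
      show ?case
      proof
        assume "x \<notin> \<Omega>"
        then have "(\<lambda>n. rep_ae_fun (s (k n)) x) = (\<lambda>n. 0)" using elim(2) by simp
        with elim(1) show "rep_ae_fun l x = 0" using LIMSEQ_unique[OF _ tendsto_const] by metis
      qed
    qed
  qed
  have fatou: "s m - l \<in> L2 \<Omega> \<and> L2.nrm (s m - l) \<le> e"
    if e: "0 < e" and N: "\<forall>m\<ge>N. \<forall>n\<ge>N. L2.nrm (s m - s n) < e" and m: "N \<le> m" for e N m
  proof -
    define h where "h n x = ennreal ((cmod (rep_ae_fun (s m - s (k n)) x))\<^sup>2)" for n x
    define h' where "h' x = ennreal ((cmod (rep_ae_fun (s m - l) x))\<^sup>2)" for x
    have [measurable]: "h n \<in> borel_measurable lebesgue" for n unfolding h_def by measurable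
    have "AE x in lebesgue. \<forall>n. rep_ae_fun (s m - s (k n)) x = rep_ae_fun (s m) x - rep_ae_fun (s (k n)) x"
      unfolding AE_all_countable using AE_rep_diff by blast
    then have "AE x in lebesgue. h' x = liminf (\<lambda>n. h n x)"
      using l AE_rep_diff[of "s m" l]
    proof eventually_elim
      case (elim x)
      have "(\<lambda>n. h n x) \<longlonglongrightarrow> h' x"
        unfolding h_def h'_def elim(3) using elim(1,2)
        by (auto intro!: tendsto_ennrealI tendsto_power tendsto_norm tendsto_diff)
      then show ?case by (simp add: lim_imp_Liminf)
    qed
    then have "(\<integral>\<^sup>+x. h' x \<partial>lebesgue) = (\<integral>\<^sup>+x. liminf (\<lambda>n. h n x) \<partial>lebesgue)"
      by (rule nn_integral_cong_AE)
    also have "\<dots> \<le> liminf (\<lambda>n. \<integral>\<^sup>+x. h n x \<partial>lebesgue)"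
      by (rule nn_integral_liminf) measurable
    also have "\<dots> \<le> ennreal (e\<^sup>2)"
    proof -
      have "(\<integral>\<^sup>+x. h n x \<partial>lebesgue) \<le> ennreal (e\<^sup>2)" if n: "N \<le> n" for n
      proof -
        have kn: "N \<le> k n" using seq_suble[OF k(1), of n] n by simp
        have dl: "s m - s (k n) \<in> L2 \<Omega>" by (rule L2_closed(5)[OF s s])
        have "(\<integral>\<^sup>+x. h n x \<partial>lebesgue) = ennreal ((L2.nrm (s m - s (k n)))\<^sup>2)"
          unfolding h_def by (rule L2_nn_integral[OF dl])
        also have "\<dots> \<le> ennreal (e\<^sup>2)"
          using N m kn L2.nrm_ge_0[OF dl] by (intro ennreal_leI power_mono) (auto intro: less_imp_le)
        finally show ?thesis .
      qed
      then have "\<forall>\<^sub>F n in sequentially. (\<integral>\<^sup>+x. h n x \<partial>lebesgue) \<le> ennreal (e\<^sup>2)"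
        unfolding eventually_sequentially by blast
      then have "liminf (\<lambda>n. \<integral>\<^sup>+x. h n x \<partial>lebesgue) \<le> liminf (\<lambda>n. ennreal (e\<^sup>2))"
        by (rule Liminf_mono)
      then show ?thesis by (simp add: Liminf_const)
    qed
    finally have le: "(\<integral>\<^sup>+x. h' x \<partial>lebesgue) \<le> ennreal (e\<^sup>2)" .
    have "integrable lebesgue (\<lambda>x. (cmod (rep_ae_fun (s m - l) x))\<^sup>2)"
    proof (rule integrableI_bounded)
      show "(\<integral>\<^sup>+x. ennreal (norm ((cmod (rep_ae_fun (s m - l) x))\<^sup>2)) \<partial>lebesgue) < \<infinity>"
        using le_less_trans[OF le, of "\<infinity>"] by (simp add: h'_def)
    qed measurable
    moreover have "AE x in lebesgue. x \<notin> \<Omega> \<longrightarrow> rep_ae_fun (s m - l) x = 0"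
      using AE_rep_diff[of "s m" l] L2D(2)[OF s[of m]] l_out by eventually_elim simp
    ultimately have mem: "s m - l \<in> L2 \<Omega>" by (simp add: L2_iff[OF meas])
    then have "ennreal ((L2.nrm (s m - l))\<^sup>2) \<le> ennreal (e\<^sup>2)"
      using le L2_nn_integral[OF mem] by (simp add: h'_def)
    then have "L2.nrm (s m - l) \<le> e"
      using e L2.nrm_ge_0[OF mem] by (simp add: power2_le_iff_abs_le)
    with mem show ?thesis by blast
  qed
  obtain N where N: "\<forall>m\<ge>N. \<forall>n\<ge>N. L2.nrm (s m - s n) < 1" using Cauchy[of 1] by auto
  have "s N - (s N - l) \<in> L2 \<Omega>"
    using fatou[OF zero_less_one N order_refl] L2_closed(5)[OF s] by blast
  then have lL: "l \<in> L2 \<Omega>" by simp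
  have "(\<lambda>n. L2.nrm (s n - l)) \<longlonglongrightarrow> 0"
  proof (rule LIMSEQ_I)
    fix r :: real assume r: "0 < r"
    obtain N where N: "\<forall>m\<ge>N. \<forall>n\<ge>N. L2.nrm (s m - s n) < r / 2" using Cauchy[of "r / 2"] r by auto
    have "norm (L2.nrm (s n - l) - 0) < r" if "N \<le> n" for n
      using fatou[OF _ N that] r L2.nrm_ge_0[OF L2_closed(5)[OF s lL], of n] by simp
    then show "\<exists>no. \<forall>n\<ge>no. norm (L2.nrm (s n - l) - 0) < r" by blast
  qed
  then show ?thesis unfolding L2.lim_in_def using s lL by blast
qed

end

section \<open>Smooth functions and test functions\<close>

text \<open>The factor \<open>1 / t ^ m\<close> makes the family closed under differentiation up to linear combinations.\<close>

definition flat_exp :: "nat \<Rightarrow> real \<Rightarrow> real" where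
  "flat_exp m t = (if t > 0 then exp (- 1 / t) / t ^ m else 0)"

lemma flat_exp_tendsto_0: "(flat_exp m \<longlongrightarrow> 0) (at 0)"
proof -
  have "((\<lambda>t::real. inverse t ^ m / exp (inverse t)) \<longlongrightarrow> 0) (at_right 0)"
    by (rule filterlim_compose[OF tendsto_power_div_exp_0 filterlim_inverse_at_top_right])
  moreover have "\<forall>\<^sub>F t in at_right 0. inverse t ^ m / exp (inverse t) = flat_exp m t"
    unfolding eventually_at_right_field
    by (rule exI[of _ 1]) (simp add: flat_exp_def exp_minus field_simps)
  ultimately have right: "(flat_exp m \<longlongrightarrow> 0) (at_right 0)"
    by (rule Lim_transform_eventually)
  have "\<forall>\<^sub>F t in at_left 0. 0 = flat_exp m t"
    unfolding eventually_at_left_field by (rule exI[of _ "-1"]) (simp add: flat_exp_def)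
  then have "(flat_exp m \<longlongrightarrow> 0) (at_left 0)"
    by (rule Lim_transform_eventually[OF tendsto_const])
  with right show ?thesis by (simp add: filterlim_at_split)
qed

lemma flat_exp_has_derivative:
  "(flat_exp m has_real_derivative flat_exp (m + 2) t - real m * flat_exp (m + 1) t) (at t)"
proof -
  consider "t > 0" | "t < 0" | "t = 0" by linarith
  then show ?thesis
  proof cases
    case 1
    have "((\<lambda>t. exp (- 1 / t) * inverse (t ^ m)) has_real_derivative
        flat_exp (m + 2) t - real m * flat_exp (m + 1) t) (at t)"
    proof (cases m)
      case 0
      then show ?thesis using 1
        by (auto intro!: derivative_eq_intros simp: flat_exp_def field_simps power2_eq_square)
    next
      case (Suc k)
      show ?thesis using 1 unfolding Suc
        by (auto intro!: derivative_eq_intros simp: flat_exp_def field_simps power2_eq_square) (cases k; simp)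
    qed
    then show ?thesis
    proof (rule DERIV_cong_ev[THEN iffD1, OF refl _ refl, rotated])
      show "\<forall>\<^sub>F x in nhds t. exp (- 1 / x) * inverse (x ^ m) = flat_exp m x"
        using eventually_nhds_in_open[of "{0<..}" t] 1
        by (auto elim!: eventually_mono simp: flat_exp_def field_simps)
    qed
  next
    case 2
    have "((\<lambda>t. 0) has_real_derivative flat_exp (m + 2) t - real m * flat_exp (m + 1) t) (at t)"
      using 2 by (simp add: flat_exp_def)
    then show ?thesis
    proof (rule DERIV_cong_ev[THEN iffD1, OF refl _ refl, rotated])
      show "\<forall>\<^sub>F x in nhds t. 0 = flat_exp m x"
        using eventually_nhds_in_open[of "{..<0}" t] 2
        by (auto elim!: eventually_mono simp: flat_exp_def)
    qed
  next
    case 3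
    \<comment> \<open>At 0 the difference quotient of one member of the family is the next member,
      so the limit at 0 of the whole family yields all derivatives there.\<close>
    have "flat_exp m h / h = flat_exp (Suc m) h" if "h \<noteq> 0" for h
      using that by (simp add: flat_exp_def)
    then have "\<forall>\<^sub>F h in at 0. flat_exp (Suc m) h = (flat_exp m (0 + h) - flat_exp m 0) / h"
      unfolding eventually_at_filter by (intro always_eventually) (simp add: flat_exp_def)
    then have "((\<lambda>h. (flat_exp m (0 + h) - flat_exp m 0) / h) \<longlongrightarrow> 0) (at 0)"
      by (rule Lim_transform_eventually[OF flat_exp_tendsto_0])
    then show ?thesis unfolding 3 DERIV_def by (simp add: flat_exp_def)
  qed
qed

lemma flat_exp_0_bounds: "0 \<le> flat_exp 0 t" "flat_exp 0 t \<le> 1"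
  by (simp_all add: flat_exp_def)

lemma flat_exp_scaled_tendsto:
  "(\<lambda>n. flat_exp 0 (real (Suc n) * t)) \<longlonglongrightarrow> (if t > 0 then 1 else 0)"
proof (cases "t > 0")
  case True
  have "(\<lambda>n. exp (- 1 / t * inverse (real (Suc n)))) \<longlonglongrightarrow> exp (- 1 / t * 0)"
    by (intro tendsto_exp tendsto_mult_left LIMSEQ_inverse_real_of_nat)
  moreover have "flat_exp 0 (real (Suc n) * t) = exp (- 1 / t * inverse (real (Suc n)))" for n
  proof -
    have "0 < real (Suc n) * t" using True by (intro mult_pos_pos) simp_all
    then show ?thesis by (simp add: flat_exp_def field_simps)
  qed
  ultimately show ?thesis using True by simp
next
  case False
  have "flat_exp 0 (real (Suc n) * t) = 0" for n
    using False by (simp add: flat_exp_def zero_less_mult_iff)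
  then show ?thesis using False by simp
qed

text \<open>A syntactic class that contains all test functions constructed here and is closed under
  partial derivatives; being \<open>C_k\<close> for every \<open>k\<close> then follows by one
  induction. The \<open>osc\<close> case provides the modulation used to make gradients
  large.\<close>

inductive smooth_fun :: "(real^'n::finite \<Rightarrow> complex) \<Rightarrow> bool" where
  const: "smooth_fun (\<lambda>x. c)"
| flat: "smooth_fun (\<lambda>x. of_real (flat_exp m (a * x $ i + b)))"
| osc: "smooth_fun (\<lambda>x. cis (k * x $ i))"
| add: "smooth_fun f \<Longrightarrow> smooth_fun g \<Longrightarrow> smooth_fun (\<lambda>x. f x + g x)"
| mult: "smooth_fun f \<Longrightarrow> smooth_fun g \<Longrightarrow> smooth_fun (\<lambda>x. f x * g x)"

lemma smooth_fun_prod: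
  assumes "finite I" "\<And>i. i \<in> I \<Longrightarrow> smooth_fun (f i)"
  shows "smooth_fun (\<lambda>x. \<Prod>i\<in>I. f i x)"
  using assms by (induction I rule: finite_induct) (auto intro: smooth_fun.const smooth_fun.mult)

lemma smooth_fun_derivative:
  fixes f :: "real^'n::finite \<Rightarrow> complex"
  assumes "smooth_fun f"
  shows "\<exists>D. (\<forall>x. (f has_derivative D x) (at x)) \<and> (\<forall>j. smooth_fun (\<lambda>x. D x (axis j 1)))"
  using assms
proof induction
  case (const c)
  show ?case by (rule exI[of _ "\<lambda>x h. 0"]) (auto intro: smooth_fun.const)
next
  case (flat m a i b)
  define e where "e t = flat_exp (m + 2) t - real m * flat_exp (m + 1) t" for t
  show ?case
  proof (intro exI[of _ "\<lambda>x h. complex_of_real (e (a * x $ i + b) * (a * h $ i))"] conjI allI)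
    fix x :: "real^'n"
    have "((\<lambda>x. a * x $ i + b) has_derivative (\<lambda>h. a * h $ i)) (at x)"
      by (auto intro!: derivative_eq_intros bounded_linear.has_derivative[OF bounded_linear_vec_nth])
    moreover have "(flat_exp m has_derivative (\<lambda>h. e (a * x $ i + b) * h)) (at (a * x $ i + b))"
      using flat_exp_has_derivative[of m "a * x $ i + b"] by (simp add: has_field_derivative_def e_def)
    ultimately have "((\<lambda>x. flat_exp m (a * x $ i + b)) has_derivative (\<lambda>h. e (a * x $ i + b) * (a * h $ i))) (at x)"
      by (rule has_derivative_compose)
    then show "((\<lambda>x. complex_of_real (flat_exp m (a * x $ i + b))) has_derivative
        (\<lambda>h. complex_of_real (e (a * x $ i + b) * (a * h $ i)))) (at x)"
      by (rule has_derivative_of_real)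
  next
    fix j
    have "smooth_fun (\<lambda>x::real^'n. (complex_of_real (flat_exp (m + 2) (a * x $ i + b)) +
        (- of_nat m) * complex_of_real (flat_exp (m + 1) (a * x $ i + b))) * of_real (a * axis j 1 $ i))"
      by (intro smooth_fun.mult smooth_fun.add smooth_fun.flat smooth_fun.const)
    then show "smooth_fun (\<lambda>x::real^'n. complex_of_real (e (a * x $ i + b) * (a * axis j 1 $ i)))"
      by (simp add: e_def)
  qed
next
  case (osc k i)
  show ?case
  proof (intro exI[of _ "\<lambda>x h. (k * h $ i) *\<^sub>R (\<i> * cis (k * x $ i))"] conjI allI)
    fix x :: "real^'n"
    have "((\<lambda>x. k * x $ i) has_derivative (\<lambda>h. k * h $ i)) (at x)"
      by (auto intro!: derivative_eq_intros bounded_linear.has_derivative[OF bounded_linear_vec_nth])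
    then show "((\<lambda>x. cis (k * x $ i)) has_derivative (\<lambda>h. (k * h $ i) *\<^sub>R (\<i> * cis (k * x $ i)))) (at x)"
      by (rule has_derivative_cis)
  next
    fix j
    have "smooth_fun (\<lambda>x::real^'n. (of_real (k * axis j 1 $ i) * \<i>) * cis (k * x $ i))"
      by (intro smooth_fun.mult smooth_fun.osc smooth_fun.const)
    then show "smooth_fun (\<lambda>x::real^'n. (k * axis j 1 $ i) *\<^sub>R (\<i> * cis (k * x $ i)))"
      by (simp add: scaleR_conv_of_real mult.assoc)
  qed
next
  case (add f g)
  then obtain D E where D: "\<And>x. (f has_derivative D x) (at x)" "\<And>j. smooth_fun (\<lambda>x. D x (axis j 1))"
    and E: "\<And>x. (g has_derivative E x) (at x)" "\<And>j. smooth_fun (\<lambda>x. E x (axis j 1))" by metis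
  show ?case
    by (rule exI[of _ "\<lambda>x h. D x h + E x h"]) (auto intro: has_derivative_add D E smooth_fun.add)
next
  case (mult f g)
  then obtain D E where D: "\<And>x. (f has_derivative D x) (at x)" "\<And>j. smooth_fun (\<lambda>x. D x (axis j 1))"
    and E: "\<And>x. (g has_derivative E x) (at x)" "\<And>j. smooth_fun (\<lambda>x. E x (axis j 1))" by metis
  show ?case
  proof (intro exI[of _ "\<lambda>x h. f x * E x h + D x h * g x"] conjI allI)
    show "((\<lambda>x. f x * g x) has_derivative (\<lambda>h. f x * E x h + D x h * g x)) (at x)" for x
      by (rule has_derivative_mult[OF D(1) E(1)])
    show "smooth_fun (\<lambda>x. f x * E x (axis j 1) + D x (axis j 1) * g x)" for j
      by (rule smooth_fun.add[OF smooth_fun.mult[OF mult.hyps(1) E(2)] smooth_fun.mult[OF D(2) mult.hyps(2)]])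
  qed
qed

lemma has_derivative_pderiv_at:
  "(f has_derivative D) (at x) \<Longrightarrow> pderiv_at j f x = D (axis j 1)"
  unfolding pderiv_at_def using frechet_derivative_at by metis

lemma smooth_fun_differentiable: "smooth_fun f \<Longrightarrow> f differentiable (at x)"
  using smooth_fun_derivative unfolding differentiable_def by blast

lemma smooth_fun_pderiv: "smooth_fun f \<Longrightarrow> smooth_fun (pderiv_at j f)"
proof -
  assume "smooth_fun f"
  then obtain D where D: "\<And>x. (f has_derivative D x) (at x)" "smooth_fun (\<lambda>x. D x (axis j 1))"
    using smooth_fun_derivative by blast
  have "pderiv_at j f = (\<lambda>x. D x (axis j 1))"
    using has_derivative_pderiv_at[OF D(1)] by blast
  then show ?thesis using D(2) by simp
qed

lemma smooth_fun_C_k: "smooth_fun f \<Longrightarrow> C_k k f"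
proof (induction k arbitrary: f)
  case 0
  then show ?case
    by (simp add: continuous_on_eq_continuous_within smooth_fun_differentiable differentiable_imp_continuous_within)
next
  case (Suc k)
  then show ?case by (simp add: smooth_fun_differentiable smooth_fun_pderiv)
qed

lemma test_functionI:
  assumes "smooth_fun \<phi>" "{x. \<phi> x \<noteq> 0} \<subseteq> cbox a b" "cbox a b \<subseteq> \<Omega>"
  shows "test_function \<Omega> \<phi>"
proof -
  have "closure {x. \<phi> x \<noteq> 0} \<subseteq> cbox a b"
    by (rule closure_minimal[OF assms(2) closed_cbox])
  moreover have "compact (closure {x. \<phi> x \<noteq> 0})"
    using compact_closure bounded_subset[OF bounded_cbox assms(2)] by blast
  ultimately show ?thesis
    unfolding test_function_def using smooth_fun_C_k[OF assms(1)] assms(3) by blast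
qed

text \<open>A product over the coordinates that is nonzero exactly in the open box. The dilation by
  \<open>Suc n\<close> makes the values tend to the indicator of the box as \<open>n\<close>
  grows.\<close>

definition box_bump :: "nat \<Rightarrow> real^'n \<Rightarrow> real^'n \<Rightarrow> real^'n \<Rightarrow> complex" where
  "box_bump n a b x = (\<Prod>i\<in>UNIV. of_real (flat_exp 0 (real (Suc n) * (x $ i - a $ i))) *
     of_real (flat_exp 0 (real (Suc n) * (b $ i - x $ i))))"

lemma box_bump_smooth:
  fixes a b :: "real^'n::finite"
  shows "smooth_fun (box_bump n a b)"
proof -
  have 1: "smooth_fun (\<lambda>x. of_real (flat_exp 0 (real (Suc n) * (x $ i - a $ i))))" for i :: 'n
    using smooth_fun.flat[of 0 "real (Suc n)" i "- real (Suc n) * a $ i"] by (simp add: algebra_simps)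
  have 2: "smooth_fun (\<lambda>x. of_real (flat_exp 0 (real (Suc n) * (b $ i - x $ i))))" for i :: 'n
    using smooth_fun.flat[of 0 "- real (Suc n)" i "real (Suc n) * b $ i"] by (simp add: algebra_simps)
  show ?thesis
    unfolding box_bump_def[abs_def] by (rule smooth_fun_prod) (simp, rule smooth_fun.mult[OF 1 2])
qed

lemma box_bump_nonzero_iff: "box_bump n a b x \<noteq> 0 \<longleftrightarrow> x \<in> box a b"
  by (simp add: box_bump_def flat_exp_def mem_box_cart zero_less_mult_iff)
    (auto simp: not_less)

lemma box_bump_norm_le: "cmod (box_bump n a b x) \<le> 1"
  unfolding box_bump_def prod_norm[symmetric]
  by (rule prod_le_1) (auto simp: norm_mult flat_exp_0_bounds intro!: mult_le_one)

lemma box_bump_tendsto: "(\<lambda>n. box_bump n a b x) \<longlonglongrightarrow> indicator (box a b) x"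
proof -
  have "(\<lambda>n. box_bump n a b x) \<longlonglongrightarrow> (\<Prod>i\<in>UNIV. of_real (if x $ i - a $ i > 0 then 1 else 0) *
      of_real (if b $ i - x $ i > 0 then 1 else 0))"
    unfolding box_bump_def
    by (intro tendsto_prod tendsto_mult tendsto_of_real flat_exp_scaled_tendsto)
  also have "(\<Prod>i\<in>UNIV. of_real (if x $ i - a $ i > 0 then 1 else 0) *
      of_real (if b $ i - x $ i > 0 then 1 else 0)) = (indicator (box a b) x :: complex)"
    by (auto simp: indicator_def mem_box_cart)
  finally show ?thesis .
qed

lemma box_bump_test_function: "cbox a b \<subseteq> \<Omega> \<Longrightarrow> test_function \<Omega> (box_bump n a b)"
  by (rule test_functionI[OF box_bump_smooth]) (auto simp: box_bump_nonzero_iff box_subset_cbox[THEN subsetD])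

section \<open>The fundamental lemma of the calculus of variations\<close>

lemma sigma_finite_lebesgue: "sigma_finite_measure (lebesgue :: 'a::euclidean_space measure)"
proof
  obtain A :: "'a set set" where A: "countable A" "A \<subseteq> sets lborel" "\<Union>A = space lborel" "\<forall>a\<in>A. emeasure lborel a \<noteq> \<infinity>"
    using lborel.sigma_finite_countable by blast
  show "\<exists>A::'a set set. countable A \<and> A \<subseteq> sets lebesgue \<and> \<Union>A = space lebesgue \<and> (\<forall>a\<in>A. emeasure lebesgue a \<noteq> \<infinity>)"
    using A by (intro exI[of _ A]) (auto simp: emeasure_completion main_part_sets)
qed

text \<open>Open boxes are stable under intersection and generate the Borel sets, and the sets over
  which \<open>h\<close> integrates to 0 form a Dynkin system; complements are covered by
  \<open>total\<close>. A Lebesgue set differs from a Borel set by a null set, so all integrals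
  vanish and with them \<open>h\<close>.\<close>

lemma AE_zero_of_box_integrals:
  fixes h :: "real^'n::finite \<Rightarrow> complex"
  assumes h: "integrable lebesgue h" and total: "integral\<^sup>L lebesgue h = 0"
    and boxes: "\<And>a b. (LINT x:box a b|lebesgue. h x) = 0"
  shows "AE x in lebesgue. h x = 0"
proof -
  interpret sigma_finite_measure "lebesgue :: (real^'n) measure" by (rule sigma_finite_lebesgue)
  have set_int: "set_integrable lebesgue A h" if "A \<in> sets lebesgue" for A
    unfolding set_integrable_def using integrable_mult_indicator[OF that h] .
  have borel: "(LINT x:A|lebesgue. h x) = 0" if "A \<in> sets borel" for A
  proof -
    let ?G = "range (\<lambda>(a, b). box a b :: (real^'n) set)"
    have A: "A \<in> sigma_sets UNIV ?G" using that unfolding borel_eq_box by simp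
    have "sigma_sets UNIV ?G = sets borel" unfolding borel_eq_box by simp
    then have sigma_leb: "B \<in> sets lebesgue" if "B \<in> sigma_sets UNIV ?G" for B
      using that sets_completionI_sets[of B lborel] by simp
    have st: "Int_stable ?G"
      unfolding Int_stable_def by (auto simp: box_Int_box)
    have sub: "?G \<subseteq> Pow UNIV" by simp
    show ?thesis
      using st sub A
    proof (induction rule: sigma_sets_induct_disjoint)
      case (basic B)
      then show ?case using boxes by auto
    next
      case empty
      show ?case by (simp add: set_lebesgue_integral_def)
    next
      case (compl B)
      have B: "B \<in> sets lebesgue" by (rule sigma_leb[OF compl(1)])
      then have "UNIV - B \<in> sets lebesgue" using sets.compl_sets[of B lebesgue] by simp
      then have "(LINT x:B \<union> (UNIV - B)|lebesgue. h x) = (LINT x:B|lebesgue. h x) + (LINT x:UNIV - B|lebesgue. h x)"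
        by (intro set_integral_Un set_int[OF B] set_int) auto
      then show ?case using compl(2) total by (simp add: set_lebesgue_integral_def)
    next
      case (union B)
      have "(LINT x:(\<Union>i. B i)|lebesgue. h x) = (\<Sum>i. (LINT x:B i|lebesgue. h x))"
      proof (rule lebesgue_integral_countable_add)
        show Bi: "B i \<in> sets lebesgue" for i using union(2) sigma_leb[of "B i"] by blast
        show "B i \<inter> B j = {}" if "i \<noteq> j" for i j using union(1) that by (auto simp: disjoint_family_on_def)
        show "set_integrable lebesgue (\<Union>i. B i) h" using Bi by (intro set_int) auto
      qed
      then show ?case using union(3) by simp
    qed
  qed
  show ?thesis
  proof (rule density_zero[OF h])
    fix A :: "(real^'n) set" assume A: "A \<in> sets lebesgue"
    then obtain S N N' where S: "A = S \<union> N" "N \<subseteq> N'" "N' \<in> null_sets lborel" "S \<in> sets lborel"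
      by (rule sets_completionE)
    have SL: "S \<in> sets lebesgue" using S(4) by simp
    have N': "AE x in lebesgue. x \<notin> N'" using S(3) by (intro AE_not_in null_sets_completionI)
    have "(LINT x:A|lebesgue. h x) = (LINT x:S|lebesgue. h x)"
      unfolding set_lebesgue_integral_def
    proof (rule integral_cong_AE)
      show "(\<lambda>x. indicator A x *\<^sub>R h x) \<in> borel_measurable lebesgue"
        using integrable_mult_indicator[OF A h] by simp
      show "(\<lambda>x. indicator S x *\<^sub>R h x) \<in> borel_measurable lebesgue"
        using integrable_mult_indicator[OF SL h] by simp
      show "AE x in lebesgue. indicator A x *\<^sub>R h x = indicator S x *\<^sub>R h x"
        using N' by eventually_elim (use S(1,2) in \<open>auto simp: indicator_def\<close>)
    qed
    then show "(LINT x:A|lebesgue. h x) = 0" using borel S(4) by simp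
  qed
qed

lemma test_function_continuous: "test_function \<Omega> \<phi> \<Longrightarrow> continuous_on UNIV \<phi>"
  unfolding test_function_def using C_k.simps(1) by blast

lemma continuous_lebesgue_measurable:
  fixes \<phi> :: "real^'n::finite \<Rightarrow> complex"
  assumes "continuous_on UNIV \<phi>"
  shows "\<phi> \<in> borel_measurable lebesgue"
  by (rule measurable_completion) (use borel_measurable_continuous_onI[OF assms] in simp)

context measurable_domain
begin

lemma box_integral_zero:
  assumes f: "f \<in> L2 \<Omega>" and sub: "cbox a b \<subseteq> \<Omega>"
    and zero: "\<And>\<phi>. test_function \<Omega> \<phi> \<Longrightarrow> (LINT x|lebesgue. rep_ae_fun f x * \<phi> x) = 0"
  shows "(LINT x:box a b|lebesgue. rep_ae_fun f x) = 0"
    and "set_integrable lebesgue (box a b) (rep_ae_fun f)"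
proof -
  \<comment> \<open>The dominating function: \<open>cmod (rep_ae_fun f x)\<close> is at most its
    square plus 1, and the box has finite measure.\<close>
  define w where "w x = indicator (box a b) x *\<^sub>R ((cmod (rep_ae_fun f x))\<^sup>2 + 1)" for x
  have w_int: "integrable lebesgue w"
  proof -
    have "integrable lebesgue (\<lambda>x. indicator (box a b) x *\<^sub>R (cmod (rep_ae_fun f x))\<^sup>2)"
      by (rule integrable_mult_indicator[OF _ L2D(1)[OF f]]) simp
    moreover have "integrable lebesgue (indicator (box a b) :: _ \<Rightarrow> real)"
      by (rule integrable_real_indicator) (auto simp: emeasure_lborel_box_eq)
    ultimately have "integrable lebesgue (\<lambda>x. indicator (box a b) x *\<^sub>R (cmod (rep_ae_fun f x))\<^sup>2 + indicator (box a b) x)"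
      by (rule Bochner_Integration.integrable_add)
    then show ?thesis unfolding w_def by (simp add: algebra_simps)
  qed
  have bound: "cmod (rep_ae_fun f x) \<le> (cmod (rep_ae_fun f x))\<^sup>2 + 1" for x
  proof -
    have "0 \<le> (cmod (rep_ae_fun f x) - 1)\<^sup>2" by simp
    then have "2 * cmod (rep_ae_fun f x) \<le> (cmod (rep_ae_fun f x))\<^sup>2 + 1" by (simp add: power2_diff)
    then show ?thesis using norm_ge_zero[of "rep_ae_fun f x"] by linarith
  qed
  have bump_meas: "box_bump n a b \<in> borel_measurable lebesgue" for n
    by (rule continuous_lebesgue_measurable[OF test_function_continuous[OF box_bump_test_function[OF sub]]])
  have meas_prod: "(\<lambda>x. rep_ae_fun f x * box_bump n a b x) \<in> borel_measurable lebesgue" for n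
    using bump_meas by measurable
  have lim: "AE x in lebesgue. (\<lambda>n. rep_ae_fun f x * box_bump n a b x) \<longlonglongrightarrow> indicator (box a b) x *\<^sub>R rep_ae_fun f x"
  proof (rule AE_I2)
    fix x
    have "(\<lambda>n. rep_ae_fun f x * box_bump n a b x) \<longlonglongrightarrow> rep_ae_fun f x * indicator (box a b) x"
      by (rule tendsto_mult_left[OF box_bump_tendsto])
    moreover have "rep_ae_fun f x * indicator (box a b) x = indicator (box a b) x *\<^sub>R rep_ae_fun f x"
      by (simp add: indicator_def)
    ultimately show "(\<lambda>n. rep_ae_fun f x * box_bump n a b x) \<longlonglongrightarrow> indicator (box a b) x *\<^sub>R rep_ae_fun f x"
      by simp
  qed
  have dom: "AE x in lebesgue. norm (rep_ae_fun f x * box_bump n a b x) \<le> w x" for n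
  proof (rule AE_I2)
    fix x
    show "norm (rep_ae_fun f x * box_bump n a b x) \<le> w x"
    proof (cases "x \<in> box a b")
      case True
      have "norm (rep_ae_fun f x * box_bump n a b x) \<le> cmod (rep_ae_fun f x)"
        using mult_left_mono[OF box_bump_norm_le[of n a b x], of "cmod (rep_ae_fun f x)"] by (simp add: norm_mult)
      then show ?thesis using bound[of x] True by (simp add: w_def)
    next
      case False
      then have "box_bump n a b x = 0" using box_bump_nonzero_iff by blast
      then show ?thesis by (simp add: w_def)
    qed
  qed
  have ind_meas: "(\<lambda>x. indicator (box a b) x *\<^sub>R rep_ae_fun f x) \<in> borel_measurable lebesgue"
    by (rule borel_measurable_scaleR[OF borel_measurable_indicator rep_ae_fun_measurable]) simp
  show "set_integrable lebesgue (box a b) (rep_ae_fun f)"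
    unfolding set_integrable_def by (rule integrable_dominated_convergence[OF ind_meas meas_prod w_int lim dom])
  have "(\<lambda>n. LINT x|lebesgue. rep_ae_fun f x * box_bump n a b x) \<longlonglongrightarrow>
      (LINT x|lebesgue. indicator (box a b) x *\<^sub>R rep_ae_fun f x)"
    by (rule integral_dominated_convergence[OF ind_meas meas_prod w_int lim dom])
  moreover have "(LINT x|lebesgue. rep_ae_fun f x * box_bump n a b x) = 0" for n
    by (rule zero[OF box_bump_test_function[OF sub]])
  ultimately show "(LINT x:box a b|lebesgue. rep_ae_fun f x) = 0"
    unfolding set_lebesgue_integral_def by (simp add: LIMSEQ_const_iff)
qed

text \<open>Vanishing is shown on each closed box inside the domain, where \<open>f\<close> is
  integrable and the bumps turn the hypothesis into vanishing box integrals. An open set is a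
  countable union of such boxes.\<close>

lemma fundamental_lemma:
  assumes "open \<Omega>" and f: "f \<in> L2 \<Omega>"
    and zero: "\<And>\<phi>. test_function \<Omega> \<phi> \<Longrightarrow> (LINT x|lebesgue. rep_ae_fun f x * \<phi> x) = 0"
  shows "f = 0"
proof -
  note box_zero = box_integral_zero[OF f _ zero]
  have local: "AE x in lebesgue. x \<in> cbox a b \<longrightarrow> rep_ae_fun f x = 0" if sub: "cbox a b \<subseteq> \<Omega>" for a b
  proof -
    define h where "h x = indicator (box a b) x *\<^sub>R rep_ae_fun f x" for x
    have "AE x in lebesgue. h x = 0"
    proof (rule AE_zero_of_box_integrals)
      show "integrable lebesgue h"
        using box_zero(2)[OF sub] unfolding h_def set_integrable_def by simp
      show "integral\<^sup>L lebesgue h = 0"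
        using box_zero(1)[OF sub] unfolding h_def set_lebesgue_integral_def by simp
      fix c d :: "real^'n"
      obtain c' d' where cd: "box c d \<inter> box a b = box c' d'" using box_Int_box[of c d a b] by blast
      have eq: "(LINT x:box c d|lebesgue. h x) = (LINT x:box c' d'|lebesgue. rep_ae_fun f x)"
        unfolding set_lebesgue_integral_def h_def cd[symmetric]
        by (rule Bochner_Integration.integral_cong) (auto simp: indicator_def)
      show "(LINT x:box c d|lebesgue. h x) = 0"
      \<comment> \<open>Emptiness is split off because an empty \<open>box c' d'\<close> gives no
        information on \<open>cbox c' d'\<close>, whereas a nonempty one has it as its
        closure.\<close>
      proof (cases "box c' d' = {}")
        case True
        then show ?thesis unfolding eq by (simp add: set_lebesgue_integral_def)
      next
        case False
        have ab: "box a b \<noteq> {}" using False cd by blast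
        have "closure (box c' d') \<subseteq> closure (box a b)" unfolding cd[symmetric] by (rule closure_mono) simp
        then have "cbox c' d' \<subseteq> \<Omega>"
          unfolding closure_box[OF False] closure_box[OF ab] using sub by (rule subset_trans)
        then show ?thesis unfolding eq by (rule box_zero(1))
      qed
    qed
    moreover have "AE x in lebesgue. x \<notin> cbox a b - box a b"
      using negligible_frontier_interval[of a b] by (intro AE_not_in) (simp add: negligible_iff_null_sets)
    ultimately show ?thesis
      by eventually_elim (auto simp: h_def)
  qed
  obtain D where D: "countable D" "D \<subseteq> Pow \<Omega>" "\<And>X. X \<in> D \<Longrightarrow> \<exists>a b. X = cbox a b" "\<Union>D = \<Omega>"
    using open_countable_Union_open_cbox[OF assms(1)] by metis
  have "AE x in lebesgue. \<forall>X\<in>D. x \<in> X \<longrightarrow> rep_ae_fun f x = 0"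
    unfolding AE_ball_countable[OF D(1)]
  proof
    fix X assume "X \<in> D"
    then obtain a b where "X = cbox a b" "cbox a b \<subseteq> \<Omega>" using D by blast
    then show "AE x in lebesgue. x \<in> X \<longrightarrow> rep_ae_fun f x = 0" using local by simp
  qed
  then have "AE x in lebesgue. rep_ae_fun f x = rep_ae_fun 0 x"
    using L2D(2)[OF f] AE_rep_zero
  proof eventually_elim
    case (elim x)
    then show ?case using D(4) by (cases "x \<in> \<Omega>") auto
  qed
  then show "f = 0" by (rule ae_fun_eqI)
qed

end

section \<open>Integration by parts\<close>

lemma pderiv_at_vector_derivative:
  fixes F :: "real^'n::finite \<Rightarrow> complex"
  assumes "F differentiable (at (x + t *\<^sub>R axis j 1))"
  shows "((\<lambda>t. F (x + t *\<^sub>R axis j 1)) has_vector_derivative pderiv_at j F (x + t *\<^sub>R axis j 1)) (at t)"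
proof -
  let ?y = "x + t *\<^sub>R axis j 1"
  let ?D = "frechet_derivative F (at ?y)"
  have D: "(F has_derivative ?D) (at ?y)"
    using assms frechet_derivative_works by blast
  have "((\<lambda>t. x + t *\<^sub>R axis j 1) has_derivative (\<lambda>h. h *\<^sub>R axis j 1)) (at t)"
    by (auto intro!: derivative_eq_intros)
  from has_derivative_compose[OF this D]
  have "((\<lambda>t. F (x + t *\<^sub>R axis j 1)) has_derivative (\<lambda>h. ?D (h *\<^sub>R axis j 1))) (at t)" .
  moreover have "?D (h *\<^sub>R axis j 1) = h *\<^sub>R ?D (axis j 1)" for h
    using linear_frechet_derivative[OF assms] by (rule linear_scale)
  ultimately show ?thesis
    by (simp add: has_vector_derivative_def pderiv_at_def)
qed

lemma vector_derivative_quotient: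
  fixes f :: "real \<Rightarrow> 'a::real_normed_vector"
  assumes "(f has_vector_derivative d) (at 0)"
  shows "((\<lambda>t. (f t - f 0) /\<^sub>R t) \<longlongrightarrow> d) (at 0)"
proof (rule LIM_zero_cancel, rule tendsto_norm_zero_cancel)
  have "((\<lambda>t. norm (f (0 + t) - f 0 - t *\<^sub>R d) / norm t) \<longlongrightarrow> 0) (at 0)"
    using assms unfolding has_vector_derivative_def has_derivative_at by blast
  moreover have "\<forall>\<^sub>F t in at 0. norm (f (0 + t) - f 0 - t *\<^sub>R d) / norm t = norm ((f t - f 0) /\<^sub>R t - d)"
    unfolding eventually_at_filter
  proof (intro always_eventually allI impI)
    fix t :: real assume t: "t \<noteq> 0"
    have "f t - f 0 - t *\<^sub>R d = t *\<^sub>R ((f t - f 0) /\<^sub>R t - d)"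
      using t by (simp add: scaleR_diff_right)
    then have "norm (f t - f 0 - t *\<^sub>R d) = \<bar>t\<bar> * norm ((f t - f 0) /\<^sub>R t - d)"
      by (metis norm_scaleR)
    then show "norm (f (0 + t) - f 0 - t *\<^sub>R d) / norm t = norm ((f t - f 0) /\<^sub>R t - d)"
      using t by simp
  qed
  ultimately show "((\<lambda>t. norm ((f t - f 0) /\<^sub>R t - d)) \<longlongrightarrow> 0) (at 0)"
    by (rule Lim_transform_eventually)
qed

lemma pderiv_at_zero_outside:
  fixes F :: "real^'n::finite \<Rightarrow> complex"
  assumes "x \<notin> closure {x. F x \<noteq> 0}"
  shows "pderiv_at j F x = 0"
proof -
  have "open (- closure {x. F x \<noteq> 0})" by (rule open_Compl[OF closed_closure])
  moreover have "x \<in> - closure {x. F x \<noteq> 0}" using assms by simp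
  moreover have "0 = F y" if "y \<in> - closure {x. F x \<noteq> 0}" for y
    using that closure_subset[of "{x. F x \<noteq> 0}"] by auto
  ultimately have "(F has_derivative (\<lambda>h. 0)) (at x)"
    using has_derivative_transform_within_open[OF has_derivative_const[of 0 "at x"]] by blast
  then show ?thesis using has_derivative_pderiv_at by metis
qed

lemma integral_lebesgue_continuous:
  fixes F :: "real^'n::finite \<Rightarrow> complex"
  assumes "continuous_on UNIV F"
  shows "integral\<^sup>L lebesgue F = integral\<^sup>L lborel F"
  by (rule integral_completion) (use borel_measurable_continuous_onI[OF assms] in simp)

lemma integral_translation:
  fixes F :: "real^'n::finite \<Rightarrow> complex"
  assumes "F \<in> borel_measurable borel"
  shows "(LINT x|lborel. F (x + c)) = integral\<^sup>L lborel F"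
proof -
  have "integral\<^sup>L lborel F = integral\<^sup>L (distr lborel borel ((+) c)) F"
    by (simp add: lborel_distr_plus)
  also have "\<dots> = (LINT x|lborel. F (c + x))"
    by (rule integral_distr) (use assms in simp_all)
  finally show ?thesis by (simp add: add.commute)
qed

lemma compact_subset_cball_0:
  assumes "compact (S :: 'a::real_normed_vector set)"
  shows "\<exists>r. S \<subseteq> cball 0 r"
  using compact_imp_bounded[OF assms] unfolding bounded_iff by (auto simp: subset_iff)

lemma integrable_const_indicator_cball:
  "integrable lborel (\<lambda>x. C * indicator (cball (0::real^'n::finite) r) x :: real)"
proof -
  have "integrable lborel (indicator (cball (0::real^'n) r) :: _ \<Rightarrow> real)"
    by (rule integrable_real_indicator) (simp, rule emeasure_bounded_finite, simp)
  then show ?thesis by simp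
qed

lemma integrable_continuous_compact_support:
  fixes F :: "real^'n::finite \<Rightarrow> complex"
  assumes cont: "continuous_on UNIV F" and supp: "\<And>x. x \<notin> cball 0 r \<Longrightarrow> F x = 0"
  obtains C where "0 \<le> C" "\<And>x. cmod (F x) \<le> C" "integrable lborel F"
proof -
  have "compact (F ` cball 0 r)"
    by (rule compact_continuous_image[OF continuous_on_subset[OF cont]]) auto
  then have "bounded (F ` cball 0 r)" by (rule compact_imp_bounded)
  then obtain C where C: "0 < C" "\<forall>y\<in>F ` cball 0 r. norm y \<le> C" using bounded_pos by blast
  then have bound: "cmod (F x) \<le> C" for x using supp[of x] by (cases "x \<in> cball 0 r") auto
  have "integrable lborel F"
  proof (rule Bochner_Integration.integrable_bound)
    show "integrable lborel (\<lambda>x. C * indicator (cball (0::real^'n) r) x)"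
      by (rule integrable_const_indicator_cball)
    show "F \<in> borel_measurable lborel" using borel_measurable_continuous_onI[OF cont] by simp
    show "AE x in lborel. norm (F x) \<le> norm (C * indicator (cball 0 r) x)"
      using bound supp C(1) by (intro always_eventually) (auto simp: indicator_def)
  qed
  with that[of C] bound C(1) show ?thesis by simp
qed

text \<open>This is the derivative of the translation invariance of the integral.\<close>

lemma integral_pderiv_zero:
  fixes F :: "real^'n::finite \<Rightarrow> complex"
  assumes diff: "\<And>x. F differentiable (at x)" and cont: "continuous_on UNIV (pderiv_at j F)"
    and supp: "compact (closure {x. F x \<noteq> 0})"
  shows "integral\<^sup>L lebesgue (pderiv_at j F) = 0"
proof -
  obtain r where r: "closure {x. F x \<noteq> 0} \<subseteq> cball 0 r"
    using compact_subset_cball_0[OF supp] by blast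
  have F0: "F x = 0" if "x \<notin> cball 0 r" for x
    using that r closure_subset[of "{x. F x \<noteq> 0}"] by blast
  have P0: "pderiv_at j F x = 0" if "x \<notin> cball 0 r" for x
    using that r by (intro pderiv_at_zero_outside) blast
  have F_cont: "continuous_on UNIV F"
    by (simp add: continuous_on_eq_continuous_within differentiable_imp_continuous_within diff)
  note F_meas = borel_measurable_continuous_onI[OF F_cont]
  obtain C where C: "0 \<le> C" "\<And>x. cmod (pderiv_at j F x) \<le> C"
    using integrable_continuous_compact_support[OF cont P0] by metis
  have F_int: "integrable lborel F"
    using integrable_continuous_compact_support[OF F_cont F0] by metis
  let ?e = "axis j 1 :: real^'n"
  \<comment> \<open>Steps of length at most 1 keep all difference quotients supported in one ball of
    radius \<open>r + 1\<close>, where a constant can serve as dominating function.\<close>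
  define h where "h n = 1 / real (Suc n)" for n
  have h: "0 < h n" "h n \<le> 1" for n by (simp_all add: h_def)
  define Q where "Q n x = (F (x + h n *\<^sub>R ?e) - F x) /\<^sub>R h n" for n x
  have shift_meas: "(\<lambda>x. F (x + h n *\<^sub>R ?e)) \<in> borel_measurable borel" for n
    by (rule measurable_compose[OF _ F_meas]) simp
  have Q_meas: "Q n \<in> borel_measurable lborel" for n
    unfolding Q_def using shift_meas[of n] F_meas by simp
  have Q_zero: "integral\<^sup>L lborel (Q n) = 0" for n
  proof -
    have "integrable lborel (\<lambda>x. F (x + h n *\<^sub>R ?e))"
    proof -
      have "integrable (distr lborel borel ((+) (h n *\<^sub>R ?e))) F"
        using F_int by (simp add: lborel_distr_plus)
      then have "integrable lborel (\<lambda>x. F (h n *\<^sub>R ?e + x))"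
        by (rule integrable_distr[rotated]) simp
      then show ?thesis by (simp add: add.commute)
    qed
    then have "integral\<^sup>L lborel (Q n) = ((LINT x|lborel. F (x + h n *\<^sub>R ?e)) - integral\<^sup>L lborel F) /\<^sub>R h n"
      unfolding Q_def using F_int by simp
    then show ?thesis by (simp add: integral_translation[OF F_meas])
  qed
  have Q_bound: "cmod (Q n x) \<le> C" for n x
  proof -
    have "norm (F (x + h n *\<^sub>R ?e) - F (x + 0 *\<^sub>R ?e)) \<le> C * norm (h n - 0)"
    proof (rule differentiable_bound[where S=UNIV and f'="\<lambda>t s. s *\<^sub>R pderiv_at j F (x + t *\<^sub>R ?e)"])
      show "((\<lambda>t. F (x + t *\<^sub>R ?e)) has_derivative (\<lambda>s. s *\<^sub>R pderiv_at j F (x + t *\<^sub>R ?e))) (at t within UNIV)" for t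
        using pderiv_at_vector_derivative[OF diff] by (simp add: has_vector_derivative_def)
      show "onorm (\<lambda>s. s *\<^sub>R pderiv_at j F (x + t *\<^sub>R ?e)) \<le> C" for t
      proof (rule onorm_le)
        show "norm (s *\<^sub>R pderiv_at j F (x + t *\<^sub>R ?e)) \<le> C * norm s" for s :: real
          by (simp add: mult.commute[of C] mult_left_mono C(2))
      qed
    qed auto
    then have "cmod (F (x + h n *\<^sub>R ?e) - F x) \<le> C * h n" using h(1)[of n] by simp
    moreover have "cmod (Q n x) = cmod (F (x + h n *\<^sub>R ?e) - F x) / h n"
      using h(1)[of n] by (simp add: Q_def divide_inverse mult.commute)
    ultimately show ?thesis using h(1)[of n] by (simp add: pos_divide_le_eq)
  qed
  have Q_supp: "Q n x = 0" if "x \<notin> cball 0 (r + 1)" for n x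
  proof -
    have nx: "r + 1 < norm x" using that by simp
    have "norm x \<le> norm (x + h n *\<^sub>R ?e) + norm (h n *\<^sub>R ?e)"
      using norm_triangle_ineq4[of "x + h n *\<^sub>R ?e" "h n *\<^sub>R ?e"] by simp
    also have "norm (h n *\<^sub>R ?e) \<le> 1" using h[of n] by simp
    finally have "x + h n *\<^sub>R ?e \<notin> cball 0 r" using nx by simp
    moreover have "x \<notin> cball 0 r" using nx by simp
    ultimately show ?thesis using F0 by (simp add: Q_def)
  qed
  have "(\<lambda>n. integral\<^sup>L lborel (Q n)) \<longlonglongrightarrow> integral\<^sup>L lborel (pderiv_at j F)"
  proof (rule integral_dominated_convergence[where w="\<lambda>x. C * indicator (cball (0::real^'n) (r + 1)) x"])
    show "pderiv_at j F \<in> borel_measurable lborel"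
      using borel_measurable_continuous_onI[OF cont] by simp
    show "Q n \<in> borel_measurable lborel" for n by (rule Q_meas)
    show "integrable lborel (\<lambda>x. C * indicator (cball (0::real^'n) (r + 1)) x)"
      by (rule integrable_const_indicator_cball)
    show "AE x in lborel. (\<lambda>n. Q n x) \<longlonglongrightarrow> pderiv_at j F x"
    proof (rule AE_I2)
      fix x
      have "((\<lambda>t. F (x + t *\<^sub>R ?e)) has_vector_derivative pderiv_at j F x) (at 0)"
        using pderiv_at_vector_derivative[OF diff, where x=x and t=0] by simp
      then have lim: "((\<lambda>t. (F (x + t *\<^sub>R ?e) - F x) /\<^sub>R t) \<longlongrightarrow> pderiv_at j F x) (at 0)"
        using vector_derivative_quotient[of "\<lambda>t. F (x + t *\<^sub>R ?e)"] by simp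
      have "filterlim h (at 0) sequentially"
        unfolding filterlim_at h_def using LIMSEQ_inverse_real_of_nat by (simp add: inverse_eq_divide)
      from filterlim_compose[OF lim this] show "(\<lambda>n. Q n x) \<longlonglongrightarrow> pderiv_at j F x"
        by (simp add: Q_def)
    qed
    show "AE x in lborel. norm (Q n x) \<le> C * indicator (cball 0 (r + 1)) x" for n
      using Q_bound Q_supp by (intro always_eventually) (auto simp: indicator_def)
  qed
  then have "integral\<^sup>L lborel (pderiv_at j F) = 0"
    using Q_zero by (simp add: LIMSEQ_const_iff)
  then show ?thesis using integral_lebesgue_continuous[OF cont] by simp
qed

text \<open>An arbitrary test function need not belong to \<open>smooth_fun\<close>, so stability
  under sums and multiples is proved for \<open>C_k\<close> itself. It is what makes the closure of
  the test functions a subspace.\<close>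

lemma C_k_add: "C_k k f \<Longrightarrow> C_k k g \<Longrightarrow> C_k k (\<lambda>x. f x + g x)"
proof (induction k arbitrary: f g)
  case 0
  then show ?case by (simp add: continuous_on_add)
next
  case (Suc k)
  have eq: "pderiv_at j (\<lambda>x. f x + g x) = (\<lambda>x. pderiv_at j f x + pderiv_at j g x)" for j
  proof
    fix x
    have "((\<lambda>x. f x + g x) has_derivative (\<lambda>h. frechet_derivative f (at x) h + frechet_derivative g (at x) h)) (at x)"
      using Suc.prems by (intro has_derivative_add) (simp_all add: frechet_derivative_works[symmetric])
    from has_derivative_pderiv_at[OF this]
    show "pderiv_at j (\<lambda>x. f x + g x) x = pderiv_at j f x + pderiv_at j g x"
      unfolding pderiv_at_def[of j f] pderiv_at_def[of j g] .
  qed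
  show ?case unfolding C_k.simps(2) eq
    using Suc.IH Suc.prems by (auto intro: differentiable_add)
qed

lemma C_k_scale: "C_k k f \<Longrightarrow> C_k k (\<lambda>x. c * f x)"
proof (induction k arbitrary: f)
  case 0
  then show ?case by (simp add: continuous_on_mult_left)
next
  case (Suc k)
  have eq: "pderiv_at j (\<lambda>x. c * f x) = (\<lambda>x. c * pderiv_at j f x)" for j
  proof
    fix x
    have "((\<lambda>x. c * f x) has_derivative (\<lambda>h. c * frechet_derivative f (at x) h)) (at x)"
      using Suc.prems by (intro has_derivative_mult_right) (simp add: frechet_derivative_works[symmetric])
    from has_derivative_pderiv_at[OF this]
    show "pderiv_at j (\<lambda>x. c * f x) x = c * pderiv_at j f x"
      unfolding pderiv_at_def[of j f] .
  qed
  show ?case unfolding C_k.simps(2) eq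
    using Suc.IH Suc.prems by (auto intro: differentiable_mult differentiable_const)
qed

lemma test_function_differentiable: "test_function \<Omega> \<phi> \<Longrightarrow> \<phi> differentiable (at x)"
  unfolding test_function_def using C_k.simps(2) by blast

lemma closure_support_mono:
  fixes \<phi> \<psi> :: "real^'n::finite \<Rightarrow> complex"
  assumes "compact (closure {x. \<phi> x \<noteq> 0})" "closure {x. \<phi> x \<noteq> 0} \<subseteq> \<Omega>" "{x. \<psi> x \<noteq> 0} \<subseteq> closure {x. \<phi> x \<noteq> 0}"
  shows "compact (closure {x. \<psi> x \<noteq> 0})" "closure {x. \<psi> x \<noteq> 0} \<subseteq> \<Omega>"
proof -
  have "closure {x. \<psi> x \<noteq> 0} \<subseteq> closure {x. \<phi> x \<noteq> 0}"
    by (rule closure_minimal[OF assms(3) closed_closure])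
  then show "closure {x. \<psi> x \<noteq> 0} \<subseteq> \<Omega>" using assms(2) by (rule subset_trans)
  have "bounded (closure {x. \<psi> x \<noteq> 0})"
    by (rule bounded_subset[OF compact_imp_bounded[OF assms(1)] \<open>closure {x. \<psi> x \<noteq> 0} \<subseteq> closure {x. \<phi> x \<noteq> 0}\<close>])
  then show "compact (closure {x. \<psi> x \<noteq> 0})" by (simp add: compact_eq_bounded_closed)
qed

lemma test_function_pderiv: 
  assumes "test_function \<Omega> \<phi>"
  shows "test_function \<Omega> (pderiv_at j \<phi>)"
proof -
  have "{x. pderiv_at j \<phi> x \<noteq> 0} \<subseteq> closure {x. \<phi> x \<noteq> 0}"
    using pderiv_at_zero_outside by blast
  moreover have "C_k k (pderiv_at j \<phi>)" for k
    using assms C_k.simps(2) unfolding test_function_def by blast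
  ultimately show ?thesis
    using assms closure_support_mono[of \<phi> \<Omega> "pderiv_at j \<phi>"] unfolding test_function_def by blast
qed

lemma test_function_scale: 
  assumes "test_function \<Omega> \<phi>"
  shows "test_function \<Omega> (\<lambda>x. c * \<phi> x)"
proof -
  have "{x. c * \<phi> x \<noteq> 0} \<subseteq> closure {x. \<phi> x \<noteq> 0}" using closure_subset[of "{x. \<phi> x \<noteq> 0}"] by auto
  then show ?thesis
    using assms closure_support_mono[of \<phi> \<Omega> "\<lambda>x. c * \<phi> x"] C_k_scale unfolding test_function_def by blast
qed

lemma test_function_add:
  assumes "test_function \<Omega> \<phi>" "test_function \<Omega> \<psi>"
  shows "test_function \<Omega> (\<lambda>x. \<phi> x + \<psi> x)"
proof -
  have "closure {x. \<phi> x + \<psi> x \<noteq> 0} \<subseteq> closure {x. \<phi> x \<noteq> 0} \<union> closure {x. \<psi> x \<noteq> 0}"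
    unfolding closure_Un[symmetric] by (rule closure_mono) auto
  moreover have "bounded (closure {x. \<phi> x \<noteq> 0} \<union> closure {x. \<psi> x \<noteq> 0})"
    using assms by (simp add: test_function_def compact_imp_bounded)
  ultimately have "bounded (closure {x. \<phi> x + \<psi> x \<noteq> 0})" "closure {x. \<phi> x + \<psi> x \<noteq> 0} \<subseteq> \<Omega>"
    using assms bounded_subset unfolding test_function_def by blast+
  moreover have "C_k k (\<lambda>x. \<phi> x + \<psi> x)" for k
    using assms by (intro C_k_add) (auto simp: test_function_def)
  ultimately show ?thesis by (simp add: test_function_def compact_eq_bounded_closed)
qed

text \<open>The derivative of the compactly supported product integrates to 0. The consequence
  needed later is that classical derivatives of test functions are their weak derivatives.\<close>

lemma integration_by_parts:
  assumes \<phi>: "test_function \<Omega> \<phi>" and \<psi>: "test_function \<Omega> \<psi>"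
  shows "(LINT x|lebesgue. \<phi> x * pderiv_at j \<psi> x) = - (LINT x|lebesgue. pderiv_at j \<phi> x * \<psi> x)"
proof -
  note d = test_function_differentiable[OF \<phi>] test_function_differentiable[OF \<psi>]
  note c = test_function_continuous[OF \<phi>] test_function_continuous[OF \<psi>]
    test_function_continuous[OF test_function_pderiv[OF \<phi>]] test_function_continuous[OF test_function_pderiv[OF \<psi>]]
  have D: "((\<lambda>x. \<phi> x * \<psi> x) has_derivative
      (\<lambda>h. \<phi> x * frechet_derivative \<psi> (at x) h + frechet_derivative \<phi> (at x) h * \<psi> x)) (at x)" for x
    using d[of x] by (intro has_derivative_mult) (simp_all add: frechet_derivative_works[symmetric])
  have pd: "pderiv_at j (\<lambda>x. \<phi> x * \<psi> x) = (\<lambda>x. \<phi> x * pderiv_at j \<psi> x + pderiv_at j \<phi> x * \<psi> x)"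
  proof
    fix x
    from has_derivative_pderiv_at[OF D[of x], of j]
    show "pderiv_at j (\<lambda>x. \<phi> x * \<psi> x) x = \<phi> x * pderiv_at j \<psi> x + pderiv_at j \<phi> x * \<psi> x"
      unfolding pderiv_at_def[of j \<phi>] pderiv_at_def[of j \<psi>] .
  qed
  obtain r where r: "closure {x. \<phi> x \<noteq> 0} \<subseteq> cball 0 r"
    using \<phi> compact_subset_cball_0[of "closure {x. \<phi> x \<noteq> 0}"]
    unfolding test_function_def by blast
  have zero: "\<phi> x = 0" "pderiv_at j \<phi> x = 0" if "x \<notin> cball 0 r" for x
    using that r closure_subset[of "{x. \<phi> x \<noteq> 0}"] pderiv_at_zero_outside[of x \<phi> j] by blast+
  have c1: "continuous_on UNIV (\<lambda>x. \<phi> x * pderiv_at j \<psi> x)" and c2: "continuous_on UNIV (\<lambda>x. pderiv_at j \<phi> x * \<psi> x)"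
    using c by (auto intro: continuous_on_mult)
  have i1: "integrable lborel (\<lambda>x. \<phi> x * pderiv_at j \<psi> x)"
    using integrable_continuous_compact_support[OF c1, of r] zero(1) by (metis mult_zero_left)
  have i2: "integrable lborel (\<lambda>x. pderiv_at j \<phi> x * \<psi> x)"
    using integrable_continuous_compact_support[OF c2, of r] zero(2) by (metis mult_zero_left)
  have "integral\<^sup>L lebesgue (pderiv_at j (\<lambda>x. \<phi> x * \<psi> x)) = 0"
  proof (rule integral_pderiv_zero)
    show "(\<lambda>x. \<phi> x * \<psi> x) differentiable (at x)" for x using D differentiable_def by blast
    show "continuous_on UNIV (pderiv_at j (\<lambda>x. \<phi> x * \<psi> x))"
      unfolding pd by (rule continuous_on_add[OF c1 c2])
    show "compact (closure {x. \<phi> x * \<psi> x \<noteq> 0})"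
    proof (rule closure_support_mono(1))
      show "compact (closure {x. \<phi> x \<noteq> 0})" "closure {x. \<phi> x \<noteq> 0} \<subseteq> \<Omega>"
        using \<phi> by (simp_all add: test_function_def)
      show "{x. \<phi> x * \<psi> x \<noteq> 0} \<subseteq> closure {x. \<phi> x \<noteq> 0}"
        using closure_subset[of "{x. \<phi> x \<noteq> 0}"] by auto
    qed
  qed
  then have "integral\<^sup>L lborel (\<lambda>x. \<phi> x * pderiv_at j \<psi> x + pderiv_at j \<phi> x * \<psi> x) = 0"
    unfolding pd integral_lebesgue_continuous[OF continuous_on_add[OF c1 c2]] .
  then show ?thesis
    unfolding integral_lebesgue_continuous[OF c1] integral_lebesgue_continuous[OF c2]
    using i1 i2 by (simp add: eq_neg_iff_add_eq_0)
qed

section \<open>The spaces \<open>H\<^sup>1\<close> and \<open>H\<^sup>1\<^sub>0\<close>\<close>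

lemma continuous_compact_support_L2:
  fixes \<phi> :: "real^'n::finite \<Rightarrow> complex"
  assumes meas: "\<Omega> \<in> sets lebesgue" and cont: "continuous_on UNIV \<phi>"
    and supp: "compact (closure {x. \<phi> x \<noteq> 0})" "closure {x. \<phi> x \<noteq> 0} \<subseteq> \<Omega>"
  shows "abs_ae_fun \<phi> \<in> L2 \<Omega>"
proof -
  have \<phi>_meas: "\<phi> \<in> borel_measurable lebesgue" by (rule continuous_lebesgue_measurable[OF cont])
  note rep = AE_rep_abs_ae_fun[OF \<phi>_meas]
  obtain r where r: "closure {x. \<phi> x \<noteq> 0} \<subseteq> cball 0 r"
    using compact_subset_cball_0[OF supp(1)] by blast
  define sq where "sq x = \<phi> x * cnj (\<phi> x)" for x
  have sq_cont: "continuous_on UNIV sq"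
    unfolding sq_def by (intro continuous_on_mult continuous_on_cnj cont)
  have "sq x = 0" if "x \<notin> cball 0 r" for x
    using that r closure_subset[of "{x. \<phi> x \<noteq> 0}"] by (auto simp: sq_def)
  then have "integrable lborel sq"
    by (rule integrable_continuous_compact_support[OF sq_cont])
  then have "integrable lborel (\<lambda>x. Re (sq x))" by (rule integrable_Re)
  moreover have "Re (sq x) = (cmod (\<phi> x))\<^sup>2" for x
    by (simp add: sq_def cmod_power2 flip: power2_eq_square)
  ultimately have i: "integrable lborel (\<lambda>x. (cmod (\<phi> x))\<^sup>2)" by simp
  have "integrable lebesgue (\<lambda>x. (cmod (\<phi> x))\<^sup>2)"
    using integrable_completion[OF borel_measurable_integrable[OF i]] i by simp
  moreover have "integrable lebesgue (\<lambda>x. (cmod (rep_ae_fun (abs_ae_fun \<phi>) x))\<^sup>2)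
      \<longleftrightarrow> integrable lebesgue (\<lambda>x. (cmod (\<phi> x))\<^sup>2)"
  proof (rule integrable_cong_AE)
    show "(\<lambda>x. (cmod (rep_ae_fun (abs_ae_fun \<phi>) x))\<^sup>2) \<in> borel_measurable lebesgue" by measurable
    show "(\<lambda>x. (cmod (\<phi> x))\<^sup>2) \<in> borel_measurable lebesgue" using \<phi>_meas by measurable
    show "AE x in lebesgue. (cmod (rep_ae_fun (abs_ae_fun \<phi>) x))\<^sup>2 = (cmod (\<phi> x))\<^sup>2"
      using rep by eventually_elim simp
  qed
  moreover have "AE x in lebesgue. x \<notin> \<Omega> \<longrightarrow> rep_ae_fun (abs_ae_fun \<phi>) x = 0"
    using rep
  proof eventually_elim
    case (elim x)
    then show ?case using supp(2) closure_subset[of "{x. \<phi> x \<noteq> 0}"] by auto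
  qed
  ultimately show ?thesis by (simp add: L2_iff[OF meas])
qed

locale open_domain =
  fixes \<Omega> :: "(real^'n::finite) set"
  assumes open_\<Omega>: "open \<Omega>"

sublocale open_domain \<subseteq> measurable_domain \<Omega>
  by unfold_locales (simp add: open_\<Omega> borel_open)

context open_domain
begin

lemma test_L2: "test_function \<Omega> \<phi> \<Longrightarrow> abs_ae_fun \<phi> \<in> L2 \<Omega>"
  by (rule continuous_compact_support_L2[OF meas test_function_continuous])
    (auto simp: test_function_def)

lemma test_cnj_L2:
  assumes "test_function \<Omega> \<phi>"
  shows "abs_ae_fun (\<lambda>x. cnj (\<phi> x)) \<in> L2 \<Omega>"
proof (rule continuous_compact_support_L2[OF meas])
  show "continuous_on UNIV (\<lambda>x. cnj (\<phi> x))"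
    by (rule continuous_on_cnj[OF test_function_continuous[OF assms]])
qed (use assms in \<open>simp_all add: test_function_def\<close>)

lemma test_measurable: "test_function \<Omega> \<phi> \<Longrightarrow> \<phi> \<in> borel_measurable lebesgue"
  by (rule continuous_lebesgue_measurable[OF test_function_continuous])

text \<open>Pairing with a test function is bilinear, hence the conjugate. Written as an L^2 inner
  product, the condition on weak derivatives inherits linearity and passes to limits.\<close>

lemma test_pairing:
  assumes f: "f \<in> L2 \<Omega>" and \<phi>: "test_function \<Omega> \<phi>"
  shows "(LINT x:\<Omega>|lebesgue. rep_ae_fun f x * \<phi> x) = L2_inner \<Omega> f (abs_ae_fun (\<lambda>x. cnj (\<phi> x)))"
    and "(LINT x:\<Omega>|lebesgue. rep_ae_fun f x * \<phi> x) = (LINT x|lebesgue. rep_ae_fun f x * \<phi> x)"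
proof -
  note \<phi>m = test_measurable[OF \<phi>]
  have prod_meas: "(\<lambda>x. rep_ae_fun f x * \<phi> x) \<in> borel_measurable lebesgue" using \<phi>m by measurable
  show eq: "(LINT x:\<Omega>|lebesgue. rep_ae_fun f x * \<phi> x) = (LINT x|lebesgue. rep_ae_fun f x * \<phi> x)"
  proof (rule set_integral_eq_integral[OF meas prod_meas])
    show "AE x in lebesgue. x \<notin> \<Omega> \<longrightarrow> rep_ae_fun f x * \<phi> x = 0"
      using L2D(2)[OF f] by eventually_elim simp
  qed
  have cnj_meas: "(\<lambda>x. cnj (\<phi> x)) \<in> borel_measurable lebesgue"
    by (rule continuous_lebesgue_measurable[OF continuous_on_cnj[OF test_function_continuous[OF \<phi>]]])
  have "(LINT x|lebesgue. rep_ae_fun f x * \<phi> x)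
      = (LINT x|lebesgue. rep_ae_fun f x * cnj (rep_ae_fun (abs_ae_fun (\<lambda>x. cnj (\<phi> x))) x))"
  proof (rule integral_cong_AE[OF prod_meas])
    show "(\<lambda>x. rep_ae_fun f x * cnj (rep_ae_fun (abs_ae_fun (\<lambda>x. cnj (\<phi> x))) x)) \<in> borel_measurable lebesgue"
      by (rule borel_measurable_integrable[OF L2_integrable_mult[OF f test_cnj_L2[OF \<phi>]]])
    show "AE x in lebesgue. rep_ae_fun f x * \<phi> x = rep_ae_fun f x * cnj (rep_ae_fun (abs_ae_fun (\<lambda>x. cnj (\<phi> x))) x)"
      using AE_rep_abs_ae_fun[OF cnj_meas] by eventually_elim simp
  qed
  then show "(LINT x:\<Omega>|lebesgue. rep_ae_fun f x * \<phi> x) = L2_inner \<Omega> f (abs_ae_fun (\<lambda>x. cnj (\<phi> x)))"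
    unfolding eq L2_inner_eq[OF f] .
qed

lemma has_weak_pderiv_iff:
  assumes "f \<in> L2 \<Omega>" "g \<in> L2 \<Omega>"
  shows "has_weak_pderiv \<Omega> j f g \<longleftrightarrow> (\<forall>\<phi>. test_function \<Omega> \<phi> \<longrightarrow>
    L2_inner \<Omega> f (abs_ae_fun (\<lambda>x. cnj (pderiv_at j \<phi> x))) = - L2_inner \<Omega> g (abs_ae_fun (\<lambda>x. cnj (\<phi> x))))"
  unfolding has_weak_pderiv_def
  using test_pairing(1)[OF assms(1) test_function_pderiv] test_pairing(1)[OF assms(2)] by auto

text \<open>The fundamental lemma on the open domain gives the definite description in
  \<open>weak_pderiv\<close> its meaning.\<close>

lemma has_weak_pderiv_unique:
  assumes f: "f \<in> L2 \<Omega>" and g: "g \<in> L2 \<Omega>" "has_weak_pderiv \<Omega> j f g" and h: "h \<in> L2 \<Omega>" "has_weak_pderiv \<Omega> j f h"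
  shows "g = h"
proof -
  have gh: "g - h \<in> L2 \<Omega>" by (rule L2_closed(5)[OF g(1) h(1)])
  have "g - h = 0"
  proof (rule fundamental_lemma[OF open_\<Omega> gh])
    fix \<phi> :: "real^'n \<Rightarrow> complex" assume \<phi>: "test_function \<Omega> \<phi>"
    have "L2_inner \<Omega> (g - h) (abs_ae_fun (\<lambda>x. cnj (\<phi> x))) = 0"
      using g(2) h(2) \<phi> unfolding has_weak_pderiv_iff[OF f g(1)] has_weak_pderiv_iff[OF f h(1)]
      by (simp add: L2.diff_left[OF g(1) h(1) test_cnj_L2[OF \<phi>]])
    then show "(LINT x|lebesgue. rep_ae_fun (g - h) x * \<phi> x) = 0"
      using test_pairing[OF gh \<phi>] by simp
  qed
  then show ?thesis by simp
qed

lemma weak_pderiv_eqI: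
  assumes "f \<in> L2 \<Omega>" "g \<in> L2 \<Omega>" "has_weak_pderiv \<Omega> j f g"
  shows "weak_pderiv \<Omega> j f = g"
  unfolding weak_pderiv_def
  by (rule the_equality) (use assms has_weak_pderiv_unique[OF assms(1)] in blast)+

lemma H1D:
  assumes "f \<in> H1 \<Omega>"
  shows "f \<in> L2 \<Omega>" "weak_pderiv \<Omega> j f \<in> L2 \<Omega>" "has_weak_pderiv \<Omega> j f (weak_pderiv \<Omega> j f)"
proof -
  show f: "f \<in> L2 \<Omega>" using assms by (simp add: H1_def)
  obtain g where g: "g \<in> L2 \<Omega>" "has_weak_pderiv \<Omega> j f g" using assms by (auto simp: H1_def)
  show "weak_pderiv \<Omega> j f \<in> L2 \<Omega>" "has_weak_pderiv \<Omega> j f (weak_pderiv \<Omega> j f)"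
    unfolding weak_pderiv_eqI[OF f g] by (fact g)+
qed

lemma H1I:
  assumes "f \<in> L2 \<Omega>" "\<And>j. g j \<in> L2 \<Omega>" "\<And>j. has_weak_pderiv \<Omega> j f (g j)"
  shows "f \<in> H1 \<Omega>" "weak_pderiv \<Omega> j f = g j"
  using assms weak_pderiv_eqI by (auto simp: H1_def)

lemma has_weak_pderiv_add:
  assumes "f \<in> H1 \<Omega>" "g \<in> H1 \<Omega>"
  shows "has_weak_pderiv \<Omega> j (f + g) (weak_pderiv \<Omega> j f + weak_pderiv \<Omega> j g)"
proof -
  note f = H1D[OF assms(1)] and g = H1D[OF assms(2)]
  show ?thesis
    using f(3)[of j] g(3)[of j]
    unfolding has_weak_pderiv_iff[OF f(1) f(2)] has_weak_pderiv_iff[OF g(1) g(2)]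
      has_weak_pderiv_iff[OF L2_closed(2)[OF f(1) g(1)] L2_closed(2)[OF f(2) g(2)]]
    by (auto simp: L2.add_left f(1,2) g(1,2) test_cnj_L2 test_function_pderiv)
qed

lemma has_weak_pderiv_scale:
  assumes "f \<in> H1 \<Omega>"
  shows "has_weak_pderiv \<Omega> j (c *\<^sub>C f) (c *\<^sub>C weak_pderiv \<Omega> j f)"
proof -
  note f = H1D[OF assms(1)]
  show ?thesis
    using f(3)[of j]
    unfolding has_weak_pderiv_iff[OF f(1) f(2)]
      has_weak_pderiv_iff[OF L2_closed(3)[OF f(1)] L2_closed(3)[OF f(2)]]
    by (auto simp: L2.scale_left f(1,2) test_cnj_L2 test_function_pderiv)
qed

lemma has_weak_pderiv_zero: "has_weak_pderiv \<Omega> j 0 0"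
  unfolding has_weak_pderiv_iff[OF L2_closed(1) L2_closed(1)]
  by (auto simp: test_cnj_L2 test_function_pderiv)

lemma H1_subspace: "csubspace (H1 \<Omega>)"
  unfolding csubspace_def
proof (intro conjI ballI allI)
  show "0 \<in> H1 \<Omega>"
    by (rule H1I(1)[OF L2_closed(1)]) (rule L2_closed(1), rule has_weak_pderiv_zero)
  show "f + g \<in> H1 \<Omega>" if "f \<in> H1 \<Omega>" "g \<in> H1 \<Omega>" for f g
    by (rule H1I(1)[OF L2_closed(2)[OF H1D(1)[OF that(1)] H1D(1)[OF that(2)]]
          L2_closed(2)[OF H1D(2)[OF that(1)] H1D(2)[OF that(2)]] has_weak_pderiv_add[OF that]])
  show "c *\<^sub>C f \<in> H1 \<Omega>" if "f \<in> H1 \<Omega>" for c f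
    by (rule H1I(1)[OF L2_closed(3)[OF H1D(1)[OF that]] L2_closed(3)[OF H1D(2)[OF that]] has_weak_pderiv_scale[OF that]])
qed

lemma weak_pderiv_add: "f \<in> H1 \<Omega> \<Longrightarrow> g \<in> H1 \<Omega> \<Longrightarrow> weak_pderiv \<Omega> j (f + g) = weak_pderiv \<Omega> j f + weak_pderiv \<Omega> j g"
  by (rule weak_pderiv_eqI[OF _ _ has_weak_pderiv_add]) (simp_all add: H1D L2_closed)

lemma weak_pderiv_scale: "f \<in> H1 \<Omega> \<Longrightarrow> weak_pderiv \<Omega> j (c *\<^sub>C f) = c *\<^sub>C weak_pderiv \<Omega> j f"
  by (rule weak_pderiv_eqI[OF _ _ has_weak_pderiv_scale]) (simp_all add: H1D L2_closed)

lemma H1_semi_inner: "semi_inner (H1 \<Omega>) (H1_inner \<Omega>)"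
proof
  show "csubspace (H1 \<Omega>)" by (rule H1_subspace)
  show "H1_inner \<Omega> (f + g) h = H1_inner \<Omega> f h + H1_inner \<Omega> g h"
    if "f \<in> H1 \<Omega>" "g \<in> H1 \<Omega>" "h \<in> H1 \<Omega>" for f g h
    using that by (simp add: H1_inner_def weak_pderiv_add L2.add_left H1D(1,2) sum.distrib)
  show "H1_inner \<Omega> (c *\<^sub>C f) g = c * H1_inner \<Omega> f g" if "f \<in> H1 \<Omega>" "g \<in> H1 \<Omega>" for f g c
    using that by (simp add: H1_inner_def weak_pderiv_scale L2.scale_left H1D(1,2) distrib_left sum_distrib_left)
  show "H1_inner \<Omega> g f = cnj (H1_inner \<Omega> f g)" if f: "f \<in> H1 \<Omega>" and g: "g \<in> H1 \<Omega>" for f g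
  proof -
    have "L2_inner \<Omega> g f = cnj (L2_inner \<Omega> f g)" by (rule L2.cnj_sym[OF H1D(1)[OF f] H1D(1)[OF g]])
    moreover have "L2_inner \<Omega> (weak_pderiv \<Omega> j g) (weak_pderiv \<Omega> j f)
        = cnj (L2_inner \<Omega> (weak_pderiv \<Omega> j f) (weak_pderiv \<Omega> j g))" for j
      by (rule L2.cnj_sym[OF H1D(2)[OF f] H1D(2)[OF g]])
    ultimately show ?thesis by (simp add: H1_inner_def)
  qed
  show "0 \<le> Re (H1_inner \<Omega> f f)" if "f \<in> H1 \<Omega>" for f
    using that by (simp add: H1_inner_def L2.nonneg H1D(1,2) sum_nonneg)
qed

end

sublocale open_domain \<subseteq> H1: semi_inner "H1 \<Omega>" "H1_inner \<Omega>"
  by (rule H1_semi_inner)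

context open_domain
begin

lemma H1_nrm_sq:
  "f \<in> H1 \<Omega> \<Longrightarrow> (H1.nrm f)\<^sup>2 = (L2.nrm f)\<^sup>2 + (\<Sum>j\<in>UNIV. (L2.nrm (weak_pderiv \<Omega> j f))\<^sup>2)"
  by (simp add: H1.nrm_sq L2.nrm_sq H1D(1,2) H1_inner_def)

lemma L2_nrm_le_H1_nrm:
  assumes "f \<in> H1 \<Omega>"
  shows "L2.nrm f \<le> H1.nrm f" "L2.nrm (weak_pderiv \<Omega> j f) \<le> H1.nrm f"
proof -
  have s: "0 \<le> (\<Sum>j\<in>UNIV. (L2.nrm (weak_pderiv \<Omega> j f))\<^sup>2)" by (rule sum_nonneg) simp
  have "(L2.nrm f)\<^sup>2 \<le> (H1.nrm f)\<^sup>2" using s by (simp add: H1_nrm_sq[OF assms])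
  then show "L2.nrm f \<le> H1.nrm f" by (rule power2_le_imp_le) (rule H1.nrm_ge_0[OF assms])
  have "(L2.nrm (weak_pderiv \<Omega> j f))\<^sup>2 \<le> (\<Sum>j\<in>UNIV. (L2.nrm (weak_pderiv \<Omega> j f))\<^sup>2)"
    by (rule member_le_sum) auto
  then have "(L2.nrm (weak_pderiv \<Omega> j f))\<^sup>2 \<le> (H1.nrm f)\<^sup>2" by (simp add: H1_nrm_sq[OF assms] add_increasing)
  then show "L2.nrm (weak_pderiv \<Omega> j f) \<le> H1.nrm f" by (rule power2_le_imp_le) (rule H1.nrm_ge_0[OF assms])
qed

lemma weak_pderiv_diff: "f \<in> H1 \<Omega> \<Longrightarrow> g \<in> H1 \<Omega> \<Longrightarrow> weak_pderiv \<Omega> j (f - g) = weak_pderiv \<Omega> j f - weak_pderiv \<Omega> j g"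
  using weak_pderiv_add[of f "(- 1) *\<^sub>C g" j] weak_pderiv_scale[of g j "- 1"] by (simp add: scaleC_minus_one)

lemma H1_definite: "f \<in> H1 \<Omega> \<Longrightarrow> H1.nrm f = 0 \<Longrightarrow> f = 0"
  using L2_nrm_le_H1_nrm(1)[of f] L2.nrm_ge_0[OF H1D(1), of f] L2_definite[OF H1D(1), of f] by simp

text \<open>The functions and each of their weak derivatives converge in L^2. The defining identity
  of the weak derivative is an equation between inner products and survives the limit, so the limits
  of the derivatives are the derivatives of the limit.\<close>

lemma H1_complete:
  assumes s: "\<And>n::nat. s n \<in> H1 \<Omega>" and Cauchy: "\<And>e. 0 < e \<Longrightarrow> \<exists>N. \<forall>m\<ge>N. \<forall>n\<ge>N. H1.nrm (s m - s n) < e"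
  shows "\<exists>l. H1.lim_in s l"
proof -
  have diff: "s m - s n \<in> H1 \<Omega>" for m n using s by (intro H1.diff_mem)
  have "\<exists>l. L2.lim_in s l"
  proof (rule L2_complete[OF H1D(1)[OF s]])
    fix e :: real assume "0 < e"
    then obtain N where "\<forall>m\<ge>N. \<forall>n\<ge>N. H1.nrm (s m - s n) < e" using Cauchy by blast
    then show "\<exists>N. \<forall>m\<ge>N. \<forall>n\<ge>N. L2.nrm (s m - s n) < e"
      using L2_nrm_le_H1_nrm(1)[OF diff] le_less_trans by blast
  qed
  then obtain u where u: "L2.lim_in s u" ..
  have "\<exists>l. L2.lim_in (\<lambda>n. weak_pderiv \<Omega> j (s n)) l" for j
  proof (rule L2_complete[OF H1D(2)[OF s]])
    fix e :: real assume "0 < e"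
    then obtain N where N: "\<forall>m\<ge>N. \<forall>n\<ge>N. H1.nrm (s m - s n) < e" using Cauchy by blast
    have "L2.nrm (weak_pderiv \<Omega> j (s m) - weak_pderiv \<Omega> j (s n)) \<le> H1.nrm (s m - s n)" for m n
      using L2_nrm_le_H1_nrm(2)[OF diff, of j] weak_pderiv_diff[OF s s] by simp
    with N show "\<exists>N. \<forall>m\<ge>N. \<forall>n\<ge>N. L2.nrm (weak_pderiv \<Omega> j (s m) - weak_pderiv \<Omega> j (s n)) < e"
      using le_less_trans by blast
  qed
  then obtain v where v: "\<And>j. L2.lim_in (\<lambda>n. weak_pderiv \<Omega> j (s n)) (v j)" by metis
  note uL = L2.lim_inD(2)[OF u] and vL = L2.lim_inD(2)[OF v]
  have weak: "has_weak_pderiv \<Omega> j u (v j)" for j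
    unfolding has_weak_pderiv_iff[OF uL vL]
  proof (intro allI impI)
    fix \<phi> :: "real^'n \<Rightarrow> complex" assume \<phi>: "test_function \<Omega> \<phi>"
    let ?D = "abs_ae_fun (\<lambda>x. cnj (pderiv_at j \<phi> x))" and ?p = "abs_ae_fun (\<lambda>x. cnj (\<phi> x))"
    have 1: "(\<lambda>n. L2_inner \<Omega> (s n) ?D) \<longlonglongrightarrow> L2_inner \<Omega> u ?D"
      by (rule L2.lim_inD(5)[OF u test_cnj_L2[OF test_function_pderiv[OF \<phi>]]])
    have 2: "(\<lambda>n. - L2_inner \<Omega> (weak_pderiv \<Omega> j (s n)) ?p) \<longlonglongrightarrow> - L2_inner \<Omega> (v j) ?p"
      by (rule tendsto_minus[OF L2.lim_inD(5)[OF v test_cnj_L2[OF \<phi>]]])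
    have "L2_inner \<Omega> (s n) ?D = - L2_inner \<Omega> (weak_pderiv \<Omega> j (s n)) ?p" for n
      using H1D(3)[OF s] \<phi> unfolding has_weak_pderiv_iff[OF H1D(1,2)[OF s]] by blast
    with 1 2 show "L2_inner \<Omega> u ?D = - L2_inner \<Omega> (v j) ?p" using LIMSEQ_unique by simp
  qed
  have uH: "u \<in> H1 \<Omega>" and Du: "weak_pderiv \<Omega> j u = v j" for j
    using H1I[OF uL vL weak] by auto
  have "(\<lambda>n. H1.nrm (s n - u)) \<longlonglongrightarrow> 0"
  proof -
    have "(H1.nrm (s n - u))\<^sup>2 = (L2.nrm (s n - u))\<^sup>2 + (\<Sum>j\<in>UNIV. (L2.nrm (weak_pderiv \<Omega> j (s n) - v j))\<^sup>2)" for n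
      using H1_nrm_sq[OF H1.diff_mem[OF s uH]] weak_pderiv_diff[OF s uH] Du by simp
    moreover have "(\<lambda>n. (L2.nrm (s n - u))\<^sup>2 + (\<Sum>j\<in>UNIV. (L2.nrm (weak_pderiv \<Omega> j (s n) - v j))\<^sup>2)) \<longlonglongrightarrow> 0\<^sup>2 + (\<Sum>j\<in>(UNIV::'n set). 0\<^sup>2)"
      by (intro tendsto_add tendsto_sum tendsto_power L2.lim_inD(3)[OF u] L2.lim_inD(3)[OF v])
    ultimately have "(\<lambda>n. (H1.nrm (s n - u))\<^sup>2) \<longlonglongrightarrow> 0" by simp
    then show ?thesis by simp
  qed
  then show ?thesis unfolding H1.lim_in_def using s uH by blast
qed

lemma test_H1:
  assumes \<phi>: "test_function \<Omega> \<phi>"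
  shows "abs_ae_fun \<phi> \<in> H1 \<Omega>" "weak_pderiv \<Omega> j (abs_ae_fun \<phi>) = abs_ae_fun (pderiv_at j \<phi>)"
proof -
  note L = test_L2[OF \<phi>] test_L2[OF test_function_pderiv[OF \<phi>]]
  have rep_int: "(LINT x|lebesgue. rep_ae_fun (abs_ae_fun \<eta>) x * \<psi> x) = (LINT x|lebesgue. \<eta> x * \<psi> x)"
    if "test_function \<Omega> \<eta>" "test_function \<Omega> \<psi>" for \<eta> \<psi>
  proof (rule integral_cong_AE)
    show "(\<lambda>x. rep_ae_fun (abs_ae_fun \<eta>) x * \<psi> x) \<in> borel_measurable lebesgue"
      using test_measurable[OF that(2)] by measurable
    show "(\<lambda>x. \<eta> x * \<psi> x) \<in> borel_measurable lebesgue"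
      using test_measurable[OF that(1)] test_measurable[OF that(2)] by measurable
    show "AE x in lebesgue. rep_ae_fun (abs_ae_fun \<eta>) x * \<psi> x = \<eta> x * \<psi> x"
      using AE_rep_abs_ae_fun[OF test_measurable[OF that(1)]] by eventually_elim simp
  qed
  have weak: "has_weak_pderiv \<Omega> j (abs_ae_fun \<phi>) (abs_ae_fun (pderiv_at j \<phi>))" for j
    unfolding has_weak_pderiv_def
  proof (intro allI impI)
    fix \<psi> :: "real^'n \<Rightarrow> complex" assume \<psi>: "test_function \<Omega> \<psi>"
    show "(LINT x:\<Omega>|lebesgue. rep_ae_fun (abs_ae_fun \<phi>) x * pderiv_at j \<psi> x) =
        - (LINT x:\<Omega>|lebesgue. rep_ae_fun (abs_ae_fun (pderiv_at j \<phi>)) x * \<psi> x)"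
      unfolding test_pairing(2)[OF L(1) test_function_pderiv[OF \<psi>]] test_pairing(2)[OF L(2) \<psi>]
        rep_int[OF \<phi> test_function_pderiv[OF \<psi>]] rep_int[OF test_function_pderiv[OF \<phi>] \<psi>]
      by (rule integration_by_parts[OF \<phi> \<psi>])
  qed
  show "abs_ae_fun \<phi> \<in> H1 \<Omega>" "weak_pderiv \<Omega> j (abs_ae_fun \<phi>) = abs_ae_fun (pderiv_at j \<phi>)"
    using H1I[OF L weak] by auto
qed

section \<open>The closure H^1_0 of the test functions\<close>

lemma H10D: "f \<in> H10 \<Omega> \<Longrightarrow> f \<in> H1 \<Omega>"
  and H10_approx: "f \<in> H10 \<Omega> \<Longrightarrow> 0 < e \<Longrightarrow> \<exists>\<phi>. test_function \<Omega> \<phi> \<and> H1.nrm (f - abs_ae_fun \<phi>) < e"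
  by (simp_all add: H10_def)

lemma test_H10: "test_function \<Omega> \<phi> \<Longrightarrow> abs_ae_fun \<phi> \<in> H10 \<Omega>"
  using test_H1(1) by (auto simp: H10_def intro!: exI[of _ \<phi>])

text \<open>\<open>H10\<close> is defined through approximation by test functions only. Allowing
  approximants from \<open>H10\<close> itself is what both the subspace property and completeness
  use.\<close>

lemma H10_closed:
  assumes "f \<in> H1 \<Omega>" "\<And>e. 0 < e \<Longrightarrow> \<exists>g\<in>H10 \<Omega>. H1.nrm (f - g) < e"
  shows "f \<in> H10 \<Omega>"
  unfolding H10_def
proof (intro CollectI conjI allI impI)
  show "f \<in> H1 \<Omega>" by (rule assms(1))
  fix e :: real assume e: "0 < e"
  obtain g where g: "g \<in> H10 \<Omega>" "H1.nrm (f - g) < e / 2" using assms(2)[of "e / 2"] e by auto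
  obtain \<phi> where \<phi>: "test_function \<Omega> \<phi>" "H1.nrm (g - abs_ae_fun \<phi>) < e / 2"
    using H10_approx[OF g(1), of "e / 2"] e by auto
  have "H1.nrm (f - abs_ae_fun \<phi>) < e"
    using H1.nrm_triangle3[OF assms(1) H10D[OF g(1)] test_H1(1)[OF \<phi>(1)]] g(2) \<phi>(2) by simp
  with \<phi>(1) show "\<exists>\<phi>. test_function \<Omega> \<phi> \<and> H1.nrm (f - abs_ae_fun \<phi>) < e" by blast
qed

lemma H10_subspace: "csubspace (H10 \<Omega>)"
  unfolding csubspace_def
proof (intro conjI ballI allI)
  show add: "f + g \<in> H10 \<Omega>" if f: "f \<in> H10 \<Omega>" and g: "g \<in> H10 \<Omega>" for f g
  proof (rule H10_closed)
    show "f + g \<in> H1 \<Omega>" using H10D f g by (intro H1.add_mem)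
    fix e :: real assume e: "0 < e"
    obtain \<phi> where \<phi>: "test_function \<Omega> \<phi>" "H1.nrm (f - abs_ae_fun \<phi>) < e / 2"
      using H10_approx[OF f, of "e / 2"] e by auto
    obtain \<psi> where \<psi>: "test_function \<Omega> \<psi>" "H1.nrm (g - abs_ae_fun \<psi>) < e / 2"
      using H10_approx[OF g, of "e / 2"] e by auto
    have "abs_ae_fun \<phi> + abs_ae_fun \<psi> \<in> H10 \<Omega>"
      using test_H10[OF test_function_add[OF \<phi>(1) \<psi>(1)]]
      by (simp add: abs_ae_fun_add test_measurable \<phi>(1) \<psi>(1))
    moreover have "H1.nrm (f + g - (abs_ae_fun \<phi> + abs_ae_fun \<psi>)) < e"
      using H1.nrm_triangle[OF H1.diff_mem[OF H10D[OF f] test_H1(1)[OF \<phi>(1)]] H1.diff_mem[OF H10D[OF g] test_H1(1)[OF \<psi>(1)]]]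
        \<phi>(2) \<psi>(2) by (simp add: algebra_simps)
    ultimately show "\<exists>h\<in>H10 \<Omega>. H1.nrm (f + g - h) < e" by blast
  qed
  show scale: "c *\<^sub>C f \<in> H10 \<Omega>" if f: "f \<in> H10 \<Omega>" for c f
  proof (rule H10_closed)
    show "c *\<^sub>C f \<in> H1 \<Omega>" using H10D f by (intro H1.scale_mem)
    fix e :: real assume e: "0 < e"
    have pos: "0 < cmod c + 1" using norm_ge_zero[of c] by linarith
    obtain \<phi> where \<phi>: "test_function \<Omega> \<phi>" "H1.nrm (f - abs_ae_fun \<phi>) < e / (cmod c + 1)"
      using H10_approx[OF f, of "e / (cmod c + 1)"] e pos by auto
    have d: "f - abs_ae_fun \<phi> \<in> H1 \<Omega>" by (rule H1.diff_mem[OF H10D[OF f] test_H1(1)[OF \<phi>(1)]])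
    have "H1.nrm (c *\<^sub>C f - c *\<^sub>C abs_ae_fun \<phi>) = cmod c * H1.nrm (f - abs_ae_fun \<phi>)"
      using H1.nrm_scale[OF d] by (simp add: scaleC_diff_right)
    also have "\<dots> \<le> (cmod c + 1) * H1.nrm (f - abs_ae_fun \<phi>)"
      using H1.nrm_ge_0[OF d] by (intro mult_right_mono) auto
    also have "\<dots> < e" using \<phi>(2) pos by (simp add: field_simps)
    finally have "H1.nrm (c *\<^sub>C f - c *\<^sub>C abs_ae_fun \<phi>) < e" .
    moreover have "c *\<^sub>C abs_ae_fun \<phi> \<in> H10 \<Omega>"
      using test_H10[OF test_function_scale[OF \<phi>(1), of c]] abs_ae_fun_scale[OF test_measurable[OF \<phi>(1)], of c] by simp
    ultimately show "\<exists>h\<in>H10 \<Omega>. H1.nrm (c *\<^sub>C f - h) < e" by blast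
  qed
  have "test_function \<Omega> (\<lambda>x. 0)"
  proof -
    have "C_k k (\<lambda>x::real^'n. 0::complex)" for k by (rule smooth_fun_C_k[OF smooth_fun.const])
    then show ?thesis by (simp add: test_function_def)
  qed
  from test_H10[OF test_function_scale[OF this, of 0]] scale[OF test_H10[OF this], of 0]
  show "0 \<in> H10 \<Omega>" by simp
qed

lemma H10_hilbert: "hilbert (H10 \<Omega>) (H1_inner \<Omega>)"
proof -
  have sub: "H10 \<Omega> \<subseteq> H1 \<Omega>" using H10D by blast
  interpret s: semi_inner "H10 \<Omega>" "H1_inner \<Omega>" by (rule H1.subspace_semi_inner[OF H10_subspace sub])
  show ?thesis
  proof
    show "x = 0" if "x \<in> H10 \<Omega>" "H1.nrm x = 0" for x by (rule H1_definite[OF H10D[OF that(1)] that(2)])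
    fix s :: "nat \<Rightarrow> 'n ae_fun"
    assume s: "\<And>n. s n \<in> H10 \<Omega>" and Cauchy: "\<And>e. 0 < e \<Longrightarrow> \<exists>N. \<forall>m\<ge>N. \<forall>n\<ge>N. H1.nrm (s m - s n) < e"
    obtain l where l: "H1.lim_in s l" using H1_complete[OF H10D[OF s] Cauchy] by blast
    have lH: "l \<in> H1 \<Omega>" by (rule H1.lim_inD(2)[OF l])
    have "l \<in> H10 \<Omega>"
    proof (rule H10_closed[OF lH])
      fix e :: real assume e: "0 < e"
      obtain n where "\<bar>H1.nrm (s n - l)\<bar> < e"
        using LIMSEQ_D[OF H1.lim_inD(3)[OF l] e] by auto
      then have "H1.nrm (l - s n) < e" using H1.nrm_minus_commute[OF lH H10D[OF s], of n] by simp
      then show "\<exists>g\<in>H10 \<Omega>. H1.nrm (l - g) < e" using s by blast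
    qed
    then show "\<exists>x. s.lim_in s x" unfolding s.lim_in_def using s H1.lim_inD(3)[OF l] by blast
  qed
qed

lemma L2_nrm_cong:
  assumes "f \<in> L2 \<Omega>" "g \<in> L2 \<Omega>" "AE x in lebesgue. cmod (rep_ae_fun f x) = cmod (rep_ae_fun g x)"
  shows "L2.nrm f = L2.nrm g"
proof -
  have "(LINT x|lebesgue. (cmod (rep_ae_fun f x))\<^sup>2) = (LINT x|lebesgue. (cmod (rep_ae_fun g x))\<^sup>2)"
  proof (rule integral_cong_AE)
    show "AE x in lebesgue. (cmod (rep_ae_fun f x))\<^sup>2 = (cmod (rep_ae_fun g x))\<^sup>2"
      using assms(3) by eventually_elim simp
  qed measurable
  then have "(L2.nrm f)\<^sup>2 = (L2.nrm g)\<^sup>2" by (simp add: L2_nrm_sq assms(1,2))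
  then show ?thesis using L2.nrm_ge_0 assms(1,2) by (simp add: power2_eq_iff_nonneg)
qed

text \<open>The modulated bumps \<open>\<phi> e\<^sup>i\<^sup>k\<^sup>x\<close> have constant \<open>L\<^sup>2\<close> norm and derivatives of order \<open>k\<close>.\<close>

lemma H1_nrm_unbounded:
  assumes "\<Omega> \<noteq> {}"
  shows "\<exists>h\<in>H10 \<Omega>. C * L2.nrm h < H1.nrm h"
proof -
  obtain p where p: "p \<in> \<Omega>" using assms by blast
  obtain a b where ab: "cbox a b \<subseteq> \<Omega>" "p \<in> box a b"
    using open_contains_cbox[of \<Omega> p] open_\<Omega> p by metis
  define \<phi> where "\<phi> = box_bump 0 a b"
  have \<phi>_smooth: "smooth_fun \<phi>" unfolding \<phi>_def by (rule box_bump_smooth)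
  have \<phi>_supp: "{x. \<phi> x \<noteq> 0} \<subseteq> cbox a b"
    unfolding \<phi>_def box_bump_nonzero_iff by (auto simp: box_subset_cbox[THEN subsetD])
  have \<phi>: "test_function \<Omega> \<phi>" by (rule test_functionI[OF \<phi>_smooth \<phi>_supp ab(1)])
  \<comment> \<open>Any coordinate direction serves; the index type is inhabited.\<close>
  obtain j :: 'n where True by simp
  define \<psi> where "\<psi> = pderiv_at j \<phi>"
  have \<psi>_smooth: "smooth_fun \<psi>" unfolding \<psi>_def by (rule smooth_fun_pderiv[OF \<phi>_smooth])
  have \<psi>_supp: "{x. \<psi> x \<noteq> 0} \<subseteq> cbox a b"
    using pderiv_at_zero_outside[of _ \<phi> j] closure_minimal[OF \<phi>_supp closed_cbox] unfolding \<psi>_def by blast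
  have \<psi>: "test_function \<Omega> \<psi>" by (rule test_functionI[OF \<psi>_smooth \<psi>_supp ab(1)])
  define N M where "N = L2.nrm (abs_ae_fun \<phi>)" and "M = L2.nrm (abs_ae_fun \<psi>)"
  \<comment> \<open>The bump vanishes nowhere on \<open>box a b\<close>, a nonempty open set, which
    cannot be a null set.\<close>
  have "N \<noteq> 0"
  proof
    assume "N = 0"
    then have "abs_ae_fun \<phi> = 0" unfolding N_def by (rule L2_definite[OF test_L2[OF \<phi>]])
    then have "AE x in lebesgue. \<phi> x = 0"
      using AE_rep_abs_ae_fun[OF test_measurable[OF \<phi>]] AE_rep_zero by (auto elim: eventually_elim2)
    then have "AE x in lebesgue. x \<notin> box a b"
      unfolding \<phi>_def by eventually_elim (metis box_bump_nonzero_iff)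
    then have "box a b \<in> null_sets lebesgue" by (subst AE_iff_null_sets) simp_all
    then have "negligible (box a b)" by (simp add: negligible_iff_null_sets)
    then show False using ab(2) open_not_negligible[OF open_box] by blast
  qed
  then have N: "0 < N" using L2.nrm_ge_0[OF test_L2[OF \<phi>]] unfolding N_def by linarith
  \<comment> \<open>The derivative of the modulated bump along \<open>j\<close> differs from a term
    of norm \<open>k * N\<close> by a term of norm \<open>M\<close>. This \<open>k\<close> gives
    \<open>k * N\<close> the value \<open>\<bar>C\<bar> * N + M + N\<close>, which exceeds
    \<open>C * N + M\<close>.\<close>
  define k where "k = \<bar>C\<bar> + M / N + 1"
  have M: "0 \<le> M" unfolding M_def by (rule L2.nrm_ge_0[OF test_L2[OF \<psi>]])
  have "k * N = \<bar>C\<bar> * N + M + N" using N by (simp add: k_def distrib_right)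
  moreover have "C * N \<le> \<bar>C\<bar> * N" using N by (intro mult_right_mono) auto
  ultimately have k_large: "C * N + M < k * N" using N by linarith
  have k_nonneg: "0 \<le> k" using N M by (simp add: k_def)
  define f g where "f x = \<phi> x * cis (k * x $ j)" and "g x = \<psi> x * cis (k * x $ j)" for x
  have f: "test_function \<Omega> f"
    unfolding f_def by (rule test_functionI[OF smooth_fun.mult[OF \<phi>_smooth smooth_fun.osc] _ ab(1)]) (use \<phi>_supp in auto)
  have g: "test_function \<Omega> g"
    unfolding g_def by (rule test_functionI[OF smooth_fun.mult[OF \<psi>_smooth smooth_fun.osc] _ ab(1)]) (use \<psi>_supp in auto)
  have f_nrm: "L2.nrm (abs_ae_fun f) = N"
    unfolding N_def
  proof (rule L2_nrm_cong[OF test_L2[OF f] test_L2[OF \<phi>]])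
    show "AE x in lebesgue. cmod (rep_ae_fun (abs_ae_fun f) x) = cmod (rep_ae_fun (abs_ae_fun \<phi>) x)"
      using AE_rep_abs_ae_fun[OF test_measurable[OF f]] AE_rep_abs_ae_fun[OF test_measurable[OF \<phi>]]
      by eventually_elim (simp add: f_def norm_mult)
  qed
  have g_nrm: "L2.nrm (abs_ae_fun g) = M"
    unfolding M_def
  proof (rule L2_nrm_cong[OF test_L2[OF g] test_L2[OF \<psi>]])
    show "AE x in lebesgue. cmod (rep_ae_fun (abs_ae_fun g) x) = cmod (rep_ae_fun (abs_ae_fun \<psi>) x)"
      using AE_rep_abs_ae_fun[OF test_measurable[OF g]] AE_rep_abs_ae_fun[OF test_measurable[OF \<psi>]]
      by eventually_elim (simp add: g_def norm_mult)
  qed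
  have "pderiv_at j f x = g x + (\<i> * of_real k) * f x" for x
  proof -
    have D: "(\<phi> has_derivative frechet_derivative \<phi> (at x)) (at x)"
      using smooth_fun_differentiable[OF \<phi>_smooth] frechet_derivative_works by blast
    have "((\<lambda>x. k * x $ j) has_derivative (\<lambda>h. k * h $ j)) (at x)"
      by (auto intro!: derivative_eq_intros bounded_linear.has_derivative[OF bounded_linear_vec_nth])
    from has_derivative_mult[OF D has_derivative_cis[OF this]]
    have "pderiv_at j f x = \<phi> x * ((k * axis j 1 $ j) *\<^sub>R (\<i> * cis (k * x $ j))) + \<psi> x * cis (k * x $ j)"
      unfolding f_def[abs_def] \<psi>_def pderiv_at_def[of j \<phi>] by (rule has_derivative_pderiv_at)
    then show ?thesis by (simp add: f_def g_def scaleR_conv_of_real)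
  qed
  then have pd: "pderiv_at j f = (\<lambda>x. g x + (\<i> * of_real k) * f x)" by blast
  have eq: "abs_ae_fun (pderiv_at j f) = abs_ae_fun g + (\<i> * of_real k) *\<^sub>C abs_ae_fun f"
    unfolding pd using test_measurable[OF f] test_measurable[OF g]
    by (simp add: abs_ae_fun_add abs_ae_fun_scale)
  note fL = test_L2[OF f] and gL = test_L2[OF g]
  have kf: "(\<i> * of_real k) *\<^sub>C abs_ae_fun f \<in> L2 \<Omega>" by (rule L2_closed(3)[OF fL])
  have "k * N = L2.nrm ((\<i> * of_real k) *\<^sub>C abs_ae_fun f)"
    unfolding L2.nrm_scale[OF fL] f_nrm using k_nonneg by (simp add: norm_mult)
  also have "\<dots> \<le> L2.nrm (abs_ae_fun (pderiv_at j f)) + L2.nrm (abs_ae_fun g)"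
    using L2.nrm_triangle_diff[OF L2_closed(2)[OF gL kf] gL] unfolding eq by simp
  also have "L2.nrm (abs_ae_fun (pderiv_at j f)) \<le> H1.nrm (abs_ae_fun f)"
    using L2_nrm_le_H1_nrm(2)[OF test_H1(1)[OF f], of j] unfolding test_H1(2)[OF f] .
  finally have "C * L2.nrm (abs_ae_fun f) < H1.nrm (abs_ae_fun f)"
    using k_large f_nrm g_nrm by simp
  then show ?thesis using test_H10[OF f] by blast
qed

lemma H10_two_inner: "two_inner (H10 \<Omega>) (H1_inner \<Omega>) (L2_inner \<Omega>)"
proof -
  have mem: "f \<in> H10 \<Omega> \<Longrightarrow> f \<in> L2 \<Omega>" for f using H1D(1)[OF H10D] .
  interpret h: hilbert "H10 \<Omega>" "H1_inner \<Omega>" by (rule H10_hilbert)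
  interpret l: semi_inner "H10 \<Omega>" "L2_inner \<Omega>"
    by (rule L2.subspace_semi_inner[OF H10_subspace]) (use mem in blast)
  show ?thesis
  proof
    show "f = 0" if "f \<in> H10 \<Omega>" "L2.nrm f = 0" for f by (rule L2_definite[OF mem[OF that(1)] that(2)])
    show "Re (L2_inner \<Omega> f f) \<le> Re (H1_inner \<Omega> f f)" if "f \<in> H10 \<Omega>" for f
      using H1D(2)[OF H10D[OF that]] by (simp add: H1_inner_def L2.nonneg sum_nonneg)
  qed
qed

end

theorem corollary5p4:
  fixes \<Omega> :: "(real^'n::finite) set"
  assumes "open \<Omega>" and "\<Omega> \<noteq> {}"
  shows "group (op_group \<Omega> (GG \<Omega>)) \<and> group (op_group \<Omega> (UU_R \<Omega>)) \<and>
    U_map \<Omega> \<in> iso (op_group \<Omega> (GG \<Omega>)) (op_group \<Omega> (UU_R \<Omega>)) \<and>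
    continuous_map (op_topology \<Omega> (GG \<Omega>)) (op_topology \<Omega> (UU_R \<Omega>)) (U_map \<Omega>) \<and>
    \<not> continuous_map (op_topology \<Omega> (UU_R \<Omega>)) (op_topology \<Omega> (GG \<Omega>))
        (inv_into (GG \<Omega>) (U_map \<Omega>))"
proof -
  interpret open_domain \<Omega> by unfold_locales (rule assms(1))
  interpret t: two_inner "H10 \<Omega>" "H1_inner \<Omega>" "L2_inner \<Omega>" by (rule H10_two_inner)
  have S: "t.S = A_half \<Omega>" by (simp add: t.S_def t.A_def A_half_def A_op_def)
  have G: "t.isom = GG \<Omega>" by (simp add: t.isom_def GG_def)
  have U: "t.unit_R = UU_R \<Omega>" by (simp add: t.unit_R_def UU_R_def S)
  have m: "t.Umap = U_map \<Omega>" by (rule ext) (simp add: t.Umap_def U_map_def S)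
  show ?thesis
    using t.group_isom t.group_unit_R t.Umap_iso t.Umap_continuous
      t.inv_Umap_discontinuous[OF H1_nrm_unbounded[OF assms(2)]]
    unfolding G U m by (intro conjI)
qed

end
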